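(* Let $\mathbf F$, $\lambda$, $\bar\mu$, $(\bar\mu_h)$, $(\tau(h))$, $T,L$, $(M_h,\mathbf F_h,\boldsymbol\eta_h)$, $\hat{\mathbf F}$ be as follows: $\mathbf F\subset\mathcal P_2(\mathsf{TX})$ is an MPVF whose barycentric field $\bar{\mathbf F}$ is totally $\lambda$-dissipative; $\bar\mu,\bar\mu_h\in D(\mathbf F)$ with $W_2(\bar\mu_h,\bar\mu)\to0$; $\tau(h)>0$, $\tau(h)\to0$; $T,L>0$; $(M_h,\mathbf F_h,\boldsymbol\eta_h)\in\mathscr T(\bar\mu_h,\tau(h),T,L)$; $\hat{\mathbf F}$ is a maximal totally $\lambda$-dissipative extension of $\bar{\mathbf F}$; and the Explicit Euler scheme for $\mathbf F$ is approximately solvable at $\bar\mu$ up to time $T$. Let $(\Omega,\mathcal B)$ be a standard Borel space with a non-atomic probability measure $\mathbb P$. Let $\bar X,\bar X_h\in L^2(\Omega,\mathcal B,\mathbb P;\mathsf X)$ with $\bar X_\sharp\mathbb P=\bar\mu$, $(\bar X_h)_\sharp\mathbb P=\bar\mu_h$, and let $\mathrm Z_h\in L^2(\Omega,\mathcal B,\mathbb P;\mathrm C([0,T];\mathsf X))$ with $(\mathrm Z_h)_\sharp\mathbb P=\boldsymbol\eta_h$ for every $h$. If $\bar X_h\to\bar X$ $\mathbb P$-a.s. and $\mathsf e_0\circ\mathrm Z_h=\bar X_h$ for every $h$, then $\mathrm Z_h\to\mathrm X$ in $L^2(\Omega,\mathcal B,\mathbb P;\mathrm C([0,T];\mathsf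 X))$, where $\mathrm X$ is the Lagrangian solution of $\hat{\mathbf F}$ starting from $\bar X$.
   Context: $\mathsf X$ separable Hilbert space; $\mathsf{TX}=\mathsf X\times\mathsf X$; $\mathcal P_2$, $W_2$, $\Gamma(\mu,\nu)$ as usual; $\mathsf x(x,v)=x$, $\exp^t(x,v)=x+tv$, $\mathsf e_t(\gamma)=\gamma(t)$, $|\Phi|_2^2=\int|v|^2d\Phi$. MPVF: nonempty $\mathbf F\subset\mathcal P_2(\mathsf{TX})$, $D(\mathbf F)=\{\mathsf x_\sharp\Phi:\Phi\in\mathbf F\}$, $\mathbf F[\mu]=\{\Phi\in\mathbf F:\mathsf x_\sharp\Phi=\mu\}$. Barycenter $b_\Phi(x)=\int v\,d\Phi_x(v)$ ($\{\Phi_x\}$ disintegration w.r.t. $\mathsf x_\sharp\Phi$), $\bar{\mathbf F}[\mu]=\{(\mathrm{id},b_\Phi)_\sharp\mu:\Phi\in\mathbf F[\mu]\}$. Totally $\lambda$-dissipative: $\int\langle v_1-v_0,x_1-x_0\rangle d\vartheta\le\lambda\int|x_1-x_0|^2d\vartheta$ for all $\Phi_0,\Phi_1$ in the MPVF and all $\vartheta\in\Gamma(\Phi_0,\Phi_1)$; maximal = maximal w.r.t. inclusion in this class. Explicit Euler scheme: for $\tau>0$, $N=\lceil T/\tau\rceil$, an $L$-stable solution from $\bar\mu$ is $(M^n,\Phi^n)_{0\le n\le N}$ with $M^0=\bar\mu$, $\Phi^n\in\mathbf F[M^n]$, $|\Phi^n|_2\le L$ ($n<N$), $M^n=(\exp^\tau)_\sharp\Phi^{n-1}$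 ($n\ge1$). $M_\tau(t)=(\exp^{t-n\tau})_\sharp\Phi^n$ on $[n\tau,(n+1)\tau]$, $\mathbf F_\tau(t)=\Phi^{\lfloor t/\tau\rfloor}$. With $T^n=(\mathsf x,\exp^\tau)_\sharp\Phi^n$ disintegrated as $\{T^n_x\}$ w.r.t. first marginal, $\alpha^1=T^0$, $\alpha^n=\int\delta_{(x_0,\dots,x_{n-1})}\otimes T^{n-1}_{x_{n-1}}d\alpha^{n-1}$, $\boldsymbol\eta_\tau=G_\sharp\alpha^N$ where $G$ maps $(x_0,\dots,x_N)$ to the curve on $[0,T]$ affine on each $[n\tau,(n+1)\tau]\cap[0,T]$ with value $x_n$ at $n\tau$. $\mathscr E(\bar\mu,\tau,T,L)$ / $\mathscr T(\bar\mu,\tau,T,L)$: sets of pairs $(M_\tau,\mathbf F_\tau)$ / triples $(M_\tau,\mathbf F_\tau,\boldsymbol\eta_\tau)$ from $L$-stable solutions. Approximate solvability at $\bar\mu$ up to $T$: there exist $\bar\tau,L'>0$ and finitely supported $\bar\mu^j\in D(\mathbf F)$ with $W_2(\bar\mu^j,\bar\mu)\to0$ and $\mathscr E(\bar\mu^j,\tau,T,L')\neq\emptyset$ for all $0<\tau<\bar\tau$, $j\in\mathbb N$. Lagrangian solution: the Lagrangian representation of $\hat{\mathbf F}$ is the operator $\mathbf B=\{(X,V)\in L^2(\Omega;\mathsf X)^2:(X,V)_\sharp\mathbb P\in\hat{\mathbf F}\}$, which is maximal $\lambda$-dissipative; since $\bar\mu\in D(\hat{\mathbf F})$, there is a unique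 locally Lipschitz curve $t\mapsto X_t\in L^2(\Omega;\mathsf X)$ with $X_0=\bar X$ and $\dot X_t\in\mathbf B X_t$ for a.e. $t$; the map $\omega\mapsto(t\mapsto X_t(\omega))$ has a version $\mathrm X:\Omega\to H^1(0,T;\mathsf X)\subset\mathrm C([0,T];\mathsf X)$ (it is $\mathrm s_{\bar\mu}\circ\bar X$, where $\mathrm s_{\bar\mu}[x](t)$ is the Lagrangian flow map of $\hat{\mathbf F}$ at time $t$ evaluated at $(x,\bar\mu)$). *)

theory Defs
  imports "HOL-Probability.Probability"
begin

text \<open>Ambient space: a separable real Hilbert space, i.e. a type of sort
  {real_inner, complete_space, second_countable_topology}.  Probability
  measures are Borel measures on the relevant type.\<close>

definition P2 :: "'c::real_normed_vector measure set" where
  "P2 = {M. prob_space M \<and> sets M = sets borel \<and> (\<integral>\<^sup>+x. ennreal ((norm x)\<^sup>2) \<partial>M) < \<infinity>}"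

definition Gamma :: "'c::topological_space measure \<Rightarrow> 'd::topological_space measure
    \<Rightarrow> ('c \<times> 'd) measure set" where
  "Gamma \<mu> \<nu> = {\<gamma>. prob_space \<gamma> \<and> sets \<gamma> = sets borel
      \<and> distr \<gamma> borel fst = \<mu> \<and> distr \<gamma> borel snd = \<nu>}"

definition W2 :: "'c::{real_normed_vector, second_countable_topology} measure \<Rightarrow> 'c measure \<Rightarrow> real" where
  "W2 \<mu> \<nu> = sqrt (Inf {(\<integral>p. (norm (fst p - snd p))\<^sup>2 \<partial>\<gamma>) | \<gamma>. \<gamma> \<in> Gamma \<mu> \<nu>})"

definition norm2 :: "('a::real_normed_vector \<times> 'a) measure \<Rightarrow> real" where
  "norm2 \<Phi> = sqrt (\<integral>p. (norm (snd p))\<^sup>2 \<partial>\<Phi>)"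

definition is_MPVF :: "('a::real_normed_vector \<times> 'a) measure set \<Rightarrow> bool" where
  "is_MPVF F \<longleftrightarrow> F \<noteq> {} \<and> F \<subseteq> P2"

definition dom_F :: "('a::{real_normed_vector,second_countable_topology} \<times> 'a) measure set \<Rightarrow> 'a measure set" where
  "dom_F F = (\<lambda>\<Phi>. distr \<Phi> borel fst) ` F"

definition fiber :: "('a::{real_normed_vector,second_countable_topology} \<times> 'a) measure set \<Rightarrow> 'a measure
    \<Rightarrow> ('a \<times> 'a) measure set" where
  "fiber F \<mu> = {\<Phi> \<in> F. distr \<Phi> borel fst = \<mu>}"

definition disint :: "'c::topological_space measure \<Rightarrow> ('c \<times> 'd::topological_space) measure
    \<Rightarrow> ('c \<Rightarrow> 'd measure) \<Rightarrow> bool" where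
  "disint \<mu> \<Phi> K \<longleftrightarrow> (\<forall>x. prob_space (K x) \<and> sets (K x) = sets borel)
     \<and> (\<forall>B \<in> sets borel. (\<lambda>x. emeasure (K x) B) \<in> borel_measurable \<mu>)
     \<and> (\<forall>C \<in> sets borel. emeasure \<Phi> C = (\<integral>\<^sup>+x. emeasure (K x) (Pair x -` C) \<partial>\<mu>))"

definition barF :: "('a::{real_inner,complete_space,second_countable_topology} \<times> 'a) measure set
    \<Rightarrow> ('a \<times> 'a) measure set" where
  "barF F = {distr \<mu> borel (\<lambda>x. (x, \<integral>v. v \<partial>(K x))) | \<mu> \<Phi> K.
       \<Phi> \<in> F \<and> \<mu> = distr \<Phi> borel fst \<and> disint \<mu> \<Phi> K}"

definition tdiss :: "real \<Rightarrow> ('a::{real_inner,complete_space,second_countable_topology} \<times> 'a) measure set \<Rightarrow> bool" where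
  "tdiss lam F \<longleftrightarrow> (\<forall>\<Phi>0\<in>F. \<forall>\<Phi>1\<in>F. \<forall>\<theta>\<in>Gamma \<Phi>0 \<Phi>1.
      (\<integral>q. inner (snd (snd q) - snd (fst q)) (fst (snd q) - fst (fst q)) \<partial>\<theta>)
        \<le> lam * (\<integral>q. (norm (fst (snd q) - fst (fst q)))\<^sup>2 \<partial>\<theta>))"

definition max_tdiss :: "real \<Rightarrow> ('a::{real_inner,complete_space,second_countable_topology} \<times> 'a) measure set \<Rightarrow> bool" where
  "max_tdiss lam F \<longleftrightarrow> is_MPVF F \<and> tdiss lam F \<and>
     (\<forall>G. is_MPVF G \<and> tdiss lam G \<and> F \<subseteq> G \<longrightarrow> G = F)"

definition stepN :: "real \<Rightarrow> real \<Rightarrow> nat" where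
  "stepN \<tau> T = nat \<lceil>T / \<tau>\<rceil>"

definition Lstable :: "('a::{real_inner,complete_space,second_countable_topology} \<times> 'a) measure set
    \<Rightarrow> 'a measure \<Rightarrow> real \<Rightarrow> real \<Rightarrow> real \<Rightarrow> (nat \<Rightarrow> 'a measure) \<Rightarrow> (nat \<Rightarrow> ('a \<times> 'a) measure) \<Rightarrow> bool" where
  "Lstable F \<mu> \<tau> T L M \<Phi> \<longleftrightarrow> M 0 = \<mu>
     \<and> (\<forall>n \<le> stepN \<tau> T. \<Phi> n \<in> fiber F (M n))
     \<and> (\<forall>n < stepN \<tau> T. norm2 (\<Phi> n) \<le> L)
     \<and> (\<forall>n. 1 \<le> n \<and> n \<le> stepN \<tau> T \<longrightarrow> M n = distr (\<Phi> (n - 1)) borel (\<lambda>p. fst p + \<tau> *\<^sub>R snd p))"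

definition Mtau :: "real \<Rightarrow> (nat \<Rightarrow> ('a::{real_inner,complete_space,second_countable_topology} \<times> 'a) measure)
    \<Rightarrow> real \<Rightarrow> 'a measure" where
  "Mtau \<tau> \<Phi> t = distr (\<Phi> (nat \<lfloor>t / \<tau>\<rfloor>)) borel
      (\<lambda>p. fst p + (t - real (nat \<lfloor>t / \<tau>\<rfloor>) * \<tau>) *\<^sub>R snd p)"

definition Ftau :: "real \<Rightarrow> (nat \<Rightarrow> ('a \<times> 'a) measure) \<Rightarrow> real \<Rightarrow> ('a \<times> 'a) measure" where
  "Ftau \<tau> \<Phi> t = \<Phi> (nat \<lfloor>t / \<tau>\<rfloor>)"

definition Tn :: "real \<Rightarrow> ('a::{real_inner,complete_space,second_countable_topology} \<times> 'a) measure \<Rightarrow> ('a \<times> 'a) measure" where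
  "Tn \<tau> \<Phi> = distr \<Phi> borel (\<lambda>p. (fst p, fst p + \<tau> *\<^sub>R snd p))"

abbreviation seqM :: "nat \<Rightarrow> (nat \<Rightarrow> 'a::topological_space) measure" where
  "seqM n \<equiv> Pi\<^sub>M {0..n} (\<lambda>_. borel)"

text \<open>alpha Ts K m is \<open>\<alpha>^{m+1}\<close>: \<open>\<alpha>^1 = T^0\<close>, and
  \<open>\<alpha>^{m+2} = \<integral> \<delta>_{(x_0..x_{m+1})} \<otimes> T^{m+1}_{x_{m+1}} d\<alpha>^{m+1}\<close>,
  where K n is a disintegration of Ts n w.r.t. its first marginal.\<close>
fun alpha :: "(nat \<Rightarrow> ('a::topological_space \<times> 'a) measure) \<Rightarrow> (nat \<Rightarrow> 'a \<Rightarrow> 'a measure)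
    \<Rightarrow> nat \<Rightarrow> (nat \<Rightarrow> 'a) measure" where
  "alpha Ts K 0 = distr (Ts 0) (seqM 1) (\<lambda>p. \<lambda>i\<in>{0..1}. if i = 0 then fst p else snd p)"
| "alpha Ts K (Suc m) = measure_of (space (seqM (Suc (Suc m)))) (sets (seqM (Suc (Suc m))))
      (\<lambda>C. \<integral>\<^sup>+x. emeasure (K (Suc m) (x (Suc m))) {y. x(Suc (Suc m) := y) \<in> C} \<partial>(alpha Ts K m))"

text \<open>Path space \<open>C([0,T];X)\<close> modelled by extensional functions on \<open>[0,T]\<close>
  with the (product = Borel on continuous paths) \<sigma>-algebra.\<close>
abbreviation pathM :: "real \<Rightarrow> (real \<Rightarrow> 'a::topological_space) measure" where
  "pathM T \<equiv> Pi\<^sub>M {0..T} (\<lambda>_. borel)"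

definition Gmap :: "real \<Rightarrow> real \<Rightarrow> (nat \<Rightarrow> 'a::real_vector) \<Rightarrow> real \<Rightarrow> 'a" where
  "Gmap \<tau> T x = (\<lambda>t\<in>{0..T}. let n = min (nat \<lfloor>t / \<tau>\<rfloor>) (stepN \<tau> T - 1) in
      x n + ((t - real n * \<tau>) / \<tau>) *\<^sub>R (x (Suc n) - x n))"

definition eta :: "real \<Rightarrow> real \<Rightarrow> (nat \<Rightarrow> ('a::{real_inner,complete_space,second_countable_topology} \<times> 'a) measure)
    \<Rightarrow> (nat \<Rightarrow> 'a \<Rightarrow> 'a measure) \<Rightarrow> (real \<Rightarrow> 'a) measure" where
  "eta \<tau> T \<Phi> K = distr (alpha (\<lambda>n. Tn \<tau> (\<Phi> n)) K (stepN \<tau> T - 1)) (pathM T) (Gmap \<tau> T)"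

definition Esol :: "('a::{real_inner,complete_space,second_countable_topology} \<times> 'a) measure set
    \<Rightarrow> 'a measure \<Rightarrow> real \<Rightarrow> real \<Rightarrow> real \<Rightarrow> ((real \<Rightarrow> 'a measure) \<times> (real \<Rightarrow> ('a \<times> 'a) measure)) set" where
  "Esol F \<mu> \<tau> T L = {(Mtau \<tau> \<Phi>, Ftau \<tau> \<Phi>) | M \<Phi>. Lstable F \<mu> \<tau> T L M \<Phi>}"

definition Tsol :: "('a::{real_inner,complete_space,second_countable_topology} \<times> 'a) measure set
    \<Rightarrow> 'a measure \<Rightarrow> real \<Rightarrow> real \<Rightarrow> real
    \<Rightarrow> ((real \<Rightarrow> 'a measure) \<times> (real \<Rightarrow> ('a \<times> 'a) measure) \<times> (real \<Rightarrow> 'a) measure) set" where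
  "Tsol F \<mu> \<tau> T L = {(Mtau \<tau> \<Phi>, Ftau \<tau> \<Phi>, eta \<tau> T \<Phi> K) | M \<Phi> K. Lstable F \<mu> \<tau> T L M \<Phi>
      \<and> (\<forall>n < stepN \<tau> T. disint (distr (Tn \<tau> (\<Phi> n)) borel fst) (Tn \<tau> (\<Phi> n)) (K n))}"

definition finitely_supported :: "'c::t1_space measure \<Rightarrow> bool" where
  "finitely_supported \<mu> \<longleftrightarrow> (\<exists>S. finite S \<and> emeasure \<mu> (UNIV - S) = 0)"

definition approx_solvable :: "('a::{real_inner,complete_space,second_countable_topology} \<times> 'a) measure set
    \<Rightarrow> 'a measure \<Rightarrow> real \<Rightarrow> bool" where
  "approx_solvable F \<mu> T \<longleftrightarrow> (\<exists>\<tau>0 L' \<mu>s. \<tau>0 > 0 \<and> L' > 0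
     \<and> (\<forall>j. finitely_supported (\<mu>s j) \<and> \<mu>s j \<in> dom_F F)
     \<and> (\<lambda>j. W2 (\<mu>s j) \<mu>) \<longlonglongrightarrow> 0
     \<and> (\<forall>\<tau> j. 0 < \<tau> \<and> \<tau> < \<tau>0 \<longrightarrow> Esol F (\<mu>s j) \<tau> T L' \<noteq> {}))"

definition atomless :: "'b measure \<Rightarrow> bool" where
  "atomless P \<longleftrightarrow> (\<forall>A \<in> sets P. emeasure P A > 0 \<longrightarrow>
      (\<exists>B \<in> sets P. B \<subseteq> A \<and> 0 < emeasure P B \<and> emeasure P B < emeasure P A))"

definition L2 :: "'b measure \<Rightarrow> ('b \<Rightarrow> 'a::{real_normed_vector,second_countable_topology}) set" where
  "L2 P = {X. X \<in> borel_measurable P \<and> integrable P (\<lambda>\<omega>. (norm (X \<omega>))\<^sup>2)}"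

definition L2dist :: "'b measure \<Rightarrow> ('b \<Rightarrow> 'a::real_normed_vector) \<Rightarrow> ('b \<Rightarrow> 'a) \<Rightarrow> real" where
  "L2dist P X Y = sqrt (\<integral>\<omega>. (norm (X \<omega> - Y \<omega>))\<^sup>2 \<partial>P)"

definition lagr_op :: "'b measure \<Rightarrow> ('a::{real_inner,complete_space,second_countable_topology} \<times> 'a) measure set
    \<Rightarrow> (('b \<Rightarrow> 'a) \<times> ('b \<Rightarrow> 'a)) set" where
  "lagr_op P G = {(X, V). X \<in> L2 P \<and> V \<in> L2 P \<and> distr P borel (\<lambda>\<omega>. (X \<omega>, V \<omega>)) \<in> G}"

definition lagr_curve :: "'b measure \<Rightarrow> ('a::{real_inner,complete_space,second_countable_topology} \<times> 'a) measure set
    \<Rightarrow> real \<Rightarrow> ('b \<Rightarrow> 'a) \<Rightarrow> (real \<Rightarrow> 'b \<Rightarrow> 'a) \<Rightarrow> bool" where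
  "lagr_curve P G T Xb Xt \<longleftrightarrow> (\<forall>t\<in>{0..T}. Xt t \<in> L2 P)
     \<and> (AE \<omega> in P. Xt 0 \<omega> = Xb \<omega>)
     \<and> (\<exists>C. \<forall>s\<in>{0..T}. \<forall>t\<in>{0..T}. L2dist P (Xt s) (Xt t) \<le> C * \<bar>s - t\<bar>)
     \<and> (AE t in lborel. t \<in> {0<..<T} \<longrightarrow>
          (\<exists>V. (Xt t, V) \<in> lagr_op P G
             \<and> ((\<lambda>s. L2dist P (\<lambda>\<omega>. (1 / (s - t)) *\<^sub>R (Xt s \<omega> - Xt t \<omega>)) V) \<longlongrightarrow> 0) (at t within {0..T})))"

definition lagr_solution :: "'b measure \<Rightarrow> ('a::{real_inner,complete_space,second_countable_topology} \<times> 'a) measure set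
    \<Rightarrow> real \<Rightarrow> ('b \<Rightarrow> 'a) \<Rightarrow> ('b \<Rightarrow> real \<Rightarrow> 'a) \<Rightarrow> bool" where
  "lagr_solution P G T Xb Xs \<longleftrightarrow> Xs \<in> measurable P (pathM T)
     \<and> (\<forall>\<omega>. continuous_on {0..T} (Xs \<omega>))
     \<and> (\<exists>Xt. lagr_curve P G T Xb Xt \<and> (\<forall>t\<in>{0..T}. AE \<omega> in P. Xs \<omega> t = Xt t \<omega>))"

definition L2C :: "'b measure \<Rightarrow> real \<Rightarrow> ('b \<Rightarrow> real \<Rightarrow> 'a::{real_normed_vector,second_countable_topology}) set" where
  "L2C P T = {Z. Z \<in> measurable P (pathM T) \<and> (\<forall>\<omega>. continuous_on {0..T} (Z \<omega>))
      \<and> (\<integral>\<^sup>+\<omega>. ennreal ((SUP t\<in>{0..T}. norm (Z \<omega> t))\<^sup>2) \<partial>P) < \<infinity>}"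

definition L2C_dist2 :: "'b measure \<Rightarrow> real \<Rightarrow> ('b \<Rightarrow> real \<Rightarrow> 'a::real_normed_vector) \<Rightarrow> ('b \<Rightarrow> real \<Rightarrow> 'a) \<Rightarrow> ennreal" where
  "L2C_dist2 P T Z Y = (\<integral>\<^sup>+\<omega>. ennreal ((SUP t\<in>{0..T}. norm (Z \<omega> t - Y \<omega> t))\<^sup>2) \<partial>P)"

end

theory Submission
  imports Defs
begin

text \<open>
  Let \<open>Y\<^sub>n\<close> be the nodes of \<open>Z\<^sub>h\<close> and \<open>V\<^sub>n\<close> the velocities. By construction of \<open>\<eta>\<^sub>h\<close> the conditional
  expectation of \<open>V\<^sub>n\<close> given \<open>Y\<^sub>0, \<dots>, Y\<^sub>n\<close> is the barycenter \<open>b\<^sub>n(Y\<^sub>n)\<close>, and \<open>(Y\<^sub>n, b\<^sub>n(Y\<^sub>n))\<close> has its law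
  in the extension of the barycentric field, so total dissipativity compares it with \<open>(X\<^sub>t, X\<^sub>t')\<close> under any
  coupling. The error \<open>V\<^sub>n - b\<^sub>n(Y\<^sub>n)\<close> must in addition be orthogonal to \<open>X\<^sub>t\<close>. This is achieved by
  comparing \<open>Z\<^sub>h(\<omega>)\<close> with \<open>X(\<omega>')\<close>, where \<open>\<omega>\<close> and \<open>\<omega>'\<close> are conditionally independent given the cell of
  \<open>Y\<^sub>0\<close> in a fine countable partition: Gronwall's inequality bounds both \<open>Z\<^sub>h(\<omega>) - X(\<omega>')\<close> and
  \<open>X(\<omega>) - X(\<omega>')\<close> by the initial distance and the step size. The resulting bound on
  \<open>E|Z\<^sub>h(t) - X\<^sub>t|\<^sup>2\<close>, uniform in \<open>t\<close>, passes to the supremum over \<open>t\<close> because both processes are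
  Lipschitz in \<open>L\<^sup>2\<close> and hence have paths of finite expected energy.
\<close>

section \<open>Square-integrable random variables\<close>

text \<open>The obstacle is that X may depend on the randomness that drives the chain after its
  start: a velocity is centred around its barycenter given the past of the chain, but nothing
  controls its correlation with the rest of the sample point, so its error cannot be tested against
  X at that same point. Against a copy of X that is independent given the cell of the starting
  point, the error only has to be centred on each cell, and this the chain does provide. Cells
  replace exact conditioning on the starting point because a countable partition gives the coupling
  an explicit density. The price is that the two copies start as far apart as a cell is wide; the
  width tends to zero while the step size is still fixed. A second loss is unavoidable:
  dissipativity holds at the last node, whereas the distance is measured at the current point of the
  affine piece. The two differ by at most one step of the scheme, which is the source of every term
  containing \<tau> in the final bound. All derivatives are taken from the right, since the affine
  interpolation has corners at its nodes.\<close>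

definition L2norm :: "'b measure \<Rightarrow> ('b \<Rightarrow> 'a::real_normed_vector) \<Rightarrow> real" where
  "L2norm M X = sqrt (\<integral>\<omega>. (norm (X \<omega>))\<^sup>2 \<partial>M)"

lemma L2dist_eq_L2norm: "L2dist M X Y = L2norm M (\<lambda>\<omega>. X \<omega> - Y \<omega>)"
  by (simp add: L2dist_def L2norm_def)

lemma L2norm_nonneg [simp]: "0 \<le> L2norm M X"
  by (simp add: L2norm_def)

lemma L2norm_power2: "(L2norm M X)\<^sup>2 = (\<integral>\<omega>. (norm (X \<omega>))\<^sup>2 \<partial>M)"
  by (simp add: L2norm_def)

lemma L2_measurable: "X \<in> L2 M \<Longrightarrow> X \<in> borel_measurable M"
  and L2_integrable_power2: "X \<in> L2 M \<Longrightarrow> integrable M (\<lambda>\<omega>. (norm (X \<omega>))\<^sup>2)"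
  by (auto simp: L2_def)

lemma norm_add_power2_le:
  fixes x y :: "'a::real_normed_vector"
  shows "(norm (x + y))\<^sup>2 \<le> 2 * (norm x)\<^sup>2 + 2 * (norm y)\<^sup>2"
proof -
  have "(norm (x + y))\<^sup>2 \<le> (norm x + norm y)\<^sup>2"
    by (intro power_mono norm_triangle_ineq) auto
  also have "\<dots> \<le> 2 * (norm x)\<^sup>2 + 2 * (norm y)\<^sup>2"
    using sum_squares_bound[of "norm x" "norm y"] by (simp add: power2_sum)
  finally show ?thesis .
qed

lemma L2_zero [simp]: "(\<lambda>_. 0) \<in> L2 M"
  by (simp add: L2_def)

lemma L2_add:
  assumes "X \<in> L2 M" "Y \<in> L2 M"
  shows "(\<lambda>\<omega>. X \<omega> + Y \<omega>) \<in> L2 M"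
proof -
  note [measurable] = assms[THEN L2_measurable]
  have "integrable M (\<lambda>\<omega>. 2 * (norm (X \<omega>))\<^sup>2 + 2 * (norm (Y \<omega>))\<^sup>2)"
    using assms[THEN L2_integrable_power2] by auto
  then have "integrable M (\<lambda>\<omega>. (norm (X \<omega> + Y \<omega>))\<^sup>2)"
    by (rule Bochner_Integration.integrable_bound) (auto intro!: AE_I2 simp: norm_add_power2_le)
  then show ?thesis by (simp add: L2_def)
qed

lemma L2_scaleR: "X \<in> L2 M \<Longrightarrow> (\<lambda>\<omega>. c *\<^sub>R X \<omega>) \<in> L2 M"
  by (auto simp: L2_def power_mult_distrib)

lemma L2_diff:
  assumes "X \<in> L2 M" "Y \<in> L2 M"
  shows "(\<lambda>\<omega>. X \<omega> - Y \<omega>) \<in> L2 M"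
  using L2_add[OF assms(1) L2_scaleR[OF assms(2), of "-1"]] by simp

lemma L2_sum: "(\<And>i. i \<in> I \<Longrightarrow> X i \<in> L2 M) \<Longrightarrow> (\<lambda>\<omega>. \<Sum>i\<in>I. X i \<omega>) \<in> L2 M"
  by (induction I rule: infinite_finite_induct) (auto intro: L2_add)

lemma L2_integrable_inner:
  fixes X Y :: "'b \<Rightarrow> 'a::{real_inner,second_countable_topology}"
  assumes "X \<in> L2 M" "Y \<in> L2 M"
  shows "integrable M (\<lambda>\<omega>. inner (X \<omega>) (Y \<omega>))"
proof -
  note [measurable] = assms[THEN L2_measurable]
  have "integrable M (\<lambda>\<omega>. (norm (X \<omega>))\<^sup>2 + (norm (Y \<omega>))\<^sup>2)"
    using assms[THEN L2_integrable_power2] by auto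
  then show ?thesis
  proof (rule Bochner_Integration.integrable_bound)
    show "AE \<omega> in M. norm (inner (X \<omega>) (Y \<omega>)) \<le> norm ((norm (X \<omega>))\<^sup>2 + (norm (Y \<omega>))\<^sup>2)"
    proof (rule AE_I2)
      fix \<omega>
      have "\<bar>inner (X \<omega>) (Y \<omega>)\<bar> \<le> norm (X \<omega>) * norm (Y \<omega>)" by (rule Cauchy_Schwarz_ineq2)
      moreover have "0 \<le> norm (X \<omega>) * norm (Y \<omega>)" by simp
      ultimately show "norm (inner (X \<omega>) (Y \<omega>)) \<le> norm ((norm (X \<omega>))\<^sup>2 + (norm (Y \<omega>))\<^sup>2)"
        using sum_squares_bound[of "norm (X \<omega>)" "norm (Y \<omega>)"] by simp
    qed
  qed simp
qed

lemma L2norm_add_power2: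
  fixes X Y :: "'b \<Rightarrow> 'a::{real_inner,second_countable_topology}"
  assumes "X \<in> L2 M" "Y \<in> L2 M"
  shows "(L2norm M (\<lambda>\<omega>. X \<omega> + Y \<omega>))\<^sup>2
    = (L2norm M X)\<^sup>2 + 2 * (\<integral>\<omega>. inner (X \<omega>) (Y \<omega>) \<partial>M) + (L2norm M Y)\<^sup>2"
proof -
  have "(\<integral>\<omega>. (norm (X \<omega> + Y \<omega>))\<^sup>2 \<partial>M)
    = (\<integral>\<omega>. (norm (X \<omega>))\<^sup>2 + 2 * inner (X \<omega>) (Y \<omega>) + (norm (Y \<omega>))\<^sup>2 \<partial>M)"
    by (simp add: power2_norm_eq_inner inner_add_left inner_add_right inner_commute algebra_simps)
  also have "\<dots> = (L2norm M X)\<^sup>2 + 2 * (\<integral>\<omega>. inner (X \<omega>) (Y \<omega>) \<partial>M) + (L2norm M Y)\<^sup>2"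
    using assms[THEN L2_integrable_power2] L2_integrable_inner[OF assms]
    by (simp add: L2norm_power2)
  finally show ?thesis by (simp add: L2norm_power2)
qed

lemma L2norm_scaleR: "L2norm M (\<lambda>\<omega>. c *\<^sub>R X \<omega>) = \<bar>c\<bar> * L2norm M X"
  by (simp add: L2norm_def power_mult_distrib real_sqrt_mult)

text \<open>The quadratic \<open>A + 2 * r * B + r\<^sup>2 * C\<close> is a squared norm for every
  real \<open>r\<close>, so its discriminant cannot be positive.\<close>

lemma L2_Cauchy_Schwarz:
  fixes X Y :: "'b \<Rightarrow> 'a::{real_inner,second_countable_topology}"
  assumes "X \<in> L2 M" "Y \<in> L2 M"
  shows "\<bar>\<integral>\<omega>. inner (X \<omega>) (Y \<omega>) \<partial>M\<bar> \<le> L2norm M X * L2norm M Y"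
proof -
  define A B C where "A = (L2norm M X)\<^sup>2" and "B = (\<integral>\<omega>. inner (X \<omega>) (Y \<omega>) \<partial>M)"
    and "C = (L2norm M Y)\<^sup>2"
  have nn: "0 \<le> A + 2 * r * B + r\<^sup>2 * C" for r
  proof -
    have "0 \<le> (L2norm M (\<lambda>\<omega>. X \<omega> + r *\<^sub>R Y \<omega>))\<^sup>2" by simp
    also have "\<dots> = A + 2 * r * B + r\<^sup>2 * C"
      using L2norm_add_power2[OF assms(1) L2_scaleR[OF assms(2), of r]]
      by (simp add: A_def B_def C_def L2norm_scaleR power_mult_distrib)
    finally show ?thesis .
  qed
  have "C \<ge> 0" by (simp add: C_def)
  have "B\<^sup>2 \<le> A * C"
  proof (cases "C = 0")
    case True
    have "B = 0"
    proof (rule ccontr)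
      assume "B \<noteq> 0"
      \<comment> \<open>With \<open>C = 0\<close> the expression is affine in \<open>r\<close>; the
        chosen \<open>r\<close> gives it the value -1.\<close>
      then show False using nn[of "- (A + 1) / (2 * B)"] True by (simp add: field_simps)
    qed
    then show ?thesis using True by simp
  next
    case False
    then have "0 < C" using \<open>C \<ge> 0\<close> by simp
    \<comment> \<open>\<open>r = - B / C\<close> is the minimiser of the quadratic.\<close>
    have "(A + 2 * (- B / C) * B + (- B / C)\<^sup>2 * C) * C = A * C - B\<^sup>2"
      using False by (simp add: field_simps power2_eq_square)
    then show ?thesis
      using mult_nonneg_nonneg[OF nn[of "- B / C"] \<open>C \<ge> 0\<close>] by linarith
  qed
  then have "\<bar>B\<bar>\<^sup>2 \<le> (L2norm M X * L2norm M Y)\<^sup>2"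
    by (simp add: A_def C_def power_mult_distrib)
  then show ?thesis
    unfolding B_def by (rule power2_le_imp_le) simp
qed

lemma L2norm_triangle:
  fixes X Y :: "'b \<Rightarrow> 'a::{real_inner,second_countable_topology}"
  assumes "X \<in> L2 M" "Y \<in> L2 M"
  shows "L2norm M (\<lambda>\<omega>. X \<omega> + Y \<omega>) \<le> L2norm M X + L2norm M Y"
proof -
  have "(L2norm M (\<lambda>\<omega>. X \<omega> + Y \<omega>))\<^sup>2 \<le> (L2norm M X + L2norm M Y)\<^sup>2"
    using L2norm_add_power2[OF assms] L2_Cauchy_Schwarz[OF assms] by (simp add: power2_sum)
  then show ?thesis by (rule power2_le_imp_le) simp
qed

lemma L2norm_diff_triangle:
  fixes X Y :: "'b \<Rightarrow> 'a::{real_inner,second_countable_topology}"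
  assumes "X \<in> L2 M" "Y \<in> L2 M"
  shows "L2norm M (\<lambda>\<omega>. X \<omega> - Y \<omega>) \<le> L2norm M X + L2norm M Y"
  using L2norm_triangle[OF assms(1) L2_scaleR[OF assms(2), of "-1"]]
  by (simp add: L2norm_scaleR[of M "-1", simplified])

lemma L2norm_sum:
  fixes X :: "'i \<Rightarrow> 'b \<Rightarrow> 'a::{real_inner,second_countable_topology}"
  assumes "\<And>i. i \<in> I \<Longrightarrow> X i \<in> L2 M"
  shows "L2norm M (\<lambda>\<omega>. \<Sum>i\<in>I. X i \<omega>) \<le> (\<Sum>i\<in>I. L2norm M (X i))"
  using assms
proof (induction I rule: infinite_finite_induct)
  case (insert i I)
  then show ?case
    using L2norm_triangle[of "X i" M "\<lambda>\<omega>. \<Sum>i\<in>I. X i \<omega>"] L2_sum[of I X M] by auto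
qed (auto simp: L2norm_def)

lemma L2norm_cong_AE:
  assumes "X \<in> borel_measurable M" "Y \<in> borel_measurable M" "AE \<omega> in M. X \<omega> = Y \<omega>"
  shows "L2norm M X = L2norm M Y"
proof -
  have "(\<integral>\<omega>. (norm (X \<omega>))\<^sup>2 \<partial>M) = (\<integral>\<omega>. (norm (Y \<omega>))\<^sup>2 \<partial>M)"
    using assms by (intro integral_cong_AE) auto
  then show ?thesis by (simp add: L2norm_def)
qed

lemma L2_cong_AE:
  assumes "X \<in> L2 M" "Y \<in> borel_measurable M" "AE \<omega> in M. X \<omega> = Y \<omega>"
  shows "Y \<in> L2 M"
proof -
  have "integrable M (\<lambda>\<omega>. (norm (X \<omega>))\<^sup>2) \<longleftrightarrow> integrable M (\<lambda>\<omega>. (norm (Y \<omega>))\<^sup>2)"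
    using assms L2_measurable[OF assms(1)] by (intro integrable_cong_AE) auto
  then show ?thesis using assms by (auto simp: L2_def)
qed

lemma L2_distr_iff:
  assumes [measurable]: "f \<in> measurable M N" "X \<in> borel_measurable N"
  shows "X \<in> L2 (distr M N f) \<longleftrightarrow> (\<lambda>\<omega>. X (f \<omega>)) \<in> L2 M"
  by (auto simp: L2_def integrable_distr_eq)

lemma L2norm_distr:
  assumes [measurable]: "f \<in> measurable M N" "X \<in> borel_measurable N"
  shows "L2norm (distr M N f) X = L2norm M (\<lambda>\<omega>. X (f \<omega>))"
  by (simp add: L2norm_def integral_distr)

section \<open>A Gronwall inequality for curves of random variables\<close>

text \<open>Continuous induction: the points with \<open>g t \<le> g a\<close> form a compact set,
  and its largest element must be \<open>b\<close>, as any other one could be pushed further right.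
  The step may jump, so nothing is asked of the points in between.\<close>

lemma right_step_nonincreasing_imp_le:
  fixes g :: "real \<Rightarrow> real"
  assumes "a \<le> b" and cont: "continuous_on {a..b} g"
    and step: "\<And>t. a \<le> t \<Longrightarrow> t < b \<Longrightarrow> \<exists>s. t < s \<and> s \<le> b \<and> g s \<le> g t"
  shows "g b \<le> g a"
proof -
  define S where "S = {a..b} \<inter> g -` {..g a}"
  have "closed S"
    unfolding S_def using cont by (rule continuous_closed_preimage) auto
  moreover have "bounded S"
    unfolding S_def by (rule bounded_Int) simp
  ultimately have "compact S"
    by (simp add: compact_eq_bounded_closed)
  moreover have "a \<in> S" using \<open>a \<le> b\<close> by (simp add: S_def)
  ultimately obtain c where c: "c \<in> S" "\<And>t. t \<in> S \<Longrightarrow> t \<le> c"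
    using compact_attains_sup[of S] by auto
  have "c = b"
  proof (rule ccontr)
    assume "c \<noteq> b"
    then have "a \<le> c" "c < b" using c(1) by (auto simp: S_def)
    then obtain s where s: "c < s" "s \<le> b" "g s \<le> g c" using step by blast
    then have "s \<in> S" using c(1) by (auto simp: S_def)
    then show False using c(2)[of s] s(1) by simp
  qed
  then show ?thesis using c(1) by (simp add: S_def)
qed

text \<open>The exceptional null set is covered by an open set \<open>U\<close> of small measure; the slope
  \<open>C\<close> of \<open>g\<close> on \<open>U\<close> is compensated by subtracting \<open>C\<close> times the measure of
  the part of \<open>U\<close> to the left of the point.\<close>

lemma Lipschitz_AE_right_deriv_nonpos_imp_le:
  fixes g :: "real \<Rightarrow> real"
  assumes "a \<le> b"
    and lip: "\<And>s t. s \<in> {a..b} \<Longrightarrow> t \<in> {a..b} \<Longrightarrow> \<bar>g s - g t\<bar> \<le> C * \<bar>s - t\<bar>"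
    and der: "AE t in lborel. t \<in> {a<..<b} \<longrightarrow>
      (\<exists>d\<le>0. (g has_real_derivative d) (at_right t))"
  shows "g b \<le> g a"
proof (cases "a = b")
  case False
  with \<open>a \<le> b\<close> have "a < b" by simp
  then have "0 \<le> C"
    using order_trans[OF abs_ge_zero lip[of a b]] by (auto simp: zero_le_mult_iff)
  from der obtain N where N: "N \<in> null_sets lborel"
    "\<And>t. t \<in> {a<..<b} \<Longrightarrow> t \<notin> N \<Longrightarrow> \<exists>d\<le>0. (g has_real_derivative d) (at_right t)"
  proof (rule AE_E)
    fix N assume "{t \<in> space lborel. \<not> (t \<in> {a<..<b} \<longrightarrow> (\<exists>d\<le>0. (g has_real_derivative d) (at_right t)))} \<subseteq> N"
      "emeasure lborel N = 0" "N \<in> sets lborel"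
    then show thesis by (intro that[of N]) auto
  qed
  \<comment> \<open>The derivative is only known in the open interval, so \<open>a\<close> joins the
    exceptional set; a point outside \<open>U\<close> is then neither \<open>a\<close> nor in
    \<open>N\<close>.\<close>
  have N': "insert a N \<in> null_sets lborel"
    using N(1) null_sets.Un[of "{a}" lborel N] by (simp add: null_setsI)
  have le_eps: "g b \<le> g a + \<epsilon> * (b - a + C)" if "0 < \<epsilon>" for \<epsilon>
  proof -
    obtain U where U: "open U" "insert a N \<subseteq> U" "emeasure lborel (U - insert a N) < ennreal \<epsilon>"
      using outer_regular_lborel[of "insert a N" \<epsilon>] N' \<open>0 < \<epsilon>\<close> by (auto simp: null_sets_def)
    have [measurable]: "U \<in> sets borel" using U(1) by simp
    have emU: "emeasure lborel U < ennreal \<epsilon>"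
      using U(3) N' emeasure_Diff_null_set[of "insert a N" lborel U] by simp
    define m where "m t = measure lborel (U \<inter> {a..t})" for t
    have fin: "emeasure lborel (U \<inter> {s..t}) \<noteq> \<infinity>" "emeasure lborel (U \<inter> {s<..t}) \<noteq> \<infinity>" for s t
      using emeasure_mono[of "U \<inter> {s..t}" U lborel] emeasure_mono[of "U \<inter> {s<..t}" U lborel] emU
      by (auto simp: top_unique)
    have m_diff: "m s = m t + measure lborel (U \<inter> {t<..s})" if "a \<le> t" "t \<le> s" for s t
    proof -
      have "U \<inter> {a..s} = (U \<inter> {a..t}) \<union> (U \<inter> {t<..s})" using that by auto
      then show ?thesis
        unfolding m_def by (simp only:) (rule measure_Union, use fin in auto)
    qed
    have m_mono: "m t \<le> m s" if "a \<le> t" "t \<le> s" for s t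
      using m_diff[OF that] by simp
    have m_lip: "m s \<le> m t + (s - t)" if "a \<le> t" "t \<le> s" for s t
    proof -
      have "measure lborel (U \<inter> {t<..s}) \<le> measure lborel {t<..s}"
        by (rule measure_mono_fmeasurable) (use that in \<open>auto simp: fmeasurable_def\<close>)
      then show ?thesis using m_diff[OF that] that by simp
    qed
    \<comment> \<open>The term \<open>\<epsilon> * (t - a)\<close> serves the points outside
      \<open>U\<close>: a derivative \<open>d \<le> 0\<close> only makes the difference quotients to
      the right eventually smaller than \<epsilon>.\<close>
    define h where "h t = g t - \<epsilon> * (t - a) - C * m t" for t
    have "C-lipschitz_on {a..b} g"
      using lip \<open>0 \<le> C\<close> by (auto intro!: lipschitz_onI simp: dist_real_def)
    moreover have "\<bar>m s - m t\<bar> \<le> 1 * \<bar>s - t\<bar>" if "s \<in> {a..b}" "t \<in> {a..b}" for s t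
      using m_mono[of t s] m_lip[of t s] m_mono[of s t] m_lip[of s t] that by (cases "s \<le> t") auto
    then have "1-lipschitz_on {a..b} m"
      by (intro lipschitz_onI) (auto simp: dist_real_def)
    ultimately
    have [continuous_intros]: "continuous_on {a..b} g" "continuous_on {a..b} m"
      by (auto intro: lipschitz_on_continuous_on)
    have "h b \<le> h a"
    proof (rule right_step_nonincreasing_imp_le[OF \<open>a \<le> b\<close>])
      show "continuous_on {a..b} h"
        unfolding h_def by (intro continuous_intros)
    next
      fix t assume t: "a \<le> t" "t < b"
      show "\<exists>s. t < s \<and> s \<le> b \<and> h s \<le> h t"
      proof (cases "t \<in> U")
        case True
        then obtain \<delta> where \<delta>: "\<delta> > 0" "ball t \<delta> \<subseteq> U"
          using U(1) open_contains_ball by blast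
        define s where "s = min (t + \<delta> / 2) b"
        have s: "t < s" "s \<le> b" "s < t + \<delta>" using \<delta>(1) t by (auto simp: s_def)
        have "U \<inter> {t<..s} = {t<..s}"
          using \<delta>(2) s by (auto simp: dist_real_def subset_iff)
        then have "m s = m t + (s - t)" using m_diff[of t s] t s by simp
        then have "C * m s = C * m t + C * (s - t)" by (simp only: distrib_left)
        moreover have "g s - g t \<le> C * (s - t)" using lip[of s t] s t by auto
        moreover have "0 \<le> \<epsilon> * (s - t)" using \<open>0 < \<epsilon>\<close> s by simp
        ultimately have "h s \<le> h t" by (simp add: h_def algebra_simps)
        then show ?thesis using s by blast
      next
        case False
        then have "t \<in> {a<..<b}" "t \<notin> N" using t U(2) by (auto simp: less_le)
        then obtain d where d: "d \<le> 0" "(g has_real_derivative d) (at_right t)"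
          using N(2) by blast
        have "\<forall>\<^sub>F s in at_right t. (g s - g t) / (s - t) < \<epsilon>"
          using d \<open>0 < \<epsilon>\<close> by (intro order_tendstoD(2)[of _ d]) (auto simp: has_field_derivative_iff)
        moreover have "\<forall>\<^sub>F s in at_right t. s \<in> {t<..<b}"
          using t by (intro eventually_at_right_real) auto
        ultimately have "\<forall>\<^sub>F s in at_right t. (g s - g t) / (s - t) < \<epsilon> \<and> s \<in> {t<..<b}"
          by (rule eventually_conj)
        then obtain s where s: "(g s - g t) / (s - t) < \<epsilon>" "t < s" "s < b"
          using eventually_happens'[OF trivial_limit_at_right_real] by fastforce
        then have "g s - g t \<le> \<epsilon> * (s - t)" by (simp add: field_simps)
        moreover have "C * m t \<le> C * m s" using m_mono[of t s] s t \<open>0 \<le> C\<close> by (simp add: mult_left_mono)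
        ultimately have "h s \<le> h t" by (simp add: h_def algebra_simps)
        then show ?thesis using s by force
      qed
    qed
    moreover have "m b \<le> \<epsilon>"
    proof -
      have "emeasure lborel (U \<inter> {a..b}) \<le> ennreal \<epsilon>"
        using order_trans[OF emeasure_mono less_imp_le[OF emU], of "U \<inter> {a..b}"] by simp
      then show ?thesis unfolding m_def measure_def using \<open>0 < \<epsilon>\<close> by (simp add: enn2real_leI)
    qed
    moreover have "0 \<le> C * m a" using \<open>0 \<le> C\<close> by (simp add: m_def)
    moreover have "C * m b \<le> C * \<epsilon>" using calculation(2) \<open>0 \<le> C\<close> by (rule mult_left_mono)
    ultimately show ?thesis by (simp add: h_def algebra_simps)
  qed
  show ?thesis
  proof (rule field_le_epsilon)
    fix e :: real assume "0 < e"
    have "0 < b - a + C" using \<open>a < b\<close> \<open>0 \<le> C\<close> by simp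
    then show "g b \<le> g a + e"
      using le_eps[of "e / (b - a + C)"] \<open>0 < e\<close> by simp
  qed
qed simp

text \<open>Write \<open>D s\<close> as \<open>D t\<close> plus \<open>s - t\<close> times the
  difference quotient and expand the square. The mixed term converges by Cauchy-Schwarz; the square
  of the quotient stays below \<open>C\<^sup>2\<close> and carries a factor
  \<open>s - t\<close>.\<close>

lemma L2norm_power2_right_deriv:
  fixes D :: "real \<Rightarrow> 'b \<Rightarrow> 'a::{real_inner,second_countable_topology}"
  assumes D: "\<And>s. s \<in> {0..T} \<Longrightarrow> D s \<in> L2 M"
    and lip: "\<And>s t. s \<in> {0..T} \<Longrightarrow> t \<in> {0..T} \<Longrightarrow> L2dist M (D s) (D t) \<le> C * \<bar>s - t\<bar>"
    and t: "0 \<le> t" "t < T" and V: "V \<in> L2 M"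
    and lim: "((\<lambda>s. L2dist M (\<lambda>\<omega>. (1 / (s - t)) *\<^sub>R (D s \<omega> - D t \<omega>)) V) \<longlongrightarrow> 0) (at_right t)"
  shows "((\<lambda>s. (L2norm M (D s))\<^sup>2) has_real_derivative 2 * (\<integral>\<omega>. inner (V \<omega>) (D t \<omega>) \<partial>M))
    (at_right t)"
proof -
  define q where "q s = (\<lambda>\<omega>. (1 / (s - t)) *\<^sub>R (D s \<omega> - D t \<omega>))" for s
  define I where "I = (\<integral>\<omega>. inner (V \<omega>) (D t \<omega>) \<partial>M)"
  have tT: "t \<in> {0..T}" using t by simp
  have "\<forall>\<^sub>F s in at_right t. norm (((L2norm M (D s))\<^sup>2 - (L2norm M (D t))\<^sup>2) / (s - t) - 2 * I)
      \<le> 2 * (L2norm M (D t) * L2dist M (q s) V) + (s - t) * C\<^sup>2"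
  proof -
    have "\<forall>\<^sub>F s in at_right t. s \<in> {t<..<T}"
      using t by (intro eventually_at_right_real) auto
    then show ?thesis
    proof eventually_elim
      case (elim s)
      then have s: "s \<in> {0..T}" "t < s" using t by auto
      have q: "q s \<in> L2 M"
        unfolding q_def by (intro L2_scaleR L2_diff D s tT)
      have "L2norm M (q s) = (1 / (s - t)) * L2dist M (D s) (D t)"
        unfolding q_def L2norm_scaleR L2dist_eq_L2norm using s by simp
      also have "\<dots> \<le> (1 / (s - t)) * (C * \<bar>s - t\<bar>)"
        using lip[OF s(1) tT] s by (intro mult_left_mono) auto
      also have "\<dots> = C" using s by simp
      finally have qC: "(L2norm M (q s))\<^sup>2 \<le> C\<^sup>2" by (intro power_mono) auto
      have "D s = (\<lambda>\<omega>. D t \<omega> + (s - t) *\<^sub>R q s \<omega>)"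
        using s by (auto simp: q_def)
      then have "(L2norm M (D s))\<^sup>2 = (L2norm M (\<lambda>\<omega>. D t \<omega> + (s - t) *\<^sub>R q s \<omega>))\<^sup>2"
        by simp
      also have "\<dots> = (L2norm M (D t))\<^sup>2 + 2 * (s - t) * (\<integral>\<omega>. inner (D t \<omega>) (q s \<omega>) \<partial>M)
          + (s - t)\<^sup>2 * (L2norm M (q s))\<^sup>2"
        by (subst L2norm_add_power2[OF D[OF tT] L2_scaleR[OF q]])
          (simp add: L2norm_scaleR power_mult_distrib)
      finally have "((L2norm M (D s))\<^sup>2 - (L2norm M (D t))\<^sup>2) / (s - t)
          = 2 * (\<integral>\<omega>. inner (D t \<omega>) (q s \<omega>) \<partial>M) + (s - t) * (L2norm M (q s))\<^sup>2"
        using s by (simp add: field_simps power2_eq_square)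
      moreover have "(\<integral>\<omega>. inner (D t \<omega>) (q s \<omega>) \<partial>M) - I = (\<integral>\<omega>. inner (D t \<omega>) (q s \<omega> - V \<omega>) \<partial>M)"
        using L2_integrable_inner[OF D[OF tT] q] L2_integrable_inner[OF D[OF tT] V]
        by (simp add: I_def inner_diff_right inner_commute)
      moreover have "\<bar>\<integral>\<omega>. inner (D t \<omega>) (q s \<omega> - V \<omega>) \<partial>M\<bar> \<le> L2norm M (D t) * L2dist M (q s) V"
        using L2_Cauchy_Schwarz[OF D[OF tT] L2_diff[OF q V]] by (simp add: L2dist_eq_L2norm)
      moreover have "(s - t) * (L2norm M (q s))\<^sup>2 \<le> (s - t) * C\<^sup>2"
        using qC s by (intro mult_left_mono) auto
      moreover have "0 \<le> (s - t) * (L2norm M (q s))\<^sup>2" using s by simp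
      ultimately show ?case by (simp add: abs_le_iff)
    qed
  qed
  moreover have "((\<lambda>s. 2 * (L2norm M (D t) * L2dist M (q s) V) + (s - t) * C\<^sup>2)
      \<longlongrightarrow> 2 * (L2norm M (D t) * 0) + (t - t) * C\<^sup>2) (at_right t)"
    by (rule tendsto_add[OF tendsto_mult_left[OF tendsto_mult_left[OF lim[folded q_def]]]
          tendsto_mult_right[OF tendsto_diff[OF tendsto_ident_at tendsto_const]]])
  then have "((\<lambda>s. 2 * (L2norm M (D t) * L2dist M (q s) V) + (s - t) * C\<^sup>2) \<longlongrightarrow> 0) (at_right t)"
    by simp
  ultimately have "((\<lambda>s. ((L2norm M (D s))\<^sup>2 - (L2norm M (D t))\<^sup>2) / (s - t) - 2 * I)
      \<longlongrightarrow> 0) (at_right t)"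
    by (rule Lim_null_comparison)
  then show ?thesis
    unfolding has_field_derivative_iff I_def by (rule LIM_zero_cancel)
qed

text \<open>The squared norm is Lipschitz on \<open>{0..T}\<close> and its right derivative is
  controlled at almost every time, which is exactly what the monotonicity criterion above asks of a
  weighted version of it.\<close>

lemma L2_curve_Gronwall:
  fixes D :: "real \<Rightarrow> 'b \<Rightarrow> 'a::{real_inner,second_countable_topology}"
  assumes D: "\<And>s. s \<in> {0..T} \<Longrightarrow> D s \<in> L2 M"
    and lip: "\<And>s t. s \<in> {0..T} \<Longrightarrow> t \<in> {0..T} \<Longrightarrow> L2dist M (D s) (D t) \<le> C * \<bar>s - t\<bar>"
    and der: "AE t in lborel. t \<in> {0<..<T} \<longrightarrow> (\<exists>V\<in>L2 M.
      ((\<lambda>s. L2dist M (\<lambda>\<omega>. (1 / (s - t)) *\<^sub>R (D s \<omega> - D t \<omega>)) V) \<longlongrightarrow> 0) (at_right t)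
      \<and> (\<integral>\<omega>. inner (V \<omega>) (D t \<omega>) \<partial>M) \<le> a * (L2norm M (D t))\<^sup>2 + b)"
    and "0 \<le> a" "0 \<le> b" and t: "t \<in> {0..T}"
  shows "(L2norm M (D t))\<^sup>2 \<le> exp (2 * a * t) * ((L2norm M (D 0))\<^sup>2 + 2 * b * t)"
proof -
  define u where "u s = (L2norm M (D s))\<^sup>2" for s
  \<comment> \<open>The linear term \<open>2 * b * s\<close> can stand for the weighted integral of
    \<open>b\<close> because \<open>a\<close> and \<open>b\<close> are nonnegative and the
    exponential weight is at most 1.\<close>
  define g where "g s = exp (- 2 * a * s) * u s - 2 * b * s" for s
  define R where "R = L2norm M (D 0) + \<bar>C\<bar> * T"
  have "0 \<le> T" and T0: "0 \<in> {0..T}" using t by auto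
  have normR: "L2norm M (D s) \<le> R" if "s \<in> {0..T}" for s
  proof -
    have "L2norm M (D s) \<le> L2norm M (D 0) + L2dist M (D s) (D 0)"
      using L2norm_triangle[OF D[OF T0] L2_diff[OF D[OF that] D[OF T0]]] by (simp add: L2dist_eq_L2norm)
    also have "L2dist M (D s) (D 0) \<le> C * \<bar>s - 0\<bar>" using lip[OF that T0] .
    also have "C * \<bar>s - 0\<bar> \<le> \<bar>C\<bar> * T" using that by (intro mult_mono) auto
    finally show ?thesis by (simp add: R_def)
  qed
  have "0 \<le> R" using order_trans[OF L2norm_nonneg normR[OF T0]] .
  have u_bound: "\<bar>u s\<bar> \<le> R\<^sup>2" if "s \<in> {0..T}" for s
    using normR[OF that] by (simp add: u_def power_mono)
  have u_lip: "\<bar>u r - u s\<bar> \<le> (2 * R * \<bar>C\<bar>) * \<bar>r - s\<bar>" if "r \<in> {0..T}" "s \<in> {0..T}" for r s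
  proof -
    have "\<bar>L2norm M (D r) - L2norm M (D s)\<bar> \<le> L2dist M (D r) (D s)"
      using L2norm_triangle[OF D[OF that(1)] L2_diff[OF D[OF that(2)] D[OF that(1)]]]
        L2norm_triangle[OF D[OF that(2)] L2_diff[OF D[OF that(1)] D[OF that(2)]]]
      by (simp add: L2dist_eq_L2norm abs_le_iff L2norm_def norm_minus_commute)
    also have "\<dots> \<le> C * \<bar>r - s\<bar>" using lip[OF that] .
    also have "\<dots> \<le> \<bar>C\<bar> * \<bar>r - s\<bar>" by (intro mult_right_mono) auto
    finally have 1: "\<bar>L2norm M (D r) - L2norm M (D s)\<bar> \<le> \<bar>C\<bar> * \<bar>r - s\<bar>" .
    have 2: "\<bar>L2norm M (D r) + L2norm M (D s)\<bar> \<le> 2 * R"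
      using normR[OF that(1)] normR[OF that(2)] by simp
    have "\<bar>u r - u s\<bar> = \<bar>L2norm M (D r) + L2norm M (D s)\<bar> * \<bar>L2norm M (D r) - L2norm M (D s)\<bar>"
      by (simp add: u_def power2_eq_square square_diff_square_factored abs_mult)
    also have "\<dots> \<le> (2 * R) * (\<bar>C\<bar> * \<bar>r - s\<bar>)" using 1 2 \<open>0 \<le> R\<close> by (intro mult_mono) auto
    finally show ?thesis by (simp add: mult_ac)
  qed
  have exp_lip: "\<bar>exp (- 2 * a * r) - exp (- 2 * a * s)\<bar> \<le> 2 * a * \<bar>r - s\<bar>"
    if "0 \<le> r" "0 \<le> s" for r s
  proof -
    have *: "1 - exp (- x) \<le> x" for x :: real using exp_ge_add_one_self[of "- x"] by simp
    have up: "exp (- 2 * a * r) - exp (- 2 * a * s) \<le> 2 * a * (s - r)" if "0 \<le> r" "r \<le> s" for r s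
    proof -
      have "exp (- 2 * a * r) - exp (- 2 * a * s)
          = exp (- 2 * a * r) * (1 - exp (- (2 * a * (s - r))))"
        by (simp add: algebra_simps flip: exp_add)
      also have "\<dots> \<le> 1 * (2 * a * (s - r))"
        using that \<open>0 \<le> a\<close> by (intro mult_mono *) auto
      finally show ?thesis by simp
    qed
    have lo: "exp (- 2 * a * s) \<le> exp (- 2 * a * r)" if "r \<le> s" for r s
      using that \<open>0 \<le> a\<close> by (simp add: mult_left_mono)
    show ?thesis
    proof (cases "r \<le> s")
      case True
      then show ?thesis using up[of r s] lo[of r s] \<open>0 \<le> r\<close> by simp
    next
      case False
      then show ?thesis using up[of s r] lo[of s r] \<open>0 \<le> s\<close> by simp
    qed
  qed
  have "g t \<le> g 0"
  \<comment> \<open>The three summands of the constant belong to the variation of \<open>u\<close>,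
    of the exponential weight (times the bound \<open>R\<^sup>2\<close> of \<open>u\<close>), and of
    the linear term.\<close>
  proof (rule Lipschitz_AE_right_deriv_nonpos_imp_le[where g = g and a = 0 and b = t and C = "2 * R * \<bar>C\<bar> + R\<^sup>2 * (2 * a) + 2 * b"])
    fix r s assume rs: "r \<in> {0..t}" "s \<in> {0..t}"
    then have rsT: "r \<in> {0..T}" "s \<in> {0..T}" using t by auto
    have "g r - g s = exp (- 2 * a * r) * (u r - u s)
        + u s * (exp (- 2 * a * r) - exp (- 2 * a * s)) + 2 * b * (s - r)"
      by (simp add: g_def algebra_simps)
    also have "\<bar>\<dots>\<bar> \<le> \<bar>exp (- 2 * a * r) * (u r - u s)\<bar>
        + \<bar>u s * (exp (- 2 * a * r) - exp (- 2 * a * s))\<bar> + \<bar>2 * b * (s - r)\<bar>"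
      by linarith
    also have "\<dots> = \<bar>exp (- 2 * a * r)\<bar> * \<bar>u r - u s\<bar>
        + \<bar>u s\<bar> * \<bar>exp (- 2 * a * r) - exp (- 2 * a * s)\<bar> + 2 * b * \<bar>r - s\<bar>"
      using \<open>0 \<le> b\<close> by (simp add: abs_mult abs_minus_commute)
    also have "\<dots> \<le> 1 * ((2 * R * \<bar>C\<bar>) * \<bar>r - s\<bar>) + R\<^sup>2 * (2 * a * \<bar>r - s\<bar>) + 2 * b * \<bar>r - s\<bar>"
    proof (rule add_right_mono, rule add_mono)
      show "\<bar>exp (- 2 * a * r)\<bar> * \<bar>u r - u s\<bar> \<le> 1 * ((2 * R * \<bar>C\<bar>) * \<bar>r - s\<bar>)"
        using rs \<open>0 \<le> a\<close> by (intro mult_mono u_lip[OF rsT]) auto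
      show "\<bar>u s\<bar> * \<bar>exp (- 2 * a * r) - exp (- 2 * a * s)\<bar> \<le> R\<^sup>2 * (2 * a * \<bar>r - s\<bar>)"
        using rs by (intro mult_mono u_bound[OF rsT(2)] exp_lip) auto
    qed
    finally show "\<bar>g r - g s\<bar> \<le> (2 * R * \<bar>C\<bar> + R\<^sup>2 * (2 * a) + 2 * b) * \<bar>r - s\<bar>"
      by (simp add: algebra_simps)
  next
    show "AE s in lborel. s \<in> {0<..<t} \<longrightarrow> (\<exists>d\<le>0. (g has_real_derivative d) (at_right s))"
      using der
    proof eventually_elim
      case (elim s)
      show ?case
      proof
        assume s: "s \<in> {0<..<t}"
        then have "s \<in> {0<..<T}" using t by auto
        then obtain V where V: "V \<in> L2 M"
          "((\<lambda>r. L2dist M (\<lambda>\<omega>. (1 / (r - s)) *\<^sub>R (D r \<omega> - D s \<omega>)) V) \<longlongrightarrow> 0) (at_right s)"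
          "(\<integral>\<omega>. inner (V \<omega>) (D s \<omega>) \<partial>M) \<le> a * u s + b"
          using elim unfolding u_def by blast
        define I where "I = (\<integral>\<omega>. inner (V \<omega>) (D s \<omega>) \<partial>M)"
        have du: "(u has_real_derivative 2 * I) (at_right s)"
          using L2norm_power2_right_deriv[where T = T, OF D lip _ _ V(1,2)] s t unfolding u_def I_def by auto
        have de: "((\<lambda>s. exp (- 2 * a * s)) has_real_derivative exp (- 2 * a * s) * (- 2 * a)) (at_right s)"
          and dl: "((\<lambda>s. 2 * b * s) has_real_derivative 2 * b) (at_right s)"
          by (auto intro!: derivative_eq_intros)
        have "(g has_real_derivative
            (exp (- 2 * a * s) * (- 2 * a)) * u s + (2 * I) * exp (- 2 * a * s) - 2 * b) (at_right s)"
          unfolding g_def by (rule DERIV_diff[OF DERIV_mult[OF de du] dl])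
        moreover have "(exp (- 2 * a * s) * (- 2 * a)) * u s + (2 * I) * exp (- 2 * a * s) - 2 * b \<le> 0"
        proof -
          have "exp (- 2 * a * s) * (I - a * u s) \<le> 1 * b"
          proof -
            have "exp (- 2 * a * s) * (I - a * u s) \<le> exp (- 2 * a * s) * b"
              using V(3) unfolding I_def[symmetric] by (intro mult_left_mono) auto
            also have "\<dots> \<le> 1 * b"
              using s \<open>0 \<le> a\<close> \<open>0 \<le> b\<close> by (intro mult_right_mono) auto
            finally show ?thesis .
          qed
          then show ?thesis by (simp add: algebra_simps)
        qed
        ultimately show "\<exists>d\<le>0. (g has_real_derivative d) (at_right s)" by blast
      qed
    qed
  qed (use t in auto)
  then have "exp (- (2 * a * t)) * u t \<le> u 0 + 2 * b * t" by (simp add: g_def)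
  then have "exp (2 * a * t) * (exp (- (2 * a * t)) * u t) \<le> exp (2 * a * t) * (u 0 + 2 * b * t)"
    by (intro mult_left_mono) auto
  moreover have "exp (2 * a * t) * (exp (- (2 * a * t)) * u t) = u t" by (simp add: exp_minus)
  ultimately show ?thesis by (simp only: u_def)
qed

section \<open>Suprema of paths\<close>

definition dyadic :: "real \<Rightarrow> nat \<Rightarrow> nat \<Rightarrow> real" where
  "dyadic T m k = real k * T / 2 ^ m"

text \<open>This is the integral of the squared speed of the path that is affine between the dyadic
  points of level \<open>m\<close> and agrees with \<open>x\<close> there.\<close>

definition dyadic_energy :: "real \<Rightarrow> nat \<Rightarrow> (real \<Rightarrow> 'a::real_normed_vector) \<Rightarrow> real" where
  "dyadic_energy T m x = (\<Sum>k<2 ^ m. 2 ^ m / T * (norm (x (dyadic T m (Suc k)) - x (dyadic T m k)))\<^sup>2)"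

lemma dyadic_mem: "0 < T \<Longrightarrow> k \<le> 2 ^ m \<Longrightarrow> dyadic T m k \<in> {0..T}"
proof -
  assume T: "0 < T" and "k \<le> 2 ^ m"
  then have "real k \<le> 2 ^ m" by (metis of_nat_le_iff of_nat_numeral of_nat_power)
  then show ?thesis using T by (simp add: dyadic_def field_simps mult_mono)
qed

lemma dyadic_refine: "dyadic T (m + r) (k * 2 ^ r) = dyadic T m k"
  by (simp add: dyadic_def power_add)

lemma sum_lessThan_double:
  fixes g :: "nat \<Rightarrow> 'a::comm_monoid_add"
  shows "(\<Sum>j<2 * n. g j) = (\<Sum>k<n. g (2 * k) + g (2 * k + 1))"
  by (induction n) (simp_all add: ac_simps)

text \<open>Splitting an increment at the midpoint costs a factor 2 in the sum of squares, and
  halving the mesh supplies that factor.\<close>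

lemma dyadic_energy_mono_Suc:
  assumes "0 < T"
  shows "dyadic_energy T m x \<le> dyadic_energy T (Suc m) x"
proof -
  define y where "y j = x (dyadic T (Suc m) j)" for j
  have e: "x (dyadic T m k) = y (2 * k)" for k
    using dyadic_refine[of T m 1 k] by (simp add: y_def mult.commute)
  have "dyadic_energy T m x = (\<Sum>k<2 ^ m. 2 ^ m / T * (norm (y (2 * k + 2) - y (2 * k)))\<^sup>2)"
    unfolding dyadic_energy_def e by simp
  also have "\<dots> \<le> (\<Sum>k<2 ^ m. 2 ^ Suc m / T * (norm (y (2 * k + 1) - y (2 * k)))\<^sup>2
      + 2 ^ Suc m / T * (norm (y (2 * k + 2) - y (2 * k + 1)))\<^sup>2)"
  proof (rule sum_mono)
    fix k
    have "(norm (y (2 * k + 2) - y (2 * k)))\<^sup>2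
      \<le> 2 * (norm (y (2 * k + 2) - y (2 * k + 1)))\<^sup>2 + 2 * (norm (y (2 * k + 1) - y (2 * k)))\<^sup>2"
      using norm_add_power2_le[of "y (2 * k + 2) - y (2 * k + 1)" "y (2 * k + 1) - y (2 * k)"] by simp
    then have "2 ^ m / T * (norm (y (2 * k + 2) - y (2 * k)))\<^sup>2 \<le> 2 ^ m / T *
      (2 * (norm (y (2 * k + 2) - y (2 * k + 1)))\<^sup>2 + 2 * (norm (y (2 * k + 1) - y (2 * k)))\<^sup>2)"
      using assms by (intro mult_left_mono) auto
    then show "2 ^ m / T * (norm (y (2 * k + 2) - y (2 * k)))\<^sup>2
      \<le> 2 ^ Suc m / T * (norm (y (2 * k + 1) - y (2 * k)))\<^sup>2
      + 2 ^ Suc m / T * (norm (y (2 * k + 2) - y (2 * k + 1)))\<^sup>2"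
      by (simp add: algebra_simps)
  qed
  also have "\<dots> = (\<Sum>j<2 * 2 ^ m. 2 ^ Suc m / T * (norm (y (Suc j) - y j))\<^sup>2)"
    unfolding sum_lessThan_double by simp
  also have "\<dots> = dyadic_energy T (Suc m) x"
    by (simp add: dyadic_energy_def y_def)
  finally show ?thesis .
qed

lemma dyadic_energy_mono: "0 < T \<Longrightarrow> m \<le> n \<Longrightarrow> dyadic_energy T m x \<le> dyadic_energy T n x"
  by (rule lift_Suc_mono_le[of "\<lambda>m. dyadic_energy T m x"]) (auto intro: dyadic_energy_mono_Suc)

lemma dyadic_energy_nonneg: "0 < T \<Longrightarrow> 0 \<le> dyadic_energy T m x"
  unfolding dyadic_energy_def by (intro sum_nonneg) auto

text \<open>Cauchy-Schwarz over the cells between the two points: the discrete form of the Hoelder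
  bound of exponent 1/2 for paths of finite energy.\<close>

lemma dyadic_increment_le_energy:
  assumes "0 < T" "i \<le> j" "j \<le> 2 ^ m"
  shows "(norm (x (dyadic T m j) - x (dyadic T m i)))\<^sup>2
    \<le> (dyadic T m j - dyadic T m i) * dyadic_energy T m x"
proof -
  define d where "d k = norm (x (dyadic T m (Suc k)) - x (dyadic T m k))" for k
  have "x (dyadic T m j) - x (dyadic T m i) = (\<Sum>k=i..<j. x (dyadic T m (Suc k)) - x (dyadic T m k))"
    using sum_Suc_diff'[OF \<open>i \<le> j\<close>, of "\<lambda>k. x (dyadic T m k)"] by simp
  then have "norm (x (dyadic T m j) - x (dyadic T m i)) \<le> (\<Sum>k=i..<j. d k)"
    by (simp add: d_def norm_sum)
  then have "(norm (x (dyadic T m j) - x (dyadic T m i)))\<^sup>2 \<le> (\<Sum>k=i..<j. d k)\<^sup>2"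
    by (intro power_mono) auto
  also have "\<dots> \<le> (\<Sum>k=i..<j. (d k)\<^sup>2) * card {i..<j}"
    by (rule sum_squared_le_sum_of_squares)
  also have "\<dots> \<le> (\<Sum>k<2 ^ m. (d k)\<^sup>2) * card {i..<j}"
    using assms by (intro mult_right_mono sum_mono2) auto
  also have "\<dots> = (dyadic T m j - dyadic T m i) * (2 ^ m / T * (\<Sum>k<2 ^ m. (d k)\<^sup>2))"
    using assms by (simp add: dyadic_def field_simps of_nat_diff)
  also have "2 ^ m / T * (\<Sum>k<2 ^ m. (d k)\<^sup>2) = dyadic_energy T m x"
    by (simp add: dyadic_energy_def d_def sum_distrib_left)
  finally show ?thesis .
qed

lemma dyadic_floor:
  assumes "0 < T" "t \<in> {0..T}"
  defines "j \<equiv> \<lambda>m. nat \<lfloor>t * 2 ^ m / T\<rfloor>"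
  shows "j m \<le> 2 ^ m" "dyadic T m (j m) \<le> t" "t \<le> dyadic T m (j m) + T / 2 ^ m"
proof -
  have "t * 2 ^ m / T \<le> 2 ^ m" using assms by (simp add: field_simps)
  then have "\<lfloor>t * 2 ^ m / T\<rfloor> \<le> 2 ^ m"
    by (metis floor_le_iff floor_mono floor_numeral_power of_int_numeral of_int_power order_refl)
  then show "j m \<le> 2 ^ m" unfolding j_def by (simp add: nat_le_iff)
  have r: "real (j m) = of_int \<lfloor>t * 2 ^ m / T\<rfloor>" unfolding j_def using assms by simp
  have "real (j m) \<le> t * 2 ^ m / T" unfolding r by (rule of_int_floor_le)
  then show "dyadic T m (j m) \<le> t" using assms(1) by (simp add: dyadic_def field_simps)
  have "t * 2 ^ m / T \<le> real (j m) + 1" unfolding r by linarith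
  then show "t \<le> dyadic T m (j m) + T / 2 ^ m" using assms(1) by (simp add: dyadic_def field_simps)
qed

text \<open>Let \<open>s\<close> be the last point of level \<open>m\<close> before
  \<open>t\<close>, and approach \<open>t\<close> from below by the points \<open>y r\<close> of
  level \<open>m + r\<close>. Each increment from \<open>s\<close> to \<open>y r\<close> obeys the
  energy bound at its own level, and continuity carries the bound to \<open>t\<close>.\<close>

lemma continuous_path_near_dyadic:
  fixes x :: "real \<Rightarrow> 'a::real_normed_vector"
  assumes T: "0 < T" and t: "t \<in> {0..T}" and cont: "continuous_on {0..T} x"
    and en: "\<And>n. dyadic_energy T n x \<le> e"
  obtains k where "k \<le> 2 ^ m" "(norm (x t - x (dyadic T m k)))\<^sup>2 \<le> T / 2 ^ m * e"
proof -
  define j where "j = (\<lambda>m. nat \<lfloor>t * 2 ^ m / T\<rfloor>)"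
  have fl: "j n \<le> 2 ^ n" "dyadic T n (j n) \<le> t" "t \<le> dyadic T n (j n) + T / 2 ^ n" for n
    unfolding j_def using dyadic_floor[OF T t] by auto
  define s where "s = dyadic T m (j m)"
  define y where "y r = dyadic T (m + r) (j (m + r))" for r
  have "0 \<le> e" using dyadic_energy_nonneg[OF T] en order_trans by blast
  have bound: "(norm (x (y r) - x s))\<^sup>2 \<le> T / 2 ^ m * e" for r
  proof -
    have s: "s = dyadic T (m + r) (j m * 2 ^ r)" by (simp add: s_def dyadic_refine)
    have "real (j m * 2 ^ r) \<le> t * 2 ^ (m + r) / T"
      using fl(2)[of m] T by (simp add: dyadic_def field_simps power_add)
    \<comment> \<open>The refined index of \<open>s\<close> does not exceed that of
      \<open>y r\<close>, so the increment runs forward on the common grid.\<close>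
    then have le: "j m * 2 ^ r \<le> j (m + r)"
      unfolding j_def by (simp add: le_nat_floor)
    have "(norm (x (y r) - x s))\<^sup>2 \<le> (y r - s) * dyadic_energy T (m + r) x"
      unfolding s y_def by (rule dyadic_increment_le_energy[OF T le fl(1)])
    also have "\<dots> \<le> T / 2 ^ m * e"
    proof (rule mult_mono[OF _ en])
      show "y r - s \<le> T / 2 ^ m" using fl(2)[of "m + r"] fl(3)[of m] by (simp add: y_def s_def)
    qed (use T dyadic_energy_nonneg in auto)
    finally show ?thesis .
  qed
  have yT: "y r \<in> {0..T}" for r
    unfolding y_def by (rule dyadic_mem[OF T fl(1)])
  have "y \<longlonglongrightarrow> t"
  proof (rule tendsto_sandwich)
    have "(\<lambda>r. T / 2 ^ m * (1 / 2) ^ r) \<longlonglongrightarrow> T / 2 ^ m * 0"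
      by (intro tendsto_intros LIMSEQ_power_zero) auto
    from tendsto_diff[OF tendsto_const this]
    show "(\<lambda>r. t - T / 2 ^ m * (1 / 2) ^ r) \<longlonglongrightarrow> t" by simp
    show "\<forall>\<^sub>F r in sequentially. t - T / 2 ^ m * (1 / 2) ^ r \<le> y r"
    proof (intro always_eventually allI)
      show "t - T / 2 ^ m * (1 / 2) ^ r \<le> y r" for r
        using fl(3)[of "m + r"] by (simp add: y_def power_add power_divide)
    qed
    show "\<forall>\<^sub>F r in sequentially. y r \<le> t"
      using fl(2) by (intro always_eventually) (auto simp: y_def)
  qed simp
  then have "(\<lambda>r. x (y r)) \<longlonglongrightarrow> x t"
    using t yT by (intro continuous_on_tendsto_compose[OF cont]) auto
  then have "(\<lambda>r. (norm (x (y r) - x s))\<^sup>2) \<longlonglongrightarrow> (norm (x t - x s))\<^sup>2"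
    by (intro tendsto_intros)
  then have "(norm (x t - x s))\<^sup>2 \<le> T / 2 ^ m * e"
    by (rule LIMSEQ_le_const2) (use bound in auto)
  then show thesis using that[of "j m"] fl(1) by (simp add: s_def)
qed

text \<open>The supremum is dominated pointwise by the values on the grid of level \<open>m\<close>
  plus a multiple of the total energy of the path. The Lipschitz bound in mean square controls the
  expected energy, and this part carries the factor \<open>1 / 2 ^ m\<close>.\<close>

lemma nn_integral_SUP_path_le:
  fixes D :: "'b \<Rightarrow> real \<Rightarrow> 'a::{real_inner,second_countable_topology}"
  assumes T: "0 < T" and C: "0 \<le> C"
    and D: "\<And>t. t \<in> {0..T} \<Longrightarrow> (\<lambda>\<omega>. D \<omega> t) \<in> L2 M"
    and cont: "\<And>\<omega>. continuous_on {0..T} (D \<omega>)"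
    and lip: "\<And>s t. s \<in> {0..T} \<Longrightarrow> t \<in> {0..T} \<Longrightarrow> L2norm M (\<lambda>\<omega>. D \<omega> s - D \<omega> t) \<le> C * \<bar>s - t\<bar>"
  shows "(\<integral>\<^sup>+\<omega>. ennreal ((SUP t\<in>{0..T}. norm (D \<omega> t))\<^sup>2) \<partial>M)
    \<le> ennreal (2 * (\<Sum>k\<le>2 ^ m. (L2norm M (\<lambda>\<omega>. D \<omega> (dyadic T m k)))\<^sup>2) + 2 * T\<^sup>2 * C\<^sup>2 / 2 ^ m)"
proof -
  define En where "En \<omega> = (SUP n. ennreal (dyadic_energy T n (D \<omega>)))" for \<omega>
  define S where "S \<omega> = (\<Sum>k\<le>2 ^ m. (norm (D \<omega> (dyadic T m k)))\<^sup>2)" for \<omega>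
  have Dm: "(\<lambda>\<omega>. D \<omega> (dyadic T n k)) \<in> L2 M" if "k \<le> 2 ^ n" for n k
    using D[OF dyadic_mem[OF T that]] .
  have Dd: "(\<lambda>\<omega>. D \<omega> (dyadic T n (Suc k)) - D \<omega> (dyadic T n k)) \<in> L2 M" if "k < 2 ^ n" for n k
    using that by (intro L2_diff Dm) auto
  have int_en: "integrable M (\<lambda>\<omega>. dyadic_energy T n (D \<omega>))" for n
    unfolding dyadic_energy_def using Dd
    by (intro Bochner_Integration.integrable_sum integrable_mult_right L2_integrable_power2) auto
  have "(\<integral>\<omega>. dyadic_energy T n (D \<omega>) \<partial>M) \<le> C\<^sup>2 * T" for n
  proof -
    have "(\<integral>\<omega>. dyadic_energy T n (D \<omega>) \<partial>M)
      = (\<Sum>k<2 ^ n. 2 ^ n / T * (L2norm M (\<lambda>\<omega>. D \<omega> (dyadic T n (Suc k)) - D \<omega> (dyadic T n k)))\<^sup>2)"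
      unfolding dyadic_energy_def L2norm_power2 using Dd
      by (subst Bochner_Integration.integral_sum)
        (auto intro!: integrable_divide integrable_mult_right L2_integrable_power2)
    \<comment> \<open>Every cell contributes at most \<open>C\<^sup>2 * T / 2 ^ n\<close>, so the
      bound on the total does not depend on the level.\<close>
    also have "\<dots> \<le> (\<Sum>k<(2::nat) ^ n. 2 ^ n / T * (C * (T / 2 ^ n))\<^sup>2)"
    proof (intro sum_mono mult_left_mono power_mono)
      fix k :: nat assume "k \<in> {..<2 ^ n}"
      then have "L2norm M (\<lambda>\<omega>. D \<omega> (dyadic T n (Suc k)) - D \<omega> (dyadic T n k))
        \<le> C * \<bar>dyadic T n (Suc k) - dyadic T n k\<bar>"
        using T by (intro lip dyadic_mem) auto
      also have "dyadic T n (Suc k) - dyadic T n k = T / 2 ^ n"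
        by (simp add: dyadic_def field_simps)
      finally show "L2norm M (\<lambda>\<omega>. D \<omega> (dyadic T n (Suc k)) - D \<omega> (dyadic T n k)) \<le> C * (T / 2 ^ n)"
        using T by simp
    qed (use T in auto)
    also have "\<dots> = C\<^sup>2 * T" using T by (simp add: power2_eq_square field_simps)
    finally show ?thesis .
  qed
  then have nn_en: "(\<integral>\<^sup>+\<omega>. ennreal (dyadic_energy T n (D \<omega>)) \<partial>M) \<le> ennreal (C\<^sup>2 * T)" for n
    using int_en dyadic_energy_nonneg[OF T] by (subst nn_integral_eq_integral) (auto intro!: ennreal_leI AE_I2)
  have [measurable]: "En \<in> borel_measurable M"
    unfolding En_def using int_en by (auto intro!: borel_measurable_SUP)
  \<comment> \<open>Refinement increases the energy, so expectation and supremum over the levels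
    commute.\<close>
  have "(\<integral>\<^sup>+\<omega>. En \<omega> \<partial>M) = (SUP n. \<integral>\<^sup>+\<omega>. ennreal (dyadic_energy T n (D \<omega>)) \<partial>M)"
    unfolding En_def using int_en T
    by (intro nn_integral_monotone_convergence_SUP)
      (auto simp: incseq_def le_fun_def intro!: ennreal_leI dyadic_energy_mono)
  also have "\<dots> \<le> ennreal (C\<^sup>2 * T)" by (intro SUP_least nn_en)
  finally have nn_En: "(\<integral>\<^sup>+\<omega>. En \<omega> \<partial>M) \<le> ennreal (C\<^sup>2 * T)" .
  have int_S: "integrable M S"
    unfolding S_def using Dm by (intro Bochner_Integration.integrable_sum L2_integrable_power2) auto
  have S_nonneg: "0 \<le> S \<omega>" for \<omega> unfolding S_def by (intro sum_nonneg) auto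
  have "ennreal ((SUP t\<in>{0..T}. norm (D \<omega> t))\<^sup>2) \<le> ennreal (2 * S \<omega>) + ennreal (2 * T / 2 ^ m) * En \<omega>" for \<omega>
  proof (cases "En \<omega>")
    case (real e)
    have en: "dyadic_energy T n (D \<omega>) \<le> e" for n
    proof -
      have "ennreal (dyadic_energy T n (D \<omega>)) \<le> ennreal e"
        unfolding real(2)[symmetric] En_def by (rule SUP_upper) simp
      then show ?thesis using real(1) by simp
    qed
    have B: "(norm (D \<omega> t))\<^sup>2 \<le> 2 * S \<omega> + 2 * T / 2 ^ m * e" if tT: "t \<in> {0..T}" for t
    proof -
      obtain k where k: "k \<le> 2 ^ m" "(norm (D \<omega> t - D \<omega> (dyadic T m k)))\<^sup>2 \<le> T / 2 ^ m * e"
        using continuous_path_near_dyadic[OF T tT cont en] .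
      have "(norm (D \<omega> t))\<^sup>2 \<le> 2 * (norm (D \<omega> (dyadic T m k)))\<^sup>2 + 2 * (norm (D \<omega> t - D \<omega> (dyadic T m k)))\<^sup>2"
        using norm_add_power2_le[of "D \<omega> (dyadic T m k)" "D \<omega> t - D \<omega> (dyadic T m k)"] by simp
      \<comment> \<open>The nearby grid point depends on the path and on \<open>t\<close>; the sum
        over all grid points bounds it uniformly.\<close>
      moreover have "(norm (D \<omega> (dyadic T m k)))\<^sup>2 \<le> S \<omega>"
        unfolding S_def using k(1) by (intro member_le_sum) auto
      ultimately show ?thesis using k(2) by simp
    qed
    have "(SUP t\<in>{0..T}. norm (D \<omega> t)) \<le> sqrt (2 * S \<omega> + 2 * T / 2 ^ m * e)"
      using T B by (intro cSUP_least real_le_rsqrt) auto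
    moreover have "0 \<le> (SUP t\<in>{0..T}. norm (D \<omega> t))"
    proof (rule cSUP_upper2[where x = 0])
      show "bdd_above ((\<lambda>t. norm (D \<omega> t)) ` {0..T})"
        using B by (intro bdd_aboveI2[where M = "sqrt (2 * S \<omega> + 2 * T / 2 ^ m * e)"] real_le_rsqrt)
    qed (use T in auto)
    moreover have "0 \<le> 2 * S \<omega> + 2 * T / 2 ^ m * e" using S_nonneg T real(1) by simp
    ultimately have "(SUP t\<in>{0..T}. norm (D \<omega> t))\<^sup>2 \<le> 2 * S \<omega> + 2 * T / 2 ^ m * e"
      by (metis power_mono real_sqrt_pow2)
    then have "ennreal ((SUP t\<in>{0..T}. norm (D \<omega> t))\<^sup>2) \<le> ennreal (2 * S \<omega> + 2 * T / 2 ^ m * e)"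
      by (rule ennreal_leI)
    also have "\<dots> = ennreal (2 * S \<omega>) + ennreal (2 * T / 2 ^ m) * En \<omega>"
    proof -
      have "ennreal (2 * S \<omega> + 2 * T / 2 ^ m * e) = ennreal (2 * S \<omega>) + ennreal (2 * T / 2 ^ m * e)"
        using S_nonneg T real(1) by (intro ennreal_plus) auto
      also have "ennreal (2 * T / 2 ^ m * e) = ennreal (2 * T / 2 ^ m) * ennreal e"
        using T real(1) by (intro ennreal_mult) auto
      finally show ?thesis by (simp only: real(2))
    qed
    finally show ?thesis .
  next
    \<comment> \<open>A path of infinite energy makes the right-hand side infinite, as its
      coefficient is positive.\<close>
    case top
    then show ?thesis using T by (simp add: ennreal_mult_top)
  qed
  then have "(\<integral>\<^sup>+\<omega>. ennreal ((SUP t\<in>{0..T}. norm (D \<omega> t))\<^sup>2) \<partial>M)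
      \<le> (\<integral>\<^sup>+\<omega>. ennreal (2 * S \<omega>) + ennreal (2 * T / 2 ^ m) * En \<omega> \<partial>M)"
    by (intro nn_integral_mono)
  also have "\<dots> = (\<integral>\<^sup>+\<omega>. ennreal (2 * S \<omega>) \<partial>M) + ennreal (2 * T / 2 ^ m) * (\<integral>\<^sup>+\<omega>. En \<omega> \<partial>M)"
    using int_S by (subst nn_integral_add) (auto simp: nn_integral_cmult)
  also have "(\<integral>\<^sup>+\<omega>. ennreal (2 * S \<omega>) \<partial>M) = ennreal (2 * (\<integral>\<omega>. S \<omega> \<partial>M))"
    using int_S S_nonneg by (subst nn_integral_eq_integral) auto
  also have "(\<integral>\<omega>. S \<omega> \<partial>M) = (\<Sum>k\<le>2 ^ m. (L2norm M (\<lambda>\<omega>. D \<omega> (dyadic T m k)))\<^sup>2)"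
    unfolding S_def L2norm_power2 using Dm
    by (intro Bochner_Integration.integral_sum L2_integrable_power2) auto
  also have "ennreal (2 * T / 2 ^ m) * (\<integral>\<^sup>+\<omega>. En \<omega> \<partial>M) \<le> ennreal (2 * T / 2 ^ m) * ennreal (C\<^sup>2 * T)"
    by (intro mult_left_mono nn_En) auto
  also have "\<dots> = ennreal (2 * T\<^sup>2 * C\<^sup>2 / 2 ^ m)"
    using T C by (subst ennreal_mult[symmetric]) (auto simp: power2_eq_square mult_ac)
  finally show ?thesis
    using T by (simp add: sum_nonneg flip: ennreal_plus)
qed

section \<open>Barycenters and disintegrations\<close>

text \<open>The sequence is fixed before any measure is chosen. Hence the barycenters of a whole
  kernel are limits of the same finite sums, which gives their measurability.\<close>

lemma simple_approximation_of_identity: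
  obtains s :: "nat \<Rightarrow> 'a::{real_normed_vector,second_countable_topology} \<Rightarrow> 'a"
  where "\<And>i. simple_function borel (s i)" "\<And>v. (\<lambda>i. s i v) \<longlonglongrightarrow> v"
    "\<And>i v. norm (s i v) \<le> 2 * norm v"
proof -
  have "(\<lambda>v::'a. v) \<in> borel_measurable borel" by simp
  from borel_measurable_implies_sequence_metric[OF this, of 0]
  show thesis using that by simp metis
qed

text \<open>The sort of the ambient space does not include \<open>banach\<close>, so the library's
  integrability criterion does not apply to vector-valued functions.\<close>

lemma barycenter_limit:
  fixes s :: "nat \<Rightarrow> 'a \<Rightarrow> 'a::{real_normed_vector,complete_space,second_countable_topology}"
    and M :: "'a measure"
  assumes s: "\<And>i. simple_function borel (s i)" "\<And>v. (\<lambda>i. s i v) \<longlonglongrightarrow> v"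
    "\<And>i v. norm (s i v) \<le> 2 * norm v"
    and M: "sets M = sets borel" and fin: "(\<integral>\<^sup>+v. norm v \<partial>M) < \<infinity>"
  shows "has_bochner_integral M (\<lambda>v. v) (\<integral>v. v \<partial>M)"
    and "(\<lambda>i. Bochner_Integration.simple_bochner_integral M (s i)) \<longlonglongrightarrow> (\<integral>v. v \<partial>M)"
proof -
  have [measurable_cong]: "sets M = sets borel" by fact
  have sM: "simple_function M (s i)" for i
    using s(1)[of i] simple_function_cong_algebra[OF M] M sets_eq_imp_space_eq[OF M] by blast
  then have [measurable]: "s i \<in> borel_measurable M" for i by (rule borel_measurable_simple_function)
  have fin2: "(\<integral>\<^sup>+v. ennreal (2 * norm v) \<partial>M) < \<infinity>"
    using fin by (simp add: nn_integral_cmult ennreal_mult ennreal_mult_less_top)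
  have sb: "Bochner_Integration.simple_bochner_integrable M (s i)" for i
  proof (rule simple_bochner_integrableI_bounded[OF sM])
    have "(\<integral>\<^sup>+v. norm (s i v) \<partial>M) \<le> (\<integral>\<^sup>+v. ennreal (2 * norm v) \<partial>M)"
      using s(3) by (intro nn_integral_mono ennreal_leI)
    then show "(\<integral>\<^sup>+v. norm (s i v) \<partial>M) < \<infinity>" using fin2 by (rule le_less_trans)
  qed
  have lim: "(\<lambda>i. \<integral>\<^sup>+v. norm (v - s i v) \<partial>M) \<longlonglongrightarrow> 0"
    by (rule nn_integral_dominated_convergence_norm[where w = "\<lambda>v. 2 * norm v"])
      (use s fin2 in auto)
  \<comment> \<open>The approximations converge in mean, so their integrals form a Cauchy sequence,
    and completeness of the space provides the value of the barycenter.\<close>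
  have "Cauchy (\<lambda>i. Bochner_Integration.simple_bochner_integral M (s i))"
  proof (rule metric_CauchyI)
    fix e :: real assume "0 < e"
    then have "0 < ennreal (e / 2)" by simp
    from order_tendstoD(2)[OF lim this]
    obtain n0 where n0: "\<And>n. n0 \<le> n \<Longrightarrow> (\<integral>\<^sup>+v. norm (v - s n v) \<partial>M) < ennreal (e / 2)"
      by (auto simp: eventually_sequentially)
    have "dist (Bochner_Integration.simple_bochner_integral M (s m)) (Bochner_Integration.simple_bochner_integral M (s n)) < e"
      if "n0 \<le> m" "n0 \<le> n" for m n
    proof -
      have "ennreal (norm (Bochner_Integration.simple_bochner_integral M (s m) - Bochner_Integration.simple_bochner_integral M (s n)))
        \<le> (\<integral>\<^sup>+v. norm (v - s m v) \<partial>M) + (\<integral>\<^sup>+v. norm (v - s n v) \<partial>M)"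
        by (intro simple_bochner_integral_bounded sb) simp
      also have "\<dots> < ennreal (e / 2) + ennreal (e / 2)"
        by (intro add_strict_mono n0 that)
      also have "\<dots> = ennreal e" using \<open>0 < e\<close> by (simp flip: ennreal_plus)
      finally show ?thesis using \<open>0 < e\<close> by (simp add: dist_norm ennreal_less_iff)
    qed
    then show "\<exists>n0. \<forall>m\<ge>n0. \<forall>n\<ge>n0. dist (Bochner_Integration.simple_bochner_integral M (s m)) (Bochner_Integration.simple_bochner_integral M (s n)) < e"
      by blast
  qed
  then obtain b where b: "(\<lambda>i. Bochner_Integration.simple_bochner_integral M (s i)) \<longlonglongrightarrow> b"
    using Cauchy_convergent_iff convergent_def by blast
  have "has_bochner_integral M (\<lambda>v. v) b"
    by (rule has_bochner_integral.intros[OF _ sb lim b]) simp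
  moreover from this have "(\<integral>v. v \<partial>M) = b" by (rule has_bochner_integral_integral_eq)
  ultimately show "has_bochner_integral M (\<lambda>v. v) (\<integral>v. v \<partial>M)"
    "(\<lambda>i. Bochner_Integration.simple_bochner_integral M (s i)) \<longlonglongrightarrow> (\<integral>v. v \<partial>M)"
    using b by simp_all
qed

lemma has_bochner_integral_barycenter:
  fixes M :: "'a::{real_normed_vector,complete_space,second_countable_topology} measure"
  assumes "sets M = sets borel" "(\<integral>\<^sup>+v. norm v \<partial>M) < \<infinity>"
  shows "has_bochner_integral M (\<lambda>v. v) (\<integral>v. v \<partial>M)"
proof -
  obtain s :: "nat \<Rightarrow> 'a \<Rightarrow> 'a" where "\<And>i. simple_function borel (s i)" "\<And>v. (\<lambda>i. s i v) \<longlonglongrightarrow> v"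
    "\<And>i v. norm (s i v) \<le> 2 * norm v"
    using simple_approximation_of_identity by blast
  from barycenter_limit(1)[OF this assms] show ?thesis .
qed

text \<open>For a fixed simple function the integral under \<open>K x\<close> is a finite
  combination of masses of \<open>K x\<close>, hence measurable in \<open>x\<close>; the barycenter
  is the limit of these wherever the first moment is finite.\<close>

lemma barycenter_measurable:
  fixes K :: "'c \<Rightarrow> 'a::{real_normed_vector,complete_space,second_countable_topology} measure"
  assumes K[measurable]: "K \<in> measurable N (subprob_algebra borel)"
  shows "(\<lambda>x. \<integral>v. v \<partial>K x) \<in> borel_measurable N"
proof -
  obtain s :: "nat \<Rightarrow> 'a \<Rightarrow> 'a" where s: "\<And>i. simple_function borel (s i)" "\<And>v. (\<lambda>i. s i v) \<longlonglongrightarrow> v"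
    "\<And>i v. norm (s i v) \<le> 2 * norm v"
    using simple_approximation_of_identity by blast
  have sK: "sets (K x) = sets borel" if "x \<in> space N" for x
    using measurable_space[OF K that] by (simp add: space_subprob_algebra)
  define F where "F = {x \<in> space N. (\<integral>\<^sup>+v. norm v \<partial>K x) < \<infinity>}"
  have [measurable]: "(\<lambda>x. \<integral>\<^sup>+v. norm v \<partial>K x) \<in> borel_measurable N"
    by (rule measurable_compose[OF K nn_integral_measurable_subprob_algebra]) simp
  have [measurable]: "F \<in> sets N" unfolding F_def by measurable
  define g where "g i x = (\<Sum>y\<in>range (s i). measure (K x) {v. s i v = y} *\<^sub>R y)" for i x
  have [measurable]: "g i \<in> borel_measurable N" for i
  proof -
    have "{v. s i v = y} \<in> sets borel" for y
      using simple_functionD(2)[OF s(1)[of i], of "{y}"] by (simp add: vimage_def)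
    then have [measurable]: "(\<lambda>x. measure (K x) {v. s i v = y}) \<in> borel_measurable N" for y
      by (intro measurable_compose[OF K measurable_measure_subprob_algebra])
    show ?thesis unfolding g_def by measurable
  qed
  show ?thesis
  proof (rule borel_measurable_LIMSEQ_metric)
    \<comment> \<open>Where the first moment is infinite the Bochner integral has the default value
      0, and so does the else branch.\<close>
    show "(\<lambda>x. if x \<in> F then g i x else 0) \<in> borel_measurable N" for i by measurable
    fix x assume x: "x \<in> space N"
    show "(\<lambda>i. if x \<in> F then g i x else 0) \<longlonglongrightarrow> (\<integral>v. v \<partial>K x)"
    proof (cases "x \<in> F")
      case True
      have "Bochner_Integration.simple_bochner_integral (K x) (s i) = g i x" for i
        unfolding simple_bochner_integral_def g_def using sets_eq_imp_space_eq[OF sK[OF x]] by simp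
      then show ?thesis
        using barycenter_limit(2)[OF s sK[OF x]] True by (simp add: F_def)
    next
      case False
      then have "\<not> (\<integral>\<^sup>+v. norm v \<partial>K x) < \<infinity>" using x by (simp add: F_def)
      then have "\<not> integrable (K x) (\<lambda>v. v)"
        using has_bochner_integral_implies_finite_norm has_bochner_integral_integrable by blast
      then show ?thesis using False by (simp add: not_integrable_integral_eq)
    qed
  qed
qed

section \<open>Disintegrations as kernels\<close>

lemma disint_kernel:
  assumes "disint \<mu> \<Phi> K"
  shows "K \<in> measurable \<mu> (subprob_algebra borel)"
  using assms unfolding disint_def
  by (intro measurable_subprob_algebra) (auto intro: prob_space_imp_subprob_space)

lemma measurable_Pair_const:
  "Pair (x::'c::second_countable_topology) \<in> measurable borel (borel :: ('c \<times> 'd::second_countable_topology) measure)"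
  unfolding borel_prod[symmetric] by simp

text \<open>The identity on sets that defines a disintegration says that \<Phi> is the bind of \<mu>
  with the kernel placing \<open>K x\<close> on the fibre over \<open>x\<close>; integration against
  a bind gives the rest.\<close>

lemma disint_nn_integral:
  fixes \<Phi> :: "('c::second_countable_topology \<times> 'd::second_countable_topology) measure"
  assumes K: "disint \<mu> \<Phi> K" and sets: "sets \<mu> = sets borel" "sets \<Phi> = sets borel"
    and f[measurable]: "f \<in> borel_measurable borel"
  shows "(\<integral>\<^sup>+p. f p \<partial>\<Phi>) = (\<integral>\<^sup>+x. \<integral>\<^sup>+y. f (x, y) \<partial>K x \<partial>\<mu>)"
proof -
  note [measurable] = disint_kernel[OF K] measurable_Pair_const
  have sK [measurable_cong]: "sets (K x) = sets borel" for x using K by (auto simp: disint_def)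
  have spK: "space (K x) = UNIV" for x using sets_eq_imp_space_eq[OF sK] by simp
  have "space \<mu> = UNIV" using sets_eq_imp_space_eq[OF sets(1)] by simp
  have [measurable]: "Pair x \<in> measurable (K x) borel" for x :: 'c
    by (subst measurable_cong_sets[OF sK refl]) (rule measurable_Pair_const)
  have "case_prod Pair \<in> measurable (\<mu> \<Otimes>\<^sub>M borel) (borel :: ('c \<times> 'd) measure)"
    unfolding measurable_cong_sets[OF sets_pair_measure_cong[OF sets(1) refl] refl] borel_prod by simp
  then have k: "(\<lambda>x. distr (K x) borel (Pair x)) \<in> measurable \<mu> (subprob_algebra borel)"
    by (rule measurable_distr2[OF _ disint_kernel[OF K]])
  have "\<Phi> = \<mu> \<bind> (\<lambda>x. distr (K x) borel (Pair x))"
  proof (rule measure_eqI)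
    show "sets \<Phi> = sets (\<mu> \<bind> (\<lambda>x. distr (K x) borel (Pair x)))"
      using sets \<open>space \<mu> = UNIV\<close> by (simp add: sets_bind[OF sets_kernel[OF k]])
  next
    fix C assume "C \<in> sets \<Phi>"
    then have C: "C \<in> sets borel" using sets by simp
    then show "emeasure \<Phi> C = emeasure (\<mu> \<bind> (\<lambda>x. distr (K x) borel (Pair x))) C"
      using K by (subst emeasure_bind[OF _ k C]) (auto simp: \<open>space \<mu> = UNIV\<close> disint_def emeasure_distr spK)
  qed
  then show ?thesis
    by (simp add: nn_integral_bind[OF f k] nn_integral_distr)
qed

section \<open>The laws of the Euler chain\<close>

lemma emeasure_distr_eq_nn_integral:
  assumes "f \<in> measurable M N" "C \<in> sets N"
  shows "emeasure (distr M N f) C = (\<integral>\<^sup>+x. indicator C (f x) \<partial>M)"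
proof -
  have "emeasure (distr M N f) C = (\<integral>\<^sup>+p. indicator C p \<partial>distr M N f)"
    using assms by simp
  also have "\<dots> = (\<integral>\<^sup>+x. indicator C (f x) \<partial>M)"
    using assms by (intro nn_integral_distr) auto
  finally show ?thesis .
qed

lemma seqM_Suc_eq_insert: "(seqM (Suc n) :: (nat \<Rightarrow> 'a::topological_space) measure) = Pi\<^sub>M (insert (Suc n) {0..n}) (\<lambda>_. borel)"
  by (simp add: atLeast0_atMost_Suc)

context
  fixes Ts :: "nat \<Rightarrow> ('a::second_countable_topology \<times> 'a) measure" and K :: "nat \<Rightarrow> 'a \<Rightarrow> 'a measure"
    and N :: nat
  assumes sets_Ts: "\<And>n. n < N \<Longrightarrow> sets (Ts n) = sets borel"
    and prob_Ts: "\<And>n. n < N \<Longrightarrow> prob_space (Ts n)"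
    and K: "\<And>n. n < N \<Longrightarrow> disint (distr (Ts n) borel fst) (Ts n) (K n)"
    and chain: "\<And>n. Suc n < N \<Longrightarrow> distr (Ts n) borel snd = distr (Ts (Suc n)) borel fst"
begin

lemma K_kernel: "n < N \<Longrightarrow> K n \<in> measurable borel (subprob_algebra borel)"
  using disint_kernel[OF K[of n]] by simp

lemma prob_K: "n < N \<Longrightarrow> prob_space (K n x)" and sets_K: "n < N \<Longrightarrow> sets (K n x) = sets borel"
  using K[of n] by (auto simp: disint_def)

text \<open>Appending a random coordinate is a kernel on finite sequences, which lets the recursion
  for \<open>alpha\<close> be read as a bind.\<close>

lemma alpha_step_kernel:
  assumes "Suc m < N"
  shows "(\<lambda>x. distr (K (Suc m) (x (Suc m))) (seqM (Suc (Suc m))) (\<lambda>y. x(Suc (Suc m) := y)))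
    \<in> measurable (seqM (Suc m)) (subprob_algebra (seqM (Suc (Suc m))))"
proof (rule measurable_distr2)
  show "(\<lambda>(x, y). x(Suc (Suc m) := y)) \<in> measurable (seqM (Suc m) \<Otimes>\<^sub>M borel) (seqM (Suc (Suc m)))"
    unfolding seqM_Suc_eq_insert[of "Suc m"] by (rule measurable_add_dim)
  show "(\<lambda>x. K (Suc m) (x (Suc m))) \<in> measurable (seqM (Suc m)) (subprob_algebra borel)"
    by (rule measurable_compose[OF _ K_kernel[OF assms]]) simp
qed

lemma alpha_0:
  assumes "0 < N"
  shows "sets (alpha Ts K 0) = sets (seqM (Suc 0))" "prob_space (alpha Ts K 0)"
    "\<And>f. f \<in> borel_measurable (seqM (Suc 0)) \<Longrightarrow> (\<integral>\<^sup>+x. f x \<partial>alpha Ts K 0)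
      = (\<integral>\<^sup>+p. f (\<lambda>i\<in>{0..1}. if i = 0 then fst p else snd p) \<partial>Ts 0)"
proof -
  have [measurable_cong]: "sets (Ts 0) = sets (borel \<Otimes>\<^sub>M borel)" unfolding borel_prod by (rule sets_Ts[OF assms])
  have m [measurable]: "(\<lambda>p. \<lambda>i\<in>{0..1}. if i = 0 then fst p else snd p) \<in> measurable (Ts 0) (seqM 1)"
    by (rule measurable_restrict) auto
  show "sets (alpha Ts K 0) = sets (seqM (Suc 0))" by simp
  interpret prob_space "Ts 0" using prob_Ts[OF assms] .
  show "prob_space (alpha Ts K 0)" unfolding alpha.simps by (rule prob_space_distr[OF m])
  show "(\<integral>\<^sup>+x. f x \<partial>alpha Ts K 0) = (\<integral>\<^sup>+p. f (\<lambda>i\<in>{0..1}. if i = 0 then fst p else snd p) \<partial>Ts 0)"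
    if "f \<in> borel_measurable (seqM (Suc 0))" for f
    unfolding alpha.simps using that by (intro nn_integral_distr[OF m]) simp
qed

text \<open>The facts on the previous law are premises because \<open>measure_of\<close> yields the
  intended values only if the set function in the recursion is a measure, which is known stage by
  stage.\<close>

lemma alpha_Suc:
  assumes m: "Suc m < N" and IH: "sets (alpha Ts K m) = sets (seqM (Suc m))" "prob_space (alpha Ts K m)"
  shows "sets (alpha Ts K (Suc m)) = sets (seqM (Suc (Suc m)))" "prob_space (alpha Ts K (Suc m))"
    "\<And>f. f \<in> borel_measurable (seqM (Suc (Suc m))) \<Longrightarrow> (\<integral>\<^sup>+x. f x \<partial>alpha Ts K (Suc m))
      = (\<integral>\<^sup>+x. \<integral>\<^sup>+y. f (x(Suc (Suc m) := y)) \<partial>K (Suc m) (x (Suc m)) \<partial>alpha Ts K m)"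
proof -
  define k where "k x = distr (K (Suc m) (x (Suc m))) (seqM (Suc (Suc m))) (\<lambda>y. x(Suc (Suc m) := y))" for x
  define B where "B = alpha Ts K m \<bind> k"
  have k: "k \<in> measurable (alpha Ts K m) (subprob_algebra (seqM (Suc (Suc m))))"
    unfolding k_def measurable_cong_sets[OF IH(1) refl] by (rule alpha_step_kernel[OF m])
  have upd: "(\<lambda>y. x(Suc (Suc m) := y)) \<in> measurable (K (Suc m) z) (seqM (Suc (Suc m)))"
    if "x \<in> space (seqM (Suc m))" for x z
    using measurable_compose[OF measurable_Pair1'[OF that] measurable_add_dim[of "Suc (Suc m)" "{0..Suc m}" "\<lambda>_. borel"]]
    unfolding seqM_Suc_eq_insert[of "Suc m"] measurable_cong_sets[OF sets_K[OF m] refl] by simp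
  interpret A: prob_space "alpha Ts K m" by fact
  have sp: "space (alpha Ts K m) = space (seqM (Suc m))" using IH(1) by (rule sets_eq_imp_space_eq)
  have setsB: "sets B = sets (seqM (Suc (Suc m)))"
    unfolding B_def by (rule sets_bind[OF sets_kernel[OF k] A.not_empty])
  have spK: "space (K (Suc m) z) = UNIV" for z using sets_eq_imp_space_eq[OF sets_K[OF m]] by simp
  \<comment> \<open>The set function in the definition agrees with \<open>B\<close> on every
    measurable set, and \<open>B\<close> is a measure, so \<open>measure_of\<close> returns
    \<open>B\<close> itself.\<close>
  have "alpha Ts K (Suc m) = measure_of (space B) (sets B) (emeasure B)"
    unfolding alpha.simps sets_eq_imp_space_eq[OF setsB] setsB
  proof (rule measure_of_eq)
    fix C assume "C \<in> sigma_sets (space (seqM (Suc (Suc m)))) (sets (seqM (Suc (Suc m)) :: (nat \<Rightarrow> 'a) measure))"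
    then have C: "C \<in> sets (seqM (Suc (Suc m)))" by (simp add: sets.sigma_sets_eq)
    have "emeasure B C = (\<integral>\<^sup>+x. emeasure (k x) C \<partial>alpha Ts K m)"
      unfolding B_def by (rule emeasure_bind[OF A.not_empty k C])
    also have "\<dots> = (\<integral>\<^sup>+x. emeasure (K (Suc m) (x (Suc m))) {y. x(Suc (Suc m) := y) \<in> C} \<partial>alpha Ts K m)"
      by (intro nn_integral_cong) (simp add: k_def emeasure_distr[OF upd C] sp spK vimage_def)
    finally show "(\<integral>\<^sup>+x. emeasure (K (Suc m) (x (Suc m))) {y. x(Suc (Suc m) := y) \<in> C} \<partial>alpha Ts K m) = emeasure B C"
      by simp
  qed (rule sets.space_closed)
  then have B: "alpha Ts K (Suc m) = B" by (simp add: measure_of_of_measure)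
  show "sets (alpha Ts K (Suc m)) = sets (seqM (Suc (Suc m)))" unfolding B by fact
  show eq: "(\<integral>\<^sup>+x. f x \<partial>alpha Ts K (Suc m))
      = (\<integral>\<^sup>+x. \<integral>\<^sup>+y. f (x(Suc (Suc m) := y)) \<partial>K (Suc m) (x (Suc m)) \<partial>alpha Ts K m)"
    if f: "f \<in> borel_measurable (seqM (Suc (Suc m)))" for f
    unfolding B B_def nn_integral_bind[OF f k]
    by (intro nn_integral_cong) (simp add: k_def nn_integral_distr[OF upd] f sp)
  have "emeasure (alpha Ts K (Suc m)) (space (alpha Ts K (Suc m))) = (\<integral>\<^sup>+x. 1 \<partial>alpha Ts K (Suc m))"
    by simp
  also have "\<dots> = 1"
    using prob_space.emeasure_space_1[OF prob_K[OF m]] A.emeasure_space_1 by (subst eq) auto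
  finally show "prob_space (alpha Ts K (Suc m))" by (rule prob_spaceI)
qed

lemma alpha_sets_prob:
  "m < N \<Longrightarrow> sets (alpha Ts K m) = sets (seqM (Suc m)) \<and> prob_space (alpha Ts K m)"
proof (induction m)
  case 0
  then show ?case using alpha_0(1,2) by blast
next
  case (Suc m)
  then show ?case using alpha_Suc(1,2)[of m] by simp
qed

text \<open>The kernels have total mass one, so a new coordinate does not change integrals of
  functions of the old ones. Two functions appear because \<open>f\<close> and \<open>f'\<close>
  live on different product spaces.\<close>

lemma alpha_restrict:
  assumes m: "Suc m < N" and f: "f \<in> borel_measurable (seqM (Suc m))"
    and f': "f' \<in> borel_measurable (seqM (Suc (Suc m)))"
    and eq: "\<And>x y. x \<in> space (seqM (Suc m)) \<Longrightarrow> f' (x(Suc (Suc m) := y)) = f x"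
  shows "(\<integral>\<^sup>+x. f' x \<partial>alpha Ts K (Suc m)) = (\<integral>\<^sup>+x. f x \<partial>alpha Ts K m)"
proof -
  have A: "sets (alpha Ts K m) = sets (seqM (Suc m))" "prob_space (alpha Ts K m)"
    using alpha_sets_prob[of m] m by auto
  show ?thesis
    unfolding alpha_Suc(3)[OF m A f']
    using prob_space.emeasure_space_1[OF prob_K[OF m]]
    by (intro nn_integral_cong) (simp add: eq sets_eq_imp_space_eq[OF A(1)])
qed

lemma kernel_integral_measurable:
  assumes "n < N" "f \<in> borel_measurable (borel :: ('a \<times> 'a \<times> 'a) measure)" "i \<in> I" "j \<in> I"
  shows "(\<lambda>x. \<integral>\<^sup>+y. f (x i, x j, y) \<partial>K n (x j)) \<in> borel_measurable (Pi\<^sub>M I (\<lambda>_. borel))"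
proof -
  note [measurable] = K_kernel[OF assms(1)]
  have [measurable]: "f \<in> borel_measurable (borel \<Otimes>\<^sub>M borel \<Otimes>\<^sub>M borel)"
    using assms(2) by (simp add: borel_prod)
  have [measurable]: "(\<lambda>x. x i) \<in> measurable (Pi\<^sub>M I (\<lambda>_. borel)) borel" "(\<lambda>x. x j) \<in> measurable (Pi\<^sub>M I (\<lambda>_. borel)) borel"
    using assms(3,4) by (auto intro: measurable_component_singleton)
  show ?thesis
    by (rule nn_integral_measurable_subprob_algebra2[where N = borel]) measurable
qed

text \<open>Coordinate 0 is carried along because the errors of the velocities will be tested on
  cells of the starting point. If \<open>n\<close> is the last step the identity is the recursion
  itself (for \<open>m = 0\<close>, the disintegration of \<open>Ts 0\<close>); otherwise neither
  side sees the last coordinate.\<close>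

lemma alpha_Markov:
  assumes "m < N" "n \<le> m" and f: "f \<in> borel_measurable (borel :: ('a \<times> 'a \<times> 'a) measure)"
  shows "(\<integral>\<^sup>+x. f (x 0, x n, x (Suc n)) \<partial>alpha Ts K m)
    = (\<integral>\<^sup>+x. \<integral>\<^sup>+y. f (x 0, x n, y) \<partial>K n (x n) \<partial>alpha Ts K m)"
proof -
  have f'[measurable]: "f \<in> borel_measurable (borel \<Otimes>\<^sub>M borel \<Otimes>\<^sub>M borel)"
    using f by (simp add: borel_prod)
  have c: "(\<lambda>x. f (x i, x j, x k)) \<in> borel_measurable (Pi\<^sub>M I (\<lambda>_. borel))" if "i \<in> I" "j \<in> I" "k \<in> I" for i j k :: nat and I
    using that by measurable
  show ?thesis using assms(1,2)
  proof (induction m)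
    case 0
    then have N: "0 < N" and [simp]: "n = 0" by auto
    have [measurable_cong]: "sets (Ts 0) = sets (borel \<Otimes>\<^sub>M borel)" unfolding borel_prod by (rule sets_Ts[OF N])
    have "(\<integral>\<^sup>+x. f (x 0, x n, x (Suc n)) \<partial>alpha Ts K 0) = (\<integral>\<^sup>+p. f (fst p, fst p, snd p) \<partial>Ts 0)"
      using alpha_0(3)[OF N c[of 0 "{0..Suc 0}" 0 "Suc 0"]] by simp
    also have "\<dots> = (\<integral>\<^sup>+x. \<integral>\<^sup>+y. f (x, x, y) \<partial>K 0 x \<partial>distr (Ts 0) borel fst)"
      by (subst disint_nn_integral[OF K[OF N] _ sets_Ts[OF N]])
        (auto simp: borel_prod[symmetric])
    also have "\<dots> = (\<integral>\<^sup>+p. \<integral>\<^sup>+y. f (fst p, fst p, y) \<partial>K 0 (fst p) \<partial>Ts 0)"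
    proof (rule nn_integral_distr)
      note [measurable] = K_kernel[OF N]
      have "(\<lambda>x. \<integral>\<^sup>+y. f (x, x, y) \<partial>K 0 x) \<in> borel_measurable borel"
        by (rule nn_integral_measurable_subprob_algebra2[where N = borel]) measurable
      then show "(\<lambda>x. \<integral>\<^sup>+y. f (x, x, y) \<partial>K 0 x) \<in> borel_measurable (distr (Ts 0) borel fst)"
        by simp
    qed simp
    also have "\<dots> = (\<integral>\<^sup>+x. \<integral>\<^sup>+y. f (x 0, x n, y) \<partial>K n (x n) \<partial>alpha Ts K 0)"
      using alpha_0(3)[OF N kernel_integral_measurable[OF N f, of 0 "{0..Suc 0}" 0]] by simp
    finally show ?case .
  next
    case (Suc m)
    show ?case
    proof (cases "n = Suc m")
      case True
      have A: "sets (alpha Ts K m) = sets (seqM (Suc m))" "prob_space (alpha Ts K m)"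
        using alpha_sets_prob[of m] Suc.prems by auto
      have "(\<integral>\<^sup>+x. f (x 0, x n, x (Suc n)) \<partial>alpha Ts K (Suc m))
        = (\<integral>\<^sup>+x. \<integral>\<^sup>+y. f (x 0, x n, y) \<partial>K n (x n) \<partial>alpha Ts K m)"
        using alpha_Suc(3)[OF Suc.prems(1) A c[of 0 "{0..Suc (Suc m)}" n "Suc n"]] True by simp
      also have "\<dots> = (\<integral>\<^sup>+x. \<integral>\<^sup>+y. f (x 0, x n, y) \<partial>K n (x n) \<partial>alpha Ts K (Suc m))"
        using Suc.prems True
        by (intro alpha_restrict[symmetric] kernel_integral_measurable f) auto
      finally show ?thesis .
    next
      case False
      then have n: "n \<le> m" using Suc.prems by simp
      have "(\<integral>\<^sup>+x. f (x 0, x n, x (Suc n)) \<partial>alpha Ts K (Suc m)) = (\<integral>\<^sup>+x. f (x 0, x n, x (Suc n)) \<partial>alpha Ts K m)"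
        using Suc.prems n by (intro alpha_restrict c) auto
      also have "\<dots> = (\<integral>\<^sup>+x. \<integral>\<^sup>+y. f (x 0, x n, y) \<partial>K n (x n) \<partial>alpha Ts K m)"
        using Suc.IH Suc.prems n by simp
      also have "\<dots> = (\<integral>\<^sup>+x. \<integral>\<^sup>+y. f (x 0, x n, y) \<partial>K n (x n) \<partial>alpha Ts K (Suc m))"
        using Suc.prems n
        by (intro alpha_restrict[symmetric] kernel_integral_measurable f) auto
      finally show ?thesis .
    qed
  qed
qed

text \<open>By the Markov property the law of two neighbours is rebuilt from the law of the first
  one and the kernel, so it suffices that the one-point laws fit; they propagate along the chain by
  the matching of the marginals.\<close>

lemma alpha_pair_law:
  assumes "m < N" "n \<le> m"
  shows "distr (alpha Ts K m) borel (\<lambda>x. (x n, x (Suc n))) = Ts n"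
proof -
  have A: "sets (alpha Ts K m) = sets (seqM (Suc m))" "prob_space (alpha Ts K m)"
    using alpha_sets_prob[of m] assms by auto
  note [measurable_cong] = A(1)
  have pm: "(\<lambda>x. (x i, x j)) \<in> measurable (alpha Ts K m) borel" if "i \<le> Suc m" "j \<le> Suc m" for i j
    using that unfolding borel_prod[symmetric]
    by (intro measurable_Pair) (auto simp: measurable_cong_sets[OF A(1) refl])
  \<comment> \<open>The one-point law at \<open>n\<close> decides the two-point law at
    \<open>n\<close>, whose second marginal is the one-point law at \<open>Suc n\<close>.\<close>
  have step: "distr (alpha Ts K m) borel (\<lambda>x. (x n, x (Suc n))) = Ts n"
    if n: "n \<le> m" and law: "distr (alpha Ts K m) borel (\<lambda>x. x n) = distr (Ts n) borel fst" for n
  proof (rule measure_eqI)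
    have nN: "n < N" using n assms by simp
    show "sets (distr (alpha Ts K m) borel (\<lambda>x. (x n, x (Suc n)))) = sets (Ts n)"
      using sets_Ts[OF nN] by simp
    fix C assume "C \<in> sets (distr (alpha Ts K m) borel (\<lambda>x. (x n, x (Suc n))))"
    then have C: "C \<in> sets borel" by simp
    then have [measurable]: "C \<in> sets (borel \<Otimes>\<^sub>M borel)" unfolding borel_prod .
    have "(\<lambda>(a::'a, b, c). indicator C (b, c) :: ennreal) \<in> borel_measurable (borel \<Otimes>\<^sub>M borel \<Otimes>\<^sub>M borel)"
      by measurable
    then have i: "(\<lambda>(a::'a, b, c). indicator C (b, c) :: ennreal) \<in> borel_measurable (borel :: ('a \<times> 'a \<times> 'a) measure)"
      unfolding borel_prod .
    have "emeasure (distr (alpha Ts K m) borel (\<lambda>x. (x n, x (Suc n)))) C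
      = (\<integral>\<^sup>+x. indicator C (x n, x (Suc n)) \<partial>alpha Ts K m)"
      using C n by (intro emeasure_distr_eq_nn_integral pm) auto
    also have "\<dots> = (\<integral>\<^sup>+x. \<integral>\<^sup>+y. indicator C (x n, y) \<partial>K n (x n) \<partial>alpha Ts K m)"
      using alpha_Markov[OF assms(1) n i] by simp
    also have "\<dots> = (\<integral>\<^sup>+x. \<integral>\<^sup>+y. indicator C (x, y) \<partial>K n x \<partial>distr (alpha Ts K m) borel (\<lambda>x. x n))"
    proof (rule nn_integral_distr[symmetric])
      show "(\<lambda>x. x n) \<in> measurable (alpha Ts K m) borel"
        using n by (auto simp: measurable_cong_sets[OF A(1) refl])
      note [measurable] = K_kernel[OF nN]
      have "(\<lambda>x. \<integral>\<^sup>+y. indicator C (x, y) \<partial>K n x) \<in> borel_measurable borel"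
        by (rule nn_integral_measurable_subprob_algebra2[where N = borel]) measurable
      then show "(\<lambda>x. \<integral>\<^sup>+y. indicator C (x, y) \<partial>K n x) \<in> borel_measurable (distr (alpha Ts K m) borel (\<lambda>x. x n))"
        by simp
    qed
    also have "\<dots> = (\<integral>\<^sup>+p. indicator C p \<partial>Ts n)"
      unfolding law using C by (subst disint_nn_integral[OF K[OF nN] _ sets_Ts[OF nN]]) auto
    also have "\<dots> = emeasure (Ts n) C" using C sets_Ts[OF nN] by simp
    finally show "emeasure (distr (alpha Ts K m) borel (\<lambda>x. (x n, x (Suc n)))) C = emeasure (Ts n) C" .
  qed
  have marg: "distr (alpha Ts K m) borel (\<lambda>x. x j) = distr (distr (alpha Ts K m) borel (\<lambda>x. (x i, x j))) borel snd"
    "distr (alpha Ts K m) borel (\<lambda>x. x i) = distr (distr (alpha Ts K m) borel (\<lambda>x. (x i, x j))) borel fst"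
    if "i \<le> Suc m" "j \<le> Suc m" for i j
    using pm[OF that] by (auto simp: distr_distr comp_def borel_prod[symmetric])
  \<comment> \<open>The propagation starts at coordinate 0, whose law is set by \<open>Ts 0\<close>
    and is not changed when the chain is extended.\<close>
  have law0: "distr (alpha Ts K m') borel (\<lambda>x. x 0) = distr (Ts 0) borel fst" if "m' < N" for m'
    using that
  proof (induction m')
    case 0
    have [measurable_cong]: "sets (Ts 0) = sets (borel \<Otimes>\<^sub>M borel)" unfolding borel_prod by (rule sets_Ts[OF 0])
    have m: "(\<lambda>p. \<lambda>i\<in>{0..1}. if i = 0 then fst p else snd p) \<in> measurable (Ts 0) (seqM 1)"
      by (rule measurable_restrict) auto
    show ?case unfolding alpha.simps by (subst distr_distr[OF _ m]) (auto simp: comp_def)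
  next
    case (Suc m')
    have s: "sets (alpha Ts K (Suc m')) = sets (seqM (Suc (Suc m')))" "sets (alpha Ts K m') = sets (seqM (Suc m'))"
      using alpha_sets_prob[of m'] alpha_sets_prob[of "Suc m'"] Suc.prems by auto
    note [measurable_cong] = s
    have c: "(\<lambda>x. x 0) \<in> measurable (alpha Ts K (Suc m')) borel" "(\<lambda>x. x 0) \<in> measurable (alpha Ts K m') borel"
      by measurable
    have "distr (alpha Ts K (Suc m')) borel (\<lambda>x. x 0) = distr (alpha Ts K m') borel (\<lambda>x. x 0)"
    proof (rule measure_eqI)
      fix C assume "C \<in> sets (distr (alpha Ts K (Suc m')) borel (\<lambda>x. x 0))"
      then have [measurable]: "C \<in> sets borel" by simp
      have "(\<integral>\<^sup>+x. indicator C (x 0) \<partial>alpha Ts K (Suc m')) = (\<integral>\<^sup>+x. indicator C (x 0) \<partial>alpha Ts K m')"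
        by (rule alpha_restrict) (use Suc.prems in auto)
      then show "emeasure (distr (alpha Ts K (Suc m')) borel (\<lambda>x. x 0)) C = emeasure (distr (alpha Ts K m') borel (\<lambda>x. x 0)) C"
        using c by (simp only: emeasure_distr_eq_nn_integral \<open>C \<in> sets borel\<close>)
    qed simp
    then show ?case using Suc by simp
  qed
  show ?thesis using assms(2)
  proof (induction n)
    case 0
    then show ?case by (intro step law0 assms)
  next
    case (Suc n)
    then have "Suc n < N" using assms by simp
    have "distr (alpha Ts K m) borel (\<lambda>x. x (Suc n)) = distr (Ts n) borel snd"
      using Suc marg(1)[of n "Suc n"] by simp
    also have "\<dots> = distr (Ts (Suc n)) borel fst" by (rule chain) fact
    finally show ?case by (intro step Suc.prems)
  qed
qed

end

section \<open>Passing between transition laws and velocity laws\<close>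

lemma distr_Tn_fst:
  assumes "sets \<Phi> = sets borel"
  shows "distr (Tn \<tau> \<Phi>) borel fst = distr \<Phi> borel (fst :: 'a::{real_inner,complete_space,second_countable_topology} \<times> 'a \<Rightarrow> 'a)"
proof -
  note [measurable_cong] = assms
  have "(\<lambda>p::'a \<times> 'a. (fst p, fst p + \<tau> *\<^sub>R snd p)) \<in> measurable borel borel"
    "fst \<in> measurable (borel :: ('a \<times> 'a) measure) borel"
    by (intro borel_measurable_continuous_onI continuous_intros)+
  then show ?thesis unfolding Tn_def by (subst distr_distr) (auto simp: comp_def)
qed

lemma distr_Tn_inverse:
  fixes \<Phi> :: "('a::{real_inner,complete_space,second_countable_topology} \<times> 'a) measure"
  assumes "0 < \<tau>" "sets \<Phi> = sets borel"
  shows "distr (Tn \<tau> \<Phi>) borel (\<lambda>p. (fst p, (1 / \<tau>) *\<^sub>R (snd p - fst p))) = \<Phi>"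
proof -
  note [measurable_cong] = assms(2)
  have "(\<lambda>p::'a \<times> 'a. (fst p, fst p + \<tau> *\<^sub>R snd p)) \<in> measurable borel borel"
    "(\<lambda>p::'a \<times> 'a. (fst p, (1 / \<tau>) *\<^sub>R (snd p - fst p))) \<in> measurable borel borel"
    by (intro borel_measurable_continuous_onI continuous_intros)+
  then show ?thesis
    unfolding Tn_def using assms by (subst distr_distr) (auto simp: comp_def distr_id2)
qed

text \<open>Over each \<open>x\<close> the position after one step determines the velocity, as
  \<tau> is positive. A kernel for the transition law therefore becomes one for \<Phi>, and only the
  barycenter of the latter enters \<open>barF\<close>.\<close>

lemma disint_Tn:
  fixes \<Phi> :: "('a::{real_inner,complete_space,second_countable_topology} \<times> 'a) measure"
  assumes "0 < \<tau>" and \<Phi>: "sets \<Phi> = sets borel"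
    and K: "disint (distr (Tn \<tau> \<Phi>) borel fst) (Tn \<tau> \<Phi>) K"
  shows "disint (distr \<Phi> borel fst) \<Phi> (\<lambda>x. distr (K x) borel (\<lambda>y. (1 / \<tau>) *\<^sub>R (y - x)))"
proof -
  note [measurable_cong] = \<Phi>
  have f [measurable]: "(\<lambda>p::'a \<times> 'a. (fst p, fst p + \<tau> *\<^sub>R snd p)) \<in> measurable borel borel"
    by (intro borel_measurable_continuous_onI continuous_intros)
  have g [measurable]: "(\<lambda>p::'a \<times> 'a. (fst p, (1 / \<tau>) *\<^sub>R (snd p - fst p))) \<in> measurable borel borel"
    by (intro borel_measurable_continuous_onI continuous_intros)
  have fst[measurable]: "fst \<in> measurable (borel :: ('a \<times> 'a) measure) borel"
    by (intro borel_measurable_continuous_onI continuous_intros)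
  have q [measurable]: "(\<lambda>y. (1 / \<tau>) *\<^sub>R (y - x)) \<in> measurable borel borel" for x :: 'a by simp
  note marg = distr_Tn_fst[OF \<Phi>] and inv = distr_Tn_inverse[OF \<open>0 < \<tau>\<close> \<Phi>, symmetric]
  have sK: "sets (K x) = sets borel" "prob_space (K x)" for x using K by (auto simp: disint_def)
  have qK: "(\<lambda>y. (1 / \<tau>) *\<^sub>R (y - x)) \<in> measurable (K x) borel" for x
    by (subst measurable_cong_sets[OF sK(1) refl]) (rule q)
  have Kk: "K \<in> measurable borel (subprob_algebra borel)"
    using disint_kernel[OF K] by simp
  have "(\<lambda>(x, y). (1 / \<tau>) *\<^sub>R (y - x)) \<in> measurable (borel \<Otimes>\<^sub>M borel) (borel :: 'a measure)"
    by measurable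
  then have K': "(\<lambda>x. distr (K x) borel (\<lambda>y. (1 / \<tau>) *\<^sub>R (y - x))) \<in> measurable borel (subprob_algebra borel)"
    by (rule measurable_distr2[OF _ Kk])
  show ?thesis
    unfolding disint_def
  proof (intro conjI allI ballI)
    show "prob_space (distr (K x) borel (\<lambda>y. (1 / \<tau>) *\<^sub>R (y - x)))" for x
      by (rule prob_space.prob_space_distr[OF sK(2) qK])
    show "sets (distr (K x) borel (\<lambda>y. (1 / \<tau>) *\<^sub>R (y - x))) = sets borel" for x by simp
    show "(\<lambda>x. emeasure (distr (K x) borel (\<lambda>y. (1 / \<tau>) *\<^sub>R (y - x))) B) \<in> borel_measurable (distr \<Phi> borel fst)"
      if "B \<in> sets borel" for B
      using measurable_compose[OF K' measurable_emeasure_subprob_algebra[OF that]] by simp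
    fix C :: "('a \<times> 'a) set" assume C: "C \<in> sets borel"
    define D where "D = (\<lambda>p::'a \<times> 'a. (fst p, (1 / \<tau>) *\<^sub>R (snd p - fst p))) -` C"
    have D: "D \<in> sets borel" using measurable_sets[OF g C] by (simp add: D_def)
    have "emeasure \<Phi> C = emeasure (Tn \<tau> \<Phi>) D"
      by (subst inv, subst emeasure_distr) (auto simp: Tn_def D_def C)
    also have "\<dots> = (\<integral>\<^sup>+x. emeasure (K x) (Pair x -` D) \<partial>distr \<Phi> borel fst)"
      using K D unfolding disint_def marg by blast
    also have "\<dots> = (\<integral>\<^sup>+x. emeasure (distr (K x) borel (\<lambda>y. (1 / \<tau>) *\<^sub>R (y - x))) (Pair x -` C) \<partial>distr \<Phi> borel fst)"
    proof (rule nn_integral_cong)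
      fix x
      have "Pair x -` C \<in> sets borel"
        using measurable_sets[OF measurable_Pair_const C, of x] by simp
      then show "emeasure (K x) (Pair x -` D) = emeasure (distr (K x) borel (\<lambda>y. (1 / \<tau>) *\<^sub>R (y - x))) (Pair x -` C)"
        by (subst emeasure_distr[OF qK]) (auto simp: D_def sets_eq_imp_space_eq[OF sK(1)] intro!: arg_cong2[where f = emeasure])
    qed
    finally show "emeasure \<Phi> C = (\<integral>\<^sup>+x. emeasure (distr (K x) borel (\<lambda>y. (1 / \<tau>) *\<^sub>R (y - x))) (Pair x -` C) \<partial>distr \<Phi> borel fst)" .
  qed
qed

section \<open>Nodes and affine interpolation\<close>

lemma stepN_props:
  assumes "0 < \<tau>" "0 < T"
  shows "0 < stepN \<tau> T" "n < stepN \<tau> T \<Longrightarrow> real n * \<tau> < T" "T \<le> real (stepN \<tau> T) * \<tau>"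
proof -
  have pos: "0 < T / \<tau>" using assms by simp
  then have r: "real (stepN \<tau> T) = of_int \<lceil>T / \<tau>\<rceil>" by (simp add: stepN_def)
  show "0 < stepN \<tau> T" using pos by (simp add: stepN_def)
  have "T / \<tau> \<le> real (stepN \<tau> T)" unfolding r by (rule le_of_int_ceiling)
  then show "T \<le> real (stepN \<tau> T) * \<tau>" using assms by (simp add: field_simps)
  assume "n < stepN \<tau> T"
  then have "int n < \<lceil>T / \<tau>\<rceil>" by (simp add: stepN_def zless_nat_eq_int_zless)
  then have "real n < T / \<tau>" by (simp add: less_ceiling_iff)
  then show "real n * \<tau> < T" using assms by (simp add: field_simps)
qed

text \<open>The last node belongs to a time that may lie beyond \<open>T\<close>, where the path is
  not defined. Its value is extrapolated from the last affine piece, known at the previous node and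
  at \<open>T\<close>.\<close>

definition node :: "real \<Rightarrow> real \<Rightarrow> nat \<Rightarrow> (real \<Rightarrow> 'a::real_vector) \<Rightarrow> 'a" where
  "node \<tau> T n \<gamma> = (if n < stepN \<tau> T then \<gamma> (real n * \<tau>)
    else let s = real (stepN \<tau> T - 1) * \<tau> in \<gamma> s + (\<tau> / (T - s)) *\<^sub>R (\<gamma> T - \<gamma> s))"

text \<open>\<open>ramp \<tau> (t - real n * \<tau>)\<close> is the time spent in the step from
  \<open>n * \<tau>\<close> to \<open>(n + 1) * \<tau>\<close> up to time \<open>t\<close>.\<close>

definition ramp :: "real \<Rightarrow> real \<Rightarrow> real" where
  "ramp \<tau> u = max 0 (min \<tau> u)"

context
  fixes \<tau> T :: real
  assumes \<tau>: "0 < \<tau>" and T: "0 < T"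
begin

lemma last_node: "real (stepN \<tau> T - 1) * \<tau> < T"
  using stepN_props(1)[OF \<tau> T] by (intro stepN_props(2)[OF \<tau> T]) simp

lemma Gmap_node:
  assumes "n < stepN \<tau> T"
  shows "Gmap \<tau> T x (real n * \<tau>) = x n"
proof -
  have "n \<le> stepN \<tau> T - 1" using assms by simp
  then show ?thesis
    using stepN_props(2)[OF \<tau> T assms] \<tau> by (simp add: Gmap_def Let_def min_absorb1)
qed

text \<open>If \<open>T\<close> is a multiple of \<tau>, the floor of \<open>T / \<tau>\<close> is
  one larger than the index of the last piece; the minimum in \<open>Gmap\<close> corrects
  this.\<close>

lemma Gmap_end:
  "Gmap \<tau> T x T = x (stepN \<tau> T - 1)
    + ((T - real (stepN \<tau> T - 1) * \<tau>) / \<tau>) *\<^sub>R (x (stepN \<tau> T) - x (stepN \<tau> T - 1))"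
proof -
  have "real (stepN \<tau> T - 1) \<le> T / \<tau>" using last_node \<tau> by (simp add: field_simps)
  then have "stepN \<tau> T - 1 \<le> nat \<lfloor>T / \<tau>\<rfloor>" by (rule le_nat_floor)
  then show ?thesis using T stepN_props(1)[OF \<tau> T] by (simp add: Gmap_def min_def Let_def)
qed

lemma node_Gmap: "n \<le> stepN \<tau> T \<Longrightarrow> node \<tau> T n (Gmap \<tau> T x) = x n"
proof (cases "n < stepN \<tau> T")
  case False
  assume "n \<le> stepN \<tau> T"
  with False have n: "n = stepN \<tau> T" by simp
  define s where "s = real (stepN \<tau> T - 1) * \<tau>"
  have s: "s < T" using last_node by (simp add: s_def)
  have "Gmap \<tau> T x s = x (stepN \<tau> T - 1)"
    unfolding s_def by (rule Gmap_node) (use stepN_props(1)[OF \<tau> T] in simp)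
  moreover have "Gmap \<tau> T x T = x (stepN \<tau> T - 1)
      + ((T - s) / \<tau>) *\<^sub>R (x (stepN \<tau> T) - x (stepN \<tau> T - 1))"
    unfolding s_def by (rule Gmap_end)
  moreover have "node \<tau> T n (Gmap \<tau> T x)
      = Gmap \<tau> T x s + (\<tau> / (T - s)) *\<^sub>R (Gmap \<tau> T x T - Gmap \<tau> T x s)"
    unfolding node_def n s_def by (simp only: Let_def less_irrefl if_False)
  ultimately show ?thesis using \<tau> s n by simp
qed (simp add: node_def Gmap_node)

text \<open>Steps before the current one are complete and telescope, later ones have not begun. The
  formula turns the interpolation into a combination of velocities with deterministic coefficients,
  to which norm estimates apply term by term.\<close>

lemma Gmap_ramp:
  assumes t: "t \<in> {0..T}"
  shows "Gmap \<tau> T x t = x 0 + (\<Sum>n<stepN \<tau> T. ramp \<tau> (t - real n * \<tau>) *\<^sub>R ((1 / \<tau>) *\<^sub>R (x (Suc n) - x n)))"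
proof -
  define N where "N = stepN \<tau> T"
  define k where "k = min (nat \<lfloor>t / \<tau>\<rfloor>) (N - 1)"
  have N: "0 < N" using stepN_props(1)[OF \<tau> T] by (simp add: N_def)
  then have kN: "k < N" by (auto simp: k_def)
  have "real (nat \<lfloor>t / \<tau>\<rfloor>) \<le> t / \<tau>" using t \<tau> by simp
  then have "real k \<le> t / \<tau>" by (simp add: k_def min_def)
  then have k1: "real k * \<tau> \<le> t" using \<tau> by (simp add: field_simps)
  have k2: "t \<le> (real k + 1) * \<tau>"
  proof (cases "nat \<lfloor>t / \<tau>\<rfloor> \<le> N - 1")
    case True
    have "t / \<tau> \<le> real (nat \<lfloor>t / \<tau>\<rfloor>) + 1" using t \<tau> by simp
    then show ?thesis using True \<tau> by (simp add: k_def min_def field_simps)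
  next
    case False
    then have "real k + 1 = real N" using N by (simp add: k_def min_def of_nat_diff)
    then show ?thesis using stepN_props(3)[OF \<tau> T] t by (simp add: N_def)
  qed
  define v where "v n = (1 / \<tau>) *\<^sub>R (x (Suc n) - x n)" for n
  have lo: "ramp \<tau> (t - real n * \<tau>) = \<tau>" if "n < k" for n
  proof -
    have "(real n + 1) * \<tau> \<le> real k * \<tau>" using that \<tau> by (intro mult_right_mono) auto
    then show ?thesis using k1 \<tau> by (simp add: ramp_def distrib_right)
  qed
  have hi: "ramp \<tau> (t - real n * \<tau>) = 0" if "k < n" for n
  proof -
    have "(real k + 1) * \<tau> \<le> real n * \<tau>" using that \<tau> by (intro mult_right_mono) auto
    then have "t - real n * \<tau> \<le> 0" using k2 by linarith
    then show ?thesis by (simp add: ramp_def)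
  qed
  have mid: "ramp \<tau> (t - real k * \<tau>) = t - real k * \<tau>"
    using k1 k2 \<tau> by (simp add: ramp_def distrib_right)
  have "(\<Sum>n<N. ramp \<tau> (t - real n * \<tau>) *\<^sub>R v n) = (\<Sum>n<Suc k. ramp \<tau> (t - real n * \<tau>) *\<^sub>R v n)"
    using kN hi by (intro sum.mono_neutral_right) auto
  also have "\<dots> = (\<Sum>n<k. \<tau> *\<^sub>R v n) + (t - real k * \<tau>) *\<^sub>R v k"
    using lo mid by simp
  also have "(\<Sum>n<k. \<tau> *\<^sub>R v n) = x k - x 0"
    using \<tau> by (simp add: v_def sum_lessThan_telescope)
  finally have sum: "(\<Sum>n<N. ramp \<tau> (t - real n * \<tau>) *\<^sub>R v n) = x k - x 0 + (t - real k * \<tau>) *\<^sub>R v k" .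
  have "Gmap \<tau> T x t = x k + ((t - real k * \<tau>) / \<tau>) *\<^sub>R (x (Suc k) - x k)"
    using t by (simp add: Gmap_def Let_def k_def N_def)
  also have "\<dots> = x 0 + (\<Sum>n<N. ramp \<tau> (t - real n * \<tau>) *\<^sub>R v n)"
    unfolding sum by (simp add: v_def)
  finally show ?thesis unfolding v_def N_def .
qed

text \<open>The interpolation of the sequence \<open>real n * \<tau>\<close> is the identity, and
  the ramp formula for it is the claimed sum.\<close>

lemma ramp_sum: "t \<in> {0..T} \<Longrightarrow> (\<Sum>n<stepN \<tau> T. ramp \<tau> (t - real n * \<tau>)) = t"
proof -
  assume t: "t \<in> {0..T}"
  have "Gmap \<tau> T (\<lambda>n. real n * \<tau>) t = t"
    using t \<tau> by (simp add: Gmap_def Let_def field_simps)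
  moreover have "Gmap \<tau> T (\<lambda>n. real n * \<tau>) t = (\<Sum>n<stepN \<tau> T. ramp \<tau> (t - real n * \<tau>))"
    unfolding Gmap_ramp[OF t] using \<tau> by (simp add: field_simps)
  ultimately show ?thesis by simp
qed

lemma ramp_mono: "s \<le> t \<Longrightarrow> ramp \<tau> s \<le> ramp \<tau> t"
  by (auto simp: ramp_def)

lemma Gmap_measurable:
  "Gmap \<tau> T \<in> measurable (seqM (stepN \<tau> T)) (pathM T :: (real \<Rightarrow> 'a::{real_normed_vector,second_countable_topology}) measure)"
  unfolding Gmap_def
proof (rule measurable_restrict)
  fix t
  define n where "n = min (nat \<lfloor>t / \<tau>\<rfloor>) (stepN \<tau> T - 1)"
  have n: "n \<in> {0..stepN \<tau> T}" "Suc n \<in> {0..stepN \<tau> T}" using stepN_props(1)[OF \<tau> T] by (auto simp: n_def)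
  then have [measurable]: "(\<lambda>x. x n) \<in> measurable (seqM (stepN \<tau> T)) (borel :: 'a measure)"
    "(\<lambda>x. x (Suc n)) \<in> measurable (seqM (stepN \<tau> T)) (borel :: 'a measure)"
    by (auto intro: measurable_component_singleton)
  show "(\<lambda>x. let n = min (nat \<lfloor>t / \<tau>\<rfloor>) (stepN \<tau> T - 1) in
      x n + ((t - real n * \<tau>) / \<tau>) *\<^sub>R (x (Suc n) - x n)) \<in> measurable (seqM (stepN \<tau> T)) (borel :: 'a measure)"
    unfolding n_def[symmetric] Let_def by measurable
qed

lemma node_measurable:
  "node \<tau> T n \<in> measurable (pathM T) (borel :: 'a::{real_normed_vector,second_countable_topology} measure)"
proof -
  have [measurable]: "(\<lambda>\<gamma>. \<gamma> s) \<in> measurable (pathM T) (borel :: 'a measure)" if "s \<in> {0..T}" for s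
    using that by (rule measurable_component_singleton)
  show ?thesis
  proof (cases "n < stepN \<tau> T")
    case True
    then have "real n * \<tau> \<in> {0..T}" using stepN_props(2)[OF \<tau> T True] \<tau> by simp
    moreover have "node \<tau> T n = (\<lambda>\<gamma>. \<gamma> (real n * \<tau>) :: 'a)"
      using True by (simp add: node_def fun_eq_iff)
    ultimately show ?thesis by simp
  next
    case False
    define s where "s = real (stepN \<tau> T - 1) * \<tau>"
    have sT: "s \<in> {0..T}" "T \<in> {0..T}" using last_node T \<tau> by (auto simp: s_def)
    have [measurable]: "(\<lambda>\<gamma>. \<gamma> s) \<in> measurable (pathM T) (borel :: 'a measure)"
      "(\<lambda>\<gamma>. \<gamma> T) \<in> measurable (pathM T) (borel :: 'a measure)"
      by (rule measurable_component_singleton, fact)+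
    have "node \<tau> T n = (\<lambda>\<gamma>. \<gamma> s + (\<tau> / (T - s)) *\<^sub>R (\<gamma> T - \<gamma> s) :: 'a)"
      using False unfolding s_def by (simp add: node_def fun_eq_iff Let_def)
    then show ?thesis by simp
  qed
qed

end

section \<open>Euler processes on a probability space\<close>

text \<open>The kernel identity is available for nonnegative functions only, so it is applied to the
  positive and the negative part of \<open>g\<close>; centring makes their inner integrals
  equal.\<close>

lemma kernel_centered_integral:
  assumes kernel: "\<And>f. f \<in> borel_measurable borel \<Longrightarrow>
      (\<integral>\<^sup>+\<omega>. f (U \<omega>, V \<omega>) \<partial>P) = (\<integral>\<^sup>+\<omega>. \<integral>\<^sup>+v. f (U \<omega>, v) \<partial>\<kappa> \<omega> \<partial>P)"
    and g[measurable]: "g \<in> borel_measurable borel" and int: "integrable P (\<lambda>\<omega>. g (U \<omega>, V \<omega>) :: real)"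
    and center: "AE \<omega> in P. has_bochner_integral (\<kappa> \<omega>) (\<lambda>v. g (U \<omega>, v)) 0"
  shows "(\<integral>\<omega>. g (U \<omega>, V \<omega>) \<partial>P) = 0"
proof -
  have "(\<integral>\<^sup>+\<omega>. \<integral>\<^sup>+v. ennreal (g (U \<omega>, v)) \<partial>\<kappa> \<omega> \<partial>P) = (\<integral>\<^sup>+\<omega>. \<integral>\<^sup>+v. ennreal (- g (U \<omega>, v)) \<partial>\<kappa> \<omega> \<partial>P)"
    using center
  proof (intro nn_integral_cong_AE, eventually_elim)
    case (elim \<omega>)
    then have i: "integrable (\<kappa> \<omega>) (\<lambda>v. g (U \<omega>, v))" and z: "(\<integral>v. g (U \<omega>, v) \<partial>\<kappa> \<omega>) = 0"
      by (auto simp: has_bochner_integral_iff)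
    have "(\<integral>\<^sup>+v. ennreal (g (U \<omega>, v)) \<partial>\<kappa> \<omega>) \<noteq> \<infinity>" "(\<integral>\<^sup>+v. ennreal (- g (U \<omega>, v)) \<partial>\<kappa> \<omega>) \<noteq> \<infinity>"
      using i by (auto simp: real_integrable_def)
    then show ?case
      using z unfolding real_lebesgue_integral_def[OF i]
      by (metis ennreal_enn2real_if infinity_ennreal_def right_minus_eq)
  qed
  then have "(\<integral>\<^sup>+\<omega>. ennreal (g (U \<omega>, V \<omega>)) \<partial>P) = (\<integral>\<^sup>+\<omega>. ennreal (- g (U \<omega>, V \<omega>)) \<partial>P)"
    using kernel[of "\<lambda>p. ennreal (g p)"] kernel[of "\<lambda>p. ennreal (- g p)"] by simp
  then show ?thesis by (simp add: real_lebesgue_integral_def[OF int])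
qed

lemma P2_L2:
  fixes \<Phi> :: "('a::{real_inner,complete_space,second_countable_topology} \<times> 'a) measure"
  assumes "\<Phi> \<in> P2"
  shows "fst \<in> L2 \<Phi>" "snd \<in> L2 \<Phi>"
proof -
  have [measurable_cong]: "sets \<Phi> = sets borel" using assms by (simp add: P2_def)
  have [measurable]: "fst \<in> measurable (borel :: ('a \<times> 'a) measure) borel"
    "snd \<in> measurable (borel :: ('a \<times> 'a) measure) borel"
    by (intro borel_measurable_continuous_onI continuous_intros)+
  have [measurable]: "(\<lambda>p::'a \<times> 'a. norm p) \<in> borel_measurable \<Phi>" by measurable
  have i: "integrable \<Phi> (\<lambda>p. (norm p)\<^sup>2)"
    using assms by (intro integrableI_bounded) (auto simp: P2_def)
  have "integrable \<Phi> (\<lambda>p. (norm (fst p))\<^sup>2)" "integrable \<Phi> (\<lambda>p. (norm (snd p))\<^sup>2)"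
    by (rule Bochner_Integration.integrable_bound[OF i];
        auto intro!: AE_I2 power_mono norm_fst_le norm_snd_le)+
  then show "fst \<in> L2 \<Phi>" "snd \<in> L2 \<Phi>" by (auto simp: L2_def)
qed

text \<open>A discrete process with velocities \<open>V\<^sub>n\<close> whose drift given its past is \<open>b\<^sub>n\<close>; of the past,
  only the initial and the current position are tested.\<close>

locale Euler_lift =
  fixes P :: "'b measure" and H :: "('a::{real_inner,complete_space,second_countable_topology} \<times> 'a) measure set"
    and \<tau> T L :: real and Y :: "nat \<Rightarrow> 'b \<Rightarrow> 'a" and b :: "nat \<Rightarrow> 'a \<Rightarrow> 'a"
  fixes N :: nat and V :: "nat \<Rightarrow> 'b \<Rightarrow> 'a"
  defines "N \<equiv> stepN \<tau> T" and "V \<equiv> \<lambda>n \<omega>. (1 / \<tau>) *\<^sub>R (Y (Suc n) \<omega> - Y n \<omega>)"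
  assumes \<tau>: "0 < \<tau>" and T: "0 < T"
    and Ym: "\<And>n. Y n \<in> borel_measurable P"
    and YL2: "\<And>n. n < N \<Longrightarrow> Y n \<in> L2 P"
    and VL2: "\<And>n. n < N \<Longrightarrow> V n \<in> L2 P"
    and VL: "\<And>n. n < N \<Longrightarrow> L2norm P (V n) \<le> L"
    and bm: "\<And>n. n < N \<Longrightarrow> b n \<in> borel_measurable borel"
    and bar: "\<And>n. n < N \<Longrightarrow> distr P borel (\<lambda>\<omega>. (Y n \<omega>, b n (Y n \<omega>))) \<in> H"
    and orth: "\<And>n g. n < N \<Longrightarrow> g \<in> borel_measurable borel \<Longrightarrow> (\<lambda>\<omega>. g (Y 0 \<omega>, Y n \<omega>)) \<in> L2 P \<Longrightarrow>
      (\<lambda>\<omega>. b n (Y n \<omega>)) \<in> L2 P \<Longrightarrow>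
      (\<integral>\<omega>. inner (V n \<omega> - b n (Y n \<omega>)) (g (Y 0 \<omega>, Y n \<omega>)) \<partial>P) = 0"

text \<open>Only the law of \<open>Z\<close> is prescribed. Since \<open>node\<close> inverts
  \<open>Gmap\<close>, the nodes read off from \<open>Z\<close> have the law of the chain, and all
  properties of the chain are transported to them.\<close>

lemma Euler_lift_exists:
  fixes F :: "('a::{real_inner,complete_space,second_countable_topology} \<times> 'a) measure set"
    and Z :: "'b \<Rightarrow> real \<Rightarrow> 'a"
  assumes \<tau>: "0 < \<tau>" and T: "0 < T" and F: "is_MPVF F" "barF F \<subseteq> H"
    and stable: "Lstable F \<mu> \<tau> T L M \<Phi>"
    and K: "\<And>n. n < stepN \<tau> T \<Longrightarrow> disint (distr (Tn \<tau> (\<Phi> n)) borel fst) (Tn \<tau> (\<Phi> n)) (K n)"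
    and Z[measurable]: "Z \<in> measurable P (pathM T)" and law: "distr P (pathM T) Z = eta \<tau> T \<Phi> K"
  obtains Y b where "Euler_lift P H \<tau> T L Y b"
    and "\<And>t. t \<in> {0..T} \<Longrightarrow> AE \<omega> in P. Z \<omega> t = Gmap \<tau> T (\<lambda>n. Y n \<omega>) t"
    and "\<And>\<omega>. Y 0 \<omega> = Z \<omega> 0"
proof -
  define N where "N = stepN \<tau> T"
  define A where "A = alpha (\<lambda>n. Tn \<tau> (\<Phi> n)) K (N - 1)"
  define Y where "Y n \<omega> = node \<tau> T n (Z \<omega>)" for n \<omega>
  define V where "V n \<omega> = (1 / \<tau>) *\<^sub>R (Y (Suc n) \<omega> - Y n \<omega>)" for n \<omega>
  \<comment> \<open>The barycenter must come from the very kernel that drives the chain: then the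
    same function \<open>b n\<close> occurs in an element of \<open>barF F\<close> and as the
    conditional mean of the velocity.\<close>
  define K' where "K' n x = distr (K n x) borel (\<lambda>y. (1 / \<tau>) *\<^sub>R (y - x))" for n x
  define b where "b n x = (\<integral>v. v \<partial>K' n x)" for n x
  have N: "0 < N" using stepN_props(1)[OF \<tau> T] by (simp add: N_def)
  have \<Phi>F: "\<Phi> n \<in> F" "distr (\<Phi> n) borel fst = M n" if "n \<le> N" for n
    using stable that by (auto simp: Lstable_def fiber_def N_def)
  have \<Phi>P2: "\<Phi> n \<in> P2" if "n \<le> N" for n using \<Phi>F(1)[OF that] F(1) by (auto simp: is_MPVF_def)
  have \<Phi>: "sets (\<Phi> n) = sets borel" "prob_space (\<Phi> n)" if "n \<le> N" for n
    using \<Phi>P2[OF that] by (auto simp: P2_def)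
  have exp_meas: "(\<lambda>p::'a \<times> 'a. (fst p, fst p + \<tau> *\<^sub>R snd p)) \<in> measurable borel borel"
    by (intro borel_measurable_continuous_onI continuous_intros)
  have inv_meas: "(\<lambda>p::'a \<times> 'a. (fst p, (1 / \<tau>) *\<^sub>R (snd p - fst p))) \<in> measurable borel borel"
    by (intro borel_measurable_continuous_onI continuous_intros)
  have fst_meas: "fst \<in> measurable (borel :: ('a \<times> 'a) measure) borel"
    and snd_meas: "snd \<in> measurable (borel :: ('a \<times> 'a) measure) borel"
    by (intro borel_measurable_continuous_onI continuous_intros)+
  have sets_T: "sets (Tn \<tau> (\<Phi> n)) = sets borel" for n by (simp add: Tn_def)
  have prob_T: "prob_space (Tn \<tau> (\<Phi> n))" if "n < N" for n
    unfolding Tn_def using that exp_meas \<Phi>[of n]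
    by (intro prob_space.prob_space_distr) (auto simp: measurable_cong_sets[OF \<Phi>(1) refl])
  have chain: "distr (Tn \<tau> (\<Phi> n)) borel snd = distr (Tn \<tau> (\<Phi> (Suc n))) borel fst" if "Suc n < N" for n
  proof -
    have n: "n \<le> N" "Suc n \<le> N" using that by auto
    have "distr (Tn \<tau> (\<Phi> n)) borel snd = distr (\<Phi> n) borel (\<lambda>p. fst p + \<tau> *\<^sub>R snd p)"
      unfolding Tn_def using exp_meas snd_meas
      by (subst distr_distr) (auto simp: comp_def measurable_cong_sets[OF \<Phi>(1)[OF n(1)] refl])
    also have "\<dots> = M (Suc n)"
      using stable n unfolding Lstable_def N_def[symmetric] by simp
    also have "\<dots> = distr (Tn \<tau> (\<Phi> (Suc n))) borel fst"
      using \<Phi>F(2)[OF n(2)] distr_Tn_fst[OF \<Phi>(1)[OF n(2)]] by simp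
    finally show ?thesis .
  qed
  note al = sets_T prob_T K[folded N_def] chain
  \<comment> \<open>\<open>alpha\<close> at index \<open>N - 1\<close> has the coordinates from 0 to
    \<open>N\<close>, one for each node.\<close>
  have NN: "N - 1 < N" "Suc (N - 1) = N" using N by auto
  have A: "sets A = sets (seqM N)"
    using alpha_sets_prob[where Ts = "\<lambda>n. Tn \<tau> (\<Phi> n)" and N = N and K = K, OF al NN(1)] NN(2) by (simp add: A_def)
  have Gm: "Gmap \<tau> T \<in> measurable A (pathM T)"
    using Gmap_measurable[OF \<tau> T] unfolding measurable_cong_sets[OF A refl] N_def .
  \<comment> \<open>Every statement on the nodes passes through this change of variables followed by
    \<open>nodeG\<close>.\<close>
  have tr: "(\<integral>\<^sup>+\<omega>. f (Z \<omega>) \<partial>P) = (\<integral>\<^sup>+x. f (Gmap \<tau> T x) \<partial>A)"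
    if [measurable]: "f \<in> borel_measurable (pathM T)" for f
  proof -
    have "(\<integral>\<^sup>+\<omega>. f (Z \<omega>) \<partial>P) = (\<integral>\<^sup>+\<gamma>. f \<gamma> \<partial>distr P (pathM T) Z)"
      by (rule nn_integral_distr[symmetric]) auto
    also have "\<dots> = (\<integral>\<^sup>+\<gamma>. f \<gamma> \<partial>distr A (pathM T) (Gmap \<tau> T))"
      unfolding law eta_def A_def N_def ..
    also have "\<dots> = (\<integral>\<^sup>+x. f (Gmap \<tau> T x) \<partial>A)"
      by (rule nn_integral_distr[OF Gm]) auto
    finally show ?thesis .
  qed
  have nodeG: "node \<tau> T n (Gmap \<tau> T x) = x n" if "n \<le> N" for n and x :: "nat \<Rightarrow> 'a"
    using node_Gmap[OF \<tau> T] that by (simp add: N_def)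
  note [measurable] = node_measurable[OF \<tau> T]
  have Ym [measurable]: "Y n \<in> borel_measurable P" for n
    unfolding Y_def by measurable
  have Vm [measurable]: "V n \<in> borel_measurable P" for n
    unfolding V_def by measurable
  have Kk: "K n \<in> measurable borel (subprob_algebra borel)" if "n < N" for n
    using disint_kernel[OF K[folded N_def, OF that]] by simp
  have joint: "(\<integral>\<^sup>+\<omega>. f (Y 0 \<omega>, Y n \<omega>, Y (Suc n) \<omega>) \<partial>P)
      = (\<integral>\<^sup>+\<omega>. \<integral>\<^sup>+y. f (Y 0 \<omega>, Y n \<omega>, y) \<partial>K n (Y n \<omega>) \<partial>P)"
    if n: "n < N" and f[measurable]: "f \<in> borel_measurable (borel :: ('a \<times> 'a \<times> 'a) measure)" for n f
  proof -
    have f3 [measurable]: "f \<in> borel_measurable (borel \<Otimes>\<^sub>M borel \<Otimes>\<^sub>M borel)"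
      using f by (simp add: borel_prod)
    note [measurable] = Kk[OF n]
    have "(\<integral>\<^sup>+\<omega>. f (Y 0 \<omega>, Y n \<omega>, Y (Suc n) \<omega>) \<partial>P) = (\<integral>\<^sup>+x. f (x 0, x n, x (Suc n)) \<partial>A)"
      unfolding Y_def using n by (subst tr) (auto simp: nodeG)
    also have "\<dots> = (\<integral>\<^sup>+x. \<integral>\<^sup>+y. f (x 0, x n, y) \<partial>K n (x n) \<partial>A)"
      unfolding A_def using n f
      by (intro alpha_Markov[where Ts = "\<lambda>n. Tn \<tau> (\<Phi> n)" and N = N and K = K, OF al NN(1)]) auto
    also have "\<dots> = (\<integral>\<^sup>+\<omega>. \<integral>\<^sup>+y. f (Y 0 \<omega>, Y n \<omega>, y) \<partial>K n (Y n \<omega>) \<partial>P)"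
    proof -
      have "(\<lambda>\<gamma>. \<integral>\<^sup>+y. f (node \<tau> T 0 \<gamma>, node \<tau> T n \<gamma>, y) \<partial>K n (node \<tau> T n \<gamma>)) \<in> borel_measurable (pathM T)"
        by (rule nn_integral_measurable_subprob_algebra2[where N = borel]) measurable
      then show ?thesis unfolding Y_def using n by (subst tr) (auto simp: nodeG)
    qed
    finally show ?thesis .
  qed
  have pair: "distr P borel (\<lambda>\<omega>. (Y n \<omega>, Y (Suc n) \<omega>)) = Tn \<tau> (\<Phi> n)" if n: "n < N" for n
  proof -
    have pm: "(\<lambda>x. (x n, x (Suc n))) \<in> measurable A borel"
      unfolding measurable_cong_sets[OF A refl] using n
      by (intro borel_measurable_Pair measurable_component_singleton) auto
    have "distr P borel (\<lambda>\<omega>. (Y n \<omega>, Y (Suc n) \<omega>)) = distr A borel (\<lambda>x. (x n, x (Suc n)))"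
    proof (rule measure_eqI)
      fix C :: "('a \<times> 'a) set" assume "C \<in> sets (distr P borel (\<lambda>\<omega>. (Y n \<omega>, Y (Suc n) \<omega>)))"
      then have C[measurable]: "C \<in> sets borel" by simp
      have "(\<integral>\<^sup>+\<omega>. indicator C (Y n \<omega>, Y (Suc n) \<omega>) \<partial>P) = (\<integral>\<^sup>+x. indicator C (x n, x (Suc n)) \<partial>A)"
        unfolding Y_def using n by (subst tr) (auto simp: nodeG)
      then show "emeasure (distr P borel (\<lambda>\<omega>. (Y n \<omega>, Y (Suc n) \<omega>))) C = emeasure (distr A borel (\<lambda>x. (x n, x (Suc n)))) C"
        by (subst (1 2) emeasure_distr_eq_nn_integral) (auto simp: pm)
    qed simp
    also have "\<dots> = Tn \<tau> (\<Phi> n)"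
      unfolding A_def using n
      by (intro alpha_pair_law[where Ts = "\<lambda>n. Tn \<tau> (\<Phi> n)" and N = N and K = K, OF al NN(1)]) auto
    finally show ?thesis .
  qed
  have YV: "distr P borel (\<lambda>\<omega>. (Y n \<omega>, V n \<omega>)) = \<Phi> n" if n: "n < N" for n
  proof -
    have "distr P borel (\<lambda>\<omega>. (Y n \<omega>, V n \<omega>))
      = distr (distr P borel (\<lambda>\<omega>. (Y n \<omega>, Y (Suc n) \<omega>))) borel (\<lambda>p. (fst p, (1 / \<tau>) *\<^sub>R (snd p - fst p)))"
      using inv_meas by (subst distr_distr) (auto simp: comp_def V_def)
    also have "\<dots> = \<Phi> n"
      unfolding pair[OF n] using n by (intro distr_Tn_inverse[OF \<tau>] \<Phi>) simp
    finally show ?thesis .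
  qed
  have YVm: "(\<lambda>\<omega>. (Y n \<omega>, V n \<omega>)) \<in> measurable P borel" for n by measurable
  have YL2: "Y n \<in> L2 P" and VL2: "V n \<in> L2 P" and VL: "L2norm P (V n) \<le> L" if n: "n < N" for n
  proof -
    have P2: "\<Phi> n \<in> P2" using n by (intro \<Phi>P2) simp
    show "Y n \<in> L2 P"
      using P2_L2(1)[OF P2] L2_distr_iff[OF YVm fst_meas, of n] unfolding YV[OF n] by simp
    show "V n \<in> L2 P"
      using P2_L2(2)[OF P2] L2_distr_iff[OF YVm snd_meas, of n] unfolding YV[OF n] by simp
    have "L2norm P (V n) = norm2 (\<Phi> n)"
      using L2norm_distr[OF YVm snd_meas, of n] unfolding YV[OF n] by (simp add: norm2_def L2norm_def)
    then show "L2norm P (V n) \<le> L" using stable n by (simp add: Lstable_def N_def)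
  qed
  have dis: "disint (distr (\<Phi> n) borel fst) (\<Phi> n) (K' n)" if n: "n < N" for n
    unfolding K'_def using n by (intro disint_Tn[OF \<tau>] \<Phi> K) (auto simp: N_def)
  have K'k: "K' n \<in> measurable borel (subprob_algebra borel)" if n: "n < N" for n
    using disint_kernel[OF dis[OF n]] by simp
  have bm: "b n \<in> borel_measurable borel" if n: "n < N" for n
    unfolding b_def by (rule barycenter_measurable[OF K'k[OF n]])
  have bar: "distr P borel (\<lambda>\<omega>. (Y n \<omega>, b n (Y n \<omega>))) \<in> H" if n: "n < N" for n
  proof -
    have "distr P borel (Y n) = distr (distr P borel (\<lambda>\<omega>. (Y n \<omega>, V n \<omega>))) borel fst"
      using fst_meas by (subst distr_distr) (auto simp: comp_def)
    then have Yn: "distr P borel (Y n) = distr (\<Phi> n) borel fst" by (simp add: YV[OF n])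
    have "distr P borel (\<lambda>\<omega>. (Y n \<omega>, b n (Y n \<omega>))) = distr (distr P borel (Y n)) borel (\<lambda>x. (x, b n x))"
      using bm[OF n] by (subst distr_distr) (auto simp: comp_def)
    also have "\<dots> = distr (distr (\<Phi> n) borel fst) borel (\<lambda>x. (x, \<integral>v. v \<partial>K' n x))"
      unfolding Yn b_def ..
    finally have "distr P borel (\<lambda>\<omega>. (Y n \<omega>, b n (Y n \<omega>))) \<in> barF F"
      unfolding barF_def using \<Phi>F(1)[of n] n dis[OF n] by auto
    then show ?thesis using F(2) by blast
  qed
  have kernel: "(\<integral>\<^sup>+\<omega>. f ((Y 0 \<omega>, Y n \<omega>), V n \<omega>) \<partial>P)
      = (\<integral>\<^sup>+\<omega>. \<integral>\<^sup>+v. f ((Y 0 \<omega>, Y n \<omega>), v) \<partial>K' n (Y n \<omega>) \<partial>P)"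
    if n: "n < N" and f: "f \<in> borel_measurable (borel :: (('a \<times> 'a) \<times> 'a) measure)" for n f
  proof -
    have r: "(\<lambda>p::'a \<times> 'a \<times> 'a. ((fst p, fst (snd p)), (1 / \<tau>) *\<^sub>R (snd (snd p) - fst (snd p)))) \<in> measurable borel borel"
      by (intro borel_measurable_continuous_onI continuous_intros)
    have "(\<integral>\<^sup>+\<omega>. f ((Y 0 \<omega>, Y n \<omega>), V n \<omega>) \<partial>P)
      = (\<integral>\<^sup>+\<omega>. \<integral>\<^sup>+y. f ((Y 0 \<omega>, Y n \<omega>), (1 / \<tau>) *\<^sub>R (y - Y n \<omega>)) \<partial>K n (Y n \<omega>) \<partial>P)"
      using joint[OF n measurable_compose[OF r f]] by (simp add: V_def)
    also have "\<dots> = (\<integral>\<^sup>+\<omega>. \<integral>\<^sup>+v. f ((Y 0 \<omega>, Y n \<omega>), v) \<partial>K' n (Y n \<omega>) \<partial>P)"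
    proof (rule nn_integral_cong)
      fix \<omega>
      have "sets (K n (Y n \<omega>)) = sets borel" using K[folded N_def, OF n] by (simp add: disint_def)
      then have "(\<lambda>y. (1 / \<tau>) *\<^sub>R (y - Y n \<omega>)) \<in> measurable (K n (Y n \<omega>)) borel"
        by (subst measurable_cong_sets[OF _ refl]) auto
      then show "(\<integral>\<^sup>+y. f ((Y 0 \<omega>, Y n \<omega>), (1 / \<tau>) *\<^sub>R (y - Y n \<omega>)) \<partial>K n (Y n \<omega>))
        = (\<integral>\<^sup>+v. f ((Y 0 \<omega>, Y n \<omega>), v) \<partial>K' n (Y n \<omega>))"
        unfolding K'_def using measurable_compose[OF measurable_Pair_const f]
        by (subst nn_integral_distr) auto
    qed
    finally show ?thesis .
  qed
  have orth: "(\<integral>\<omega>. inner (V n \<omega> - b n (Y n \<omega>)) (G (Y 0 \<omega>, Y n \<omega>)) \<partial>P) = 0"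
    if n: "n < N" and G: "G \<in> borel_measurable borel" and GL: "(\<lambda>\<omega>. G (Y 0 \<omega>, Y n \<omega>)) \<in> L2 P"
      and bL: "(\<lambda>\<omega>. b n (Y n \<omega>)) \<in> L2 P" for n G
  proof -
    define g where "g p = inner (snd p - b n (snd (fst p))) (G (fst p))" for p :: "('a \<times> 'a) \<times> 'a"
    have m1: "(\<lambda>p::('a \<times> 'a) \<times> 'a. snd (fst p)) \<in> measurable borel borel"
      and m2: "(\<lambda>p::('a \<times> 'a) \<times> 'a. fst p) \<in> measurable borel borel"
      and m3: "(\<lambda>p::('a \<times> 'a) \<times> 'a. snd p) \<in> measurable borel borel"
      by (intro borel_measurable_continuous_onI continuous_intros)+
    have gm: "g \<in> borel_measurable borel"
      unfolding g_def
      by (intro borel_measurable_inner borel_measurable_diff m3 measurable_compose[OF m1 bm[OF n]]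
          measurable_compose[OF m2 G])
    have "(\<integral>\<omega>. g ((Y 0 \<omega>, Y n \<omega>), V n \<omega>) \<partial>P) = 0"
    proof (rule kernel_centered_integral[OF kernel[OF n] gm])
      show "integrable P (\<lambda>\<omega>. g ((Y 0 \<omega>, Y n \<omega>), V n \<omega>))"
        unfolding g_def using L2_integrable_inner[OF L2_diff[OF VL2[OF n] bL] GL] by simp
      \<comment> \<open>Almost surely the kernel has a finite first moment, so that
        \<open>b n (Y n \<omega>)\<close> is a genuine barycenter and not a default value.\<close>
      have "(\<integral>\<^sup>+\<omega>. \<integral>\<^sup>+v. norm v \<partial>K' n (Y n \<omega>) \<partial>P) = (\<integral>\<^sup>+\<omega>. norm (V n \<omega>) \<partial>P)"
        using kernel[OF n, of "\<lambda>p. ennreal (norm (snd p))"] measurable_compose[OF m3 borel_measurable_norm]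
        by simp
      also have "\<dots> = (\<integral>\<^sup>+p. norm (snd p) \<partial>\<Phi> n)"
        unfolding YV[OF n, symmetric] using snd_meas by (subst nn_integral_distr[OF YVm]) auto
      also have "\<dots> \<le> (\<integral>\<^sup>+p. ennreal (1 + (norm (snd p))\<^sup>2) \<partial>\<Phi> n)"
      proof (intro nn_integral_mono ennreal_leI)
        show "norm (snd p) \<le> 1 + (norm (snd p))\<^sup>2" for p :: "'a \<times> 'a"
          using sum_squares_bound[of "norm (snd p)" 1] norm_ge_zero[of "snd p"] by (simp del: norm_ge_zero)
      qed
      also have "\<dots> < \<infinity>"
      proof -
        interpret prob_space "\<Phi> n" using n by (intro \<Phi>) simp
        have "integrable (\<Phi> n) (\<lambda>p. 1 + (norm (snd p))\<^sup>2)"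
          using P2_L2(2)[OF \<Phi>P2[of n]] n by (intro Bochner_Integration.integrable_add L2_integrable_power2) auto
        then show ?thesis by (subst nn_integral_eq_integral) auto
      qed
      finally have "AE \<omega> in P. (\<integral>\<^sup>+v. norm v \<partial>K' n (Y n \<omega>)) \<noteq> \<infinity>"
      proof (intro nn_integral_PInf_AE)
        note [measurable] = K'k[OF n]
        show "(\<lambda>\<omega>. \<integral>\<^sup>+v. norm v \<partial>K' n (Y n \<omega>)) \<in> borel_measurable P"
          by (rule nn_integral_measurable_subprob_algebra2[where N = borel]) measurable
      qed auto
      then show "AE \<omega> in P. has_bochner_integral (K' n (Y n \<omega>)) (\<lambda>v. g ((Y 0 \<omega>, Y n \<omega>), v)) 0"
      proof eventually_elim
        case (elim \<omega>)
        have K': "sets (K' n (Y n \<omega>)) = sets borel" "prob_space (K' n (Y n \<omega>))"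
          using dis[OF n] by (auto simp: disint_def)
        interpret prob_space "K' n (Y n \<omega>)" by (rule K'(2))
        have 1: "has_bochner_integral (K' n (Y n \<omega>)) (\<lambda>v. v) (b n (Y n \<omega>))"
          unfolding b_def using elim by (intro has_bochner_integral_barycenter K') (auto simp: less_top)
        \<comment> \<open>A constant integrates to itself under a probability measure; it is written
          as an indicator of the whole space times a vector.\<close>
        have 2: "has_bochner_integral (K' n (Y n \<omega>)) (\<lambda>v. b n (Y n \<omega>)) (b n (Y n \<omega>))"
          using has_bochner_integral_indicator[of "space (K' n (Y n \<omega>))" "K' n (Y n \<omega>)" "b n (Y n \<omega>)"]
          by (subst has_bochner_integral_cong[OF refl, of _ _ "\<lambda>v. indicator (space (K' n (Y n \<omega>))) v *\<^sub>R b n (Y n \<omega>)"])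
            (auto simp: prob_space emeasure_space_1)
        show ?case
          using has_bochner_integral_inner_left[OF has_bochner_integral_diff[OF 1 2], of "G (Y 0 \<omega>, Y n \<omega>)"]
          by (simp add: g_def)
      qed
    qed
    then show ?thesis by (simp add: g_def)
  qed
  have interp: "AE \<omega> in P. Z \<omega> t = Gmap \<tau> T (\<lambda>n. Y n \<omega>) t" if t: "t \<in> {0..T}" for t
  proof -
    \<comment> \<open>\<open>h\<close> interpolates a path through its own nodes. The defect
      \<open>\<gamma> t - h \<gamma>\<close> vanishes on the range of \<open>Gmap\<close>, and
      equality of laws turns this into an almost sure statement on \<open>Z\<close> for each fixed
      \<open>t\<close>.\<close>
    define h where "h \<gamma> = Gmap \<tau> T (\<lambda>n. node \<tau> T n \<gamma>) t" for \<gamma> :: "real \<Rightarrow> 'a"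
    have [measurable]: "(\<lambda>\<gamma>. \<gamma> t) \<in> measurable (pathM T) (borel :: 'a measure)"
      using t by (rule measurable_component_singleton)
    have [measurable]: "h \<in> measurable (pathM T) borel" unfolding h_def Gmap_ramp[OF \<tau> T t] by measurable
    have "h (Gmap \<tau> T x) = Gmap \<tau> T x t" for x :: "nat \<Rightarrow> 'a"
      unfolding h_def Gmap_ramp[OF \<tau> T t] N_def[symmetric] by (auto simp: nodeG intro!: sum.cong)
    then have "(\<integral>\<^sup>+x. ennreal (norm (Gmap \<tau> T x t - h (Gmap \<tau> T x))) \<partial>A) = 0" by simp
    then have "(\<integral>\<^sup>+\<omega>. ennreal (norm (Z \<omega> t - h (Z \<omega>))) \<partial>P) = 0"
      by (subst tr[of "\<lambda>\<gamma>. ennreal (norm (\<gamma> t - h \<gamma>))"]) auto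
    then have "AE \<omega> in P. ennreal (norm (Z \<omega> t - h (Z \<omega>))) = 0"
      by (subst (asm) nn_integral_0_iff_AE) auto
    then show ?thesis by eventually_elim (simp add: h_def Y_def)
  qed
  have lift: "Euler_lift P H \<tau> T L Y b"
  proof (rule Euler_lift.intro)
    fix n assume n: "n < stepN \<tau> T"
    note n' = n[folded N_def]
    have V_eq: "(\<lambda>\<omega>. (1 / \<tau>) *\<^sub>R (Y (Suc n) \<omega> - Y n \<omega>)) = V n" by (simp add: V_def fun_eq_iff)
    show "Y n \<in> L2 P" by (rule YL2[OF n'])
    show "(\<lambda>\<omega>. (1 / \<tau>) *\<^sub>R (Y (Suc n) \<omega> - Y n \<omega>)) \<in> L2 P" unfolding V_eq by (rule VL2[OF n'])
    show "L2norm P (\<lambda>\<omega>. (1 / \<tau>) *\<^sub>R (Y (Suc n) \<omega> - Y n \<omega>)) \<le> L" unfolding V_eq by (rule VL[OF n'])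
    show "b n \<in> borel_measurable borel" by (rule bm[OF n'])
    show "distr P borel (\<lambda>\<omega>. (Y n \<omega>, b n (Y n \<omega>))) \<in> H" by (rule bar[OF n'])
    fix g :: "'a \<times> 'a \<Rightarrow> 'a"
    assume "g \<in> borel_measurable borel" "(\<lambda>\<omega>. g (Y 0 \<omega>, Y n \<omega>)) \<in> L2 P" "(\<lambda>\<omega>. b n (Y n \<omega>)) \<in> L2 P"
    from orth[OF n' this]
    show "(\<integral>\<omega>. inner ((1 / \<tau>) *\<^sub>R (Y (Suc n) \<omega> - Y n \<omega>) - b n (Y n \<omega>)) (g (Y 0 \<omega>, Y n \<omega>)) \<partial>P) = 0"
      unfolding V_def .
  qed (rule \<tau> T Ym)+
  have Y0: "Y 0 \<omega> = Z \<omega> 0" for \<omega>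
    using N by (simp add: Y_def node_def N_def)
  show thesis by (rule that[OF lift interp Y0])
qed

section \<open>A conditionally independent coupling\<close>

text \<open>Given the common cell, both points are drawn independently from \<open>P\<close>
  conditioned on that cell, which amounts to a density on the product space. For a fixed second
  point, the integral over the first one tests \<open>A\<close> against a vector constant on one
  cell, so those are the only tests required.\<close>

lemma conditionally_independent_coupling:
  fixes P :: "'b measure" and c :: "'b \<Rightarrow> nat"
  assumes P: "prob_space P" and c[measurable]: "c \<in> measurable P (count_space UNIV)"
  obtains R :: "('b \<times> 'b) measure"
  where "prob_space R" "fst \<in> measurable R P" "snd \<in> measurable R P"
    "distr R P fst = P" "distr R P snd = P" "AE p in R. c (fst p) = c (snd p)"
    "\<forall>A\<in>L2 P. \<forall>B\<in>L2 P.
      (\<forall>i e. (\<integral>\<omega>. inner (A \<omega>) (if c \<omega> = i then e else 0 :: 'a::{real_inner,second_countable_topology}) \<partial>P) = 0) \<longrightarrow>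
      (\<integral>p. inner (A (fst p)) (B (snd p)) \<partial>R) = 0"
proof -
  interpret P: prob_space P by fact
  interpret PP: pair_prob_space P P ..
  define w where "w i = measure P {\<omega> \<in> space P. c \<omega> = i}" for i
  \<comment> \<open>On a cell of probability zero the division yields 0, so \<open>q\<close> has
    mass zero there instead of one; \<open>w_pos\<close> shows that such cells are almost surely
    avoided.\<close>
  define q where "q p = (if c (fst p) = c (snd p) then 1 / w (c (fst p)) else 0)" for p
  define R where "R = density (P \<Otimes>\<^sub>M P) (\<lambda>p. ennreal (q p))"
  have w_nonneg: "0 \<le> w i" for i by (simp add: w_def)
  have q_nonneg: "0 \<le> q p" for p by (simp add: q_def w_nonneg)
  have q[measurable]: "q \<in> borel_measurable (P \<Otimes>\<^sub>M P)"
  proof -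
    have c1 [measurable]: "(\<lambda>p. c (fst p)) \<in> measurable (P \<Otimes>\<^sub>M P) (count_space UNIV)"
      and c2 [measurable]: "(\<lambda>p. c (snd p)) \<in> measurable (P \<Otimes>\<^sub>M P) (count_space UNIV)"
      by measurable
    have [measurable]: "(\<lambda>p. w (c (fst p))) \<in> borel_measurable (P \<Otimes>\<^sub>M P)"
      by (rule measurable_compose[OF c1]) simp
    have [measurable]: "(\<lambda>p. real (c (fst p))) \<in> borel_measurable (P \<Otimes>\<^sub>M P)"
      "(\<lambda>p. real (c (snd p))) \<in> borel_measurable (P \<Otimes>\<^sub>M P)"
      by (rule measurable_compose[OF c1] measurable_compose[OF c2]; simp)+
    have "Measurable.pred (P \<Otimes>\<^sub>M P) (\<lambda>p. real (c (fst p)) = real (c (snd p)))"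
      by measurable
    then have [measurable]: "Measurable.pred (P \<Otimes>\<^sub>M P) (\<lambda>p. c (fst p) = c (snd p))"
      by simp
    show ?thesis unfolding q_def by measurable
  qed
  have w_emeasure: "emeasure P {\<omega> \<in> space P. c \<omega> = i} = ennreal (w i)" for i
    by (simp add: w_def P.emeasure_eq_measure)
  have w_pos: "AE \<omega> in P. w (c \<omega>) \<noteq> 0"
  proof -
    \<comment> \<open>There are countably many cells, so the null ones can be discarded all at
      once.\<close>
    have "AE \<omega> in P. w i = 0 \<longrightarrow> c \<omega> \<noteq> i" for i
    proof (cases "w i = 0")
      case True
      then have "{\<omega> \<in> space P. c \<omega> = i} \<in> null_sets P" using w_emeasure[of i] by (intro null_setsI) auto
      from AE_not_in[OF this] show ?thesis using AE_space by eventually_elim auto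
    qed simp
    then have "AE \<omega> in P. \<forall>i. w i = 0 \<longrightarrow> c \<omega> \<noteq> i" by (simp add: AE_all_countable)
    then show ?thesis by eventually_elim auto
  qed
  have mass: "(\<integral>\<^sup>+\<omega>'. ennreal (if c \<omega>' = c \<omega> then 1 / w (c \<omega>) else 0) \<partial>P) = 1" if "w (c \<omega>) \<noteq> 0" for \<omega>
  proof -
    have "(\<integral>\<^sup>+\<omega>'. ennreal (if c \<omega>' = c \<omega> then 1 / w (c \<omega>) else 0) \<partial>P)
      = (\<integral>\<^sup>+\<omega>'. ennreal (1 / w (c \<omega>)) * indicator {\<omega>' \<in> space P. c \<omega>' = c \<omega>} \<omega>' \<partial>P)"
      by (intro nn_integral_cong) auto
    also have "\<dots> = ennreal (1 / w (c \<omega>)) * ennreal (w (c \<omega>))"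
      by (subst nn_integral_cmult_indicator) (auto simp: w_emeasure)
    also have "\<dots> = 1" using that w_nonneg[of "c \<omega>"] by (simp flip: ennreal_mult)
    finally show ?thesis .
  qed
  have fst_m: "fst \<in> measurable R P" and snd_m: "snd \<in> measurable R P"
    by (auto simp: R_def)
  have fst_law: "distr R P fst = P"
  proof (rule measure_eqI)
    fix S assume "S \<in> sets (distr R P fst)"
    then have S[measurable]: "S \<in> sets P" by simp
    have "emeasure (distr R P fst) S = (\<integral>\<^sup>+p. indicator S (fst p) \<partial>R)"
      using fst_m by (simp add: nn_integral_distr[symmetric] flip: nn_integral_indicator)
    also have "\<dots> = (\<integral>\<^sup>+p. ennreal (q p) * indicator S (fst p) \<partial>(P \<Otimes>\<^sub>M P))"
      unfolding R_def by (subst nn_integral_density) auto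
    also have "\<dots> = (\<integral>\<^sup>+\<omega>. \<integral>\<^sup>+\<omega>'. ennreal (q (\<omega>, \<omega>')) * indicator S \<omega> \<partial>P \<partial>P)"
      by (subst P.nn_integral_fst[symmetric]) auto
    also have "\<dots> = (\<integral>\<^sup>+\<omega>. indicator S \<omega> \<partial>P)"
      using w_pos
    proof (intro nn_integral_cong_AE, eventually_elim)
      case (elim \<omega>)
      have "(\<integral>\<^sup>+\<omega>'. ennreal (q (\<omega>, \<omega>')) * indicator S \<omega> \<partial>P) = (\<integral>\<^sup>+\<omega>'. ennreal (if c \<omega>' = c \<omega> then 1 / w (c \<omega>) else 0) \<partial>P) * indicator S \<omega>"
        by (subst nn_integral_multc[symmetric]) (auto simp: q_def intro!: nn_integral_cong)
      then show ?case using mass[OF elim(2)] by simp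
    qed
    finally show "emeasure (distr R P fst) S = emeasure P S" by simp
  qed simp
  have snd_law: "distr R P snd = P"
  proof (rule measure_eqI)
    fix S assume "S \<in> sets (distr R P snd)"
    then have S[measurable]: "S \<in> sets P" by simp
    have "emeasure (distr R P snd) S = (\<integral>\<^sup>+p. indicator S (snd p) \<partial>R)"
      using snd_m by (simp add: nn_integral_distr[symmetric] flip: nn_integral_indicator)
    also have "\<dots> = (\<integral>\<^sup>+p. ennreal (q p) * indicator S (snd p) \<partial>(P \<Otimes>\<^sub>M P))"
      unfolding R_def by (subst nn_integral_density) auto
    also have "\<dots> = (\<integral>\<^sup>+\<omega>'. \<integral>\<^sup>+\<omega>. ennreal (q (\<omega>, \<omega>')) * indicator S \<omega>' \<partial>P \<partial>P)"
      by (subst PP.nn_integral_snd[symmetric]) auto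
    also have "\<dots> = (\<integral>\<^sup>+\<omega>'. indicator S \<omega>' \<partial>P)"
      using w_pos
    proof (intro nn_integral_cong_AE, eventually_elim)
      case (elim \<omega>')
      have "(\<integral>\<^sup>+\<omega>. ennreal (q (\<omega>, \<omega>')) * indicator S \<omega>' \<partial>P) = (\<integral>\<^sup>+\<omega>. ennreal (if c \<omega> = c \<omega>' then 1 / w (c \<omega>') else 0) \<partial>P) * indicator S \<omega>'"
        by (subst nn_integral_multc[symmetric]) (auto simp: q_def intro!: nn_integral_cong)
      then show ?case using mass[OF elim(2)] by simp
    qed
    finally show "emeasure (distr R P snd) S = emeasure P S" by simp
  qed simp
  have prob: "prob_space R"
  proof (rule prob_spaceI)
    have "emeasure R (space R) = emeasure (distr R P fst) (space P)"
      using fst_m by (subst emeasure_distr) (auto intro!: arg_cong2[where f = emeasure] dest: measurable_space)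
    then show "emeasure R (space R) = 1" unfolding fst_law by (simp add: P.emeasure_space_1)
  qed
  have cell: "AE p in R. c (fst p) = c (snd p)"
    unfolding R_def AE_density[OF measurable_compose[OF q measurable_ennreal]] by (simp add: q_def)
  have orth: "(\<integral>p. inner (A (fst p)) (B (snd p)) \<partial>R) = 0"
    if A: "A \<in> L2 P" and B: "B \<in> L2 P"
      and z: "\<And>i e. (\<integral>\<omega>. inner (A \<omega>) (if c \<omega> = i then e else 0) \<partial>P) = 0" for A B :: "'b \<Rightarrow> 'a"
  proof -
    note [measurable] = L2_measurable[OF A] L2_measurable[OF B]
    have "(\<lambda>p. A (fst p)) \<in> L2 R" "(\<lambda>p. B (snd p)) \<in> L2 R"
      using A B L2_distr_iff[OF fst_m L2_measurable[OF A]] L2_distr_iff[OF snd_m L2_measurable[OF B]]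
      unfolding fst_law snd_law by auto
    from L2_integrable_inner[OF this]
    have int: "integrable (P \<Otimes>\<^sub>M P) (\<lambda>p. q p * inner (A (fst p)) (B (snd p)))"
      unfolding R_def by (subst (asm) integrable_density) (auto simp: q_nonneg)
    have "(\<integral>p. inner (A (fst p)) (B (snd p)) \<partial>R) = (\<integral>p. q p * inner (A (fst p)) (B (snd p)) \<partial>(P \<Otimes>\<^sub>M P))"
      unfolding R_def by (subst integral_density) (auto simp: q_nonneg)
    \<comment> \<open>The first variable is integrated first: with the second one frozen,
      \<open>B \<omega>'\<close> is a constant vector and the hypothesis on \<open>A\<close>
      applies.\<close>
    also have "\<dots> = (\<integral>\<omega>'. (\<integral>\<omega>. q (\<omega>, \<omega>') * inner (A \<omega>) (B \<omega>') \<partial>P) \<partial>P)"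
      using int by (subst PP.integral_snd) (auto simp: case_prod_beta')
    also have "\<dots> = (\<integral>\<omega>'. 0 \<partial>P)"
    proof (intro Bochner_Integration.integral_cong refl)
      fix \<omega>'
      have "(\<integral>\<omega>. q (\<omega>, \<omega>') * inner (A \<omega>) (B \<omega>') \<partial>P)
        = (\<integral>\<omega>. inner (A \<omega>) (if c \<omega> = c \<omega>' then (1 / w (c \<omega>')) *\<^sub>R B \<omega>' else 0) \<partial>P)"
        by (intro Bochner_Integration.integral_cong refl) (auto simp: q_def)
      then show "(\<integral>\<omega>. q (\<omega>, \<omega>') * inner (A \<omega>) (B \<omega>') \<partial>P) = 0" using z by simp
    qed
    finally show ?thesis by simp
  qed
  show thesis
    by (rule that[OF prob fst_m snd_m fst_law snd_law cell]) (use orth in blast)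
qed

text \<open>A point is labelled by the first element of a countable dense set within
  \<open>\<epsilon> / 2\<close> of it; points with the same label share this centre.\<close>

lemma small_cells:
  fixes \<epsilon> :: real
  assumes "0 < \<epsilon>"
  obtains cell :: "'a::{metric_space,second_countable_topology} \<Rightarrow> nat"
  where "cell \<in> measurable borel (count_space UNIV)" "\<And>x y. cell x = cell y \<Longrightarrow> dist x y < \<epsilon>"
proof -
  obtain D :: "'a set" where D: "countable D" "\<And>X. open X \<Longrightarrow> X \<noteq> {} \<Longrightarrow> \<exists>d\<in>D. d \<in> X"
    using countable_dense_setE by blast
  then have "D \<noteq> {}" by (metis UNIV_not_empty empty_iff open_UNIV)
  define cell where "cell x = (LEAST i. dist x (from_nat_into D i) < \<epsilon> / 2)" for x
  have "\<exists>i. dist x (from_nat_into D i) < \<epsilon> / 2" for x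
  proof -
    obtain d where "d \<in> D" "d \<in> ball x (\<epsilon> / 2)" using D(2)[of "ball x (\<epsilon> / 2)"] assms by auto
    then show ?thesis using from_nat_into_surj[OF D(1)] by (metis mem_ball)
  qed
  then have near: "dist x (from_nat_into D (cell x)) < \<epsilon> / 2" for x
    unfolding cell_def by (rule LeastI_ex)
  show thesis
  proof (rule that[of cell])
    show "cell \<in> measurable borel (count_space UNIV)" unfolding cell_def by measurable
    show "dist x y < \<epsilon>" if "cell x = cell y" for x y
      using near[of x] near[of y] that dist_triangle_half_l by metis
  qed
qed

text \<open>The joint law of the two pairs is an admissible coupling whatever their dependence, so
  total dissipativity becomes an inequality between random variables on one space.\<close>

lemma tdiss_coupling:
  fixes X W X' W' :: "'c \<Rightarrow> 'a::{real_inner,complete_space,second_countable_topology}"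
  assumes G: "tdiss lam G" and R: "prob_space R"
    and m[measurable]: "X \<in> borel_measurable R" "W \<in> borel_measurable R"
      "X' \<in> borel_measurable R" "W' \<in> borel_measurable R"
    and laws: "distr R borel (\<lambda>p. (X p, W p)) \<in> G" "distr R borel (\<lambda>p. (X' p, W' p)) \<in> G"
  shows "(\<integral>p. inner (W' p - W p) (X' p - X p) \<partial>R) \<le> lam * (L2norm R (\<lambda>p. X' p - X p))\<^sup>2"
proof -
  define \<theta> where "\<theta> = distr R borel (\<lambda>p. ((X p, W p), (X' p, W' p)))"
  have J[measurable]: "(\<lambda>p. ((X p, W p), (X' p, W' p))) \<in> measurable R borel" by measurable
  have c: "(fst :: ('a \<times> 'a) \<times> ('a \<times> 'a) \<Rightarrow> _) \<in> measurable borel borel"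
    "(snd :: ('a \<times> 'a) \<times> ('a \<times> 'a) \<Rightarrow> _) \<in> measurable borel borel"
    by (intro borel_measurable_continuous_onI continuous_intros)+
  have "\<theta> \<in> Gamma (distr R borel (\<lambda>p. (X p, W p))) (distr R borel (\<lambda>p. (X' p, W' p)))"
    unfolding Gamma_def \<theta>_def using c
    by (auto simp: prob_space.prob_space_distr[OF R J] distr_distr[OF _ J] comp_def)
  with G laws have "(\<integral>q. inner (snd (snd q) - snd (fst q)) (fst (snd q) - fst (fst q)) \<partial>\<theta>)
      \<le> lam * (\<integral>q. (norm (fst (snd q) - fst (fst q)))\<^sup>2 \<partial>\<theta>)"
    unfolding tdiss_def by blast
  moreover have "(\<lambda>q::('a \<times> 'a) \<times> 'a \<times> 'a. inner (snd (snd q) - snd (fst q)) (fst (snd q) - fst (fst q))) \<in> borel_measurable borel"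
    "(\<lambda>q::('a \<times> 'a) \<times> 'a \<times> 'a. (norm (fst (snd q) - fst (fst q)))\<^sup>2) \<in> borel_measurable borel"
    by (intro borel_measurable_continuous_onI continuous_intros)+
  ultimately show ?thesis
    unfolding \<theta>_def L2norm_power2 by (simp add: integral_distr[OF J])
qed

text \<open>The difference quotients have norm at most \<open>C\<close>, and \<open>W\<close> is
  their limit.\<close>

lemma L2norm_derivative_le:
  fixes X :: "real \<Rightarrow> 'b \<Rightarrow> 'a::{real_inner,second_countable_topology}"
  assumes X: "\<And>s. s \<in> {0..T} \<Longrightarrow> X s \<in> L2 P"
    and lip: "\<And>s t. s \<in> {0..T} \<Longrightarrow> t \<in> {0..T} \<Longrightarrow> L2dist P (X s) (X t) \<le> C * \<bar>s - t\<bar>"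
    and t: "0 \<le> t" "t < T" and W: "W \<in> L2 P"
    and lim: "((\<lambda>s. L2dist P (\<lambda>\<omega>. (1 / (s - t)) *\<^sub>R (X s \<omega> - X t \<omega>)) W) \<longlongrightarrow> 0) (at_right t)"
  shows "L2norm P W \<le> C"
proof (rule tendsto_lowerbound[OF _ _ trivial_limit_at_right_real])
  show "((\<lambda>s. C + L2dist P (\<lambda>\<omega>. (1 / (s - t)) *\<^sub>R (X s \<omega> - X t \<omega>)) W) \<longlongrightarrow> C) (at_right t)"
    using tendsto_add[OF tendsto_const lim] by simp
  have "\<forall>\<^sub>F s in at_right t. s \<in> {t<..<T}"
    using t by (intro eventually_at_right_real) auto
  then show "\<forall>\<^sub>F s in at_right t. L2norm P W \<le> C + L2dist P (\<lambda>\<omega>. (1 / (s - t)) *\<^sub>R (X s \<omega> - X t \<omega>)) W"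
  proof eventually_elim
    case (elim s)
    define q where "q = (\<lambda>\<omega>. (1 / (s - t)) *\<^sub>R (X s \<omega> - X t \<omega>))"
    have st: "s \<in> {0..T}" "t \<in> {0..T}" "t < s" using elim t by auto
    have q: "q \<in> L2 P" unfolding q_def by (intro L2_scaleR L2_diff X st)
    have "L2norm P q = (1 / (s - t)) * L2dist P (X s) (X t)"
      unfolding q_def L2norm_scaleR L2dist_eq_L2norm using st by simp
    also have "\<dots> \<le> (1 / (s - t)) * (C * \<bar>s - t\<bar>)"
      using lip[OF st(1,2)] st by (intro mult_left_mono) auto
    also have "\<dots> = C" using st by simp
    finally have qC: "L2norm P q \<le> C" .
    have "L2norm P W \<le> L2norm P q + L2norm P (\<lambda>\<omega>. q \<omega> - W \<omega>)"
      using L2norm_diff_triangle[OF q L2_diff[OF q W]] by simp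
    then show ?case using qC by (simp add: L2dist_eq_L2norm q_def[symmetric])
  qed
qed

section \<open>Distance between an Euler process and a Lagrangian solution\<close>

context Euler_lift begin

text \<open>Doubling a squared norm in dissipativity gives the Gronwall rate
  \<open>2 * \<bar>lam\<bar>\<close>, hence the exponent \<open>4 * \<bar>lam\<bar> * T\<close>. The
  10 is 2 + 8: the two comparisons start at distances \<open>r\<close> and \<open>2 * r\<close> in
  the limit, and each squared distance is doubled when they are combined; the error \<beta> occurs
  in one of them only.\<close>

lemma Lagrangian_estimate:
  assumes P: "prob_space P" and H: "tdiss lam H" "H \<subseteq> P2"
    and XL2: "\<And>t. t \<in> {0..T} \<Longrightarrow> X t \<in> L2 P"
    and lipX: "\<And>s t. s \<in> {0..T} \<Longrightarrow> t \<in> {0..T} \<Longrightarrow> L2dist P (X s) (X t) \<le> C * \<bar>s - t\<bar>"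
    and derX: "AE t in lborel. t \<in> {0<..<T} \<longrightarrow> (\<exists>W. (X t, W) \<in> lagr_op P H \<and>
      ((\<lambda>s. L2dist P (\<lambda>\<omega>. (1 / (s - t)) *\<^sub>R (X s \<omega> - X t \<omega>)) W) \<longlongrightarrow> 0) (at t within {0..T}))"
    and t: "t \<in> {0..T}"
  defines "\<zeta> \<equiv> \<lambda>t \<omega>. Gmap \<tau> T (\<lambda>n. Y n \<omega>) t"
  shows "\<zeta> t \<in> L2 P"
    and "s \<in> {0..T} \<Longrightarrow> L2norm P (\<lambda>\<omega>. \<zeta> s \<omega> - \<zeta> t \<omega>) \<le> L * \<bar>s - t\<bar>"
    and "(L2norm P (\<lambda>\<omega>. \<zeta> t \<omega> - X t \<omega>))\<^sup>2 \<le> exp (4 * \<bar>lam\<bar> * T) * (10 * (L2norm P (\<lambda>\<omega>. Y 0 \<omega> - X 0 \<omega>))\<^sup>2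
      + 4 * (2 * \<bar>lam\<bar> * \<tau>\<^sup>2 * L\<^sup>2 + \<tau> * ((L + C) * L)) * T)"
proof -
  have N: "0 < N" using stepN_props(1)[OF \<tau> T] by (simp add: N_def)
  have "0 \<le> L" using order_trans[OF L2norm_nonneg VL[OF N]] .
  have "0 \<le> C * \<bar>0 - T\<bar>"
    using order_trans[OF L2norm_nonneg lipX[of 0 T, unfolded L2dist_eq_L2norm]] T by simp
  then have "0 \<le> C" using T by (simp add: zero_le_mult_iff)
  note [measurable] = Ym
  have \<zeta>_ramp: "\<zeta> r \<omega> = Y 0 \<omega> + (\<Sum>n<N. ramp \<tau> (r - real n * \<tau>) *\<^sub>R V n \<omega>)" if "r \<in> {0..T}" for r \<omega>
    unfolding \<zeta>_def Gmap_ramp[OF \<tau> T that] N_def V_def ..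
  have \<zeta>L2: "\<zeta> r \<in> L2 P" if "r \<in> {0..T}" for r
  proof -
    have "(\<lambda>\<omega>. Y 0 \<omega> + (\<Sum>n<N. ramp \<tau> (r - real n * \<tau>) *\<^sub>R V n \<omega>)) \<in> L2 P"
      using N by (intro L2_add L2_sum L2_scaleR VL2 YL2) auto
    then show ?thesis by (simp add: \<zeta>_ramp[OF that, abs_def])
  qed
  then show "\<zeta> t \<in> L2 P" using t by blast
  have lip_le: "L2norm P (\<lambda>\<omega>. \<zeta> s \<omega> - \<zeta> r \<omega>) \<le> L * (s - r)"
    if sr: "r \<in> {0..T}" "s \<in> {0..T}" "r \<le> s" for r s
  proof -
    define d where "d n = ramp \<tau> (s - real n * \<tau>) - ramp \<tau> (r - real n * \<tau>)" for n
    have d: "0 \<le> d n" for n using ramp_mono[OF \<tau> T, of "r - real n * \<tau>" "s - real n * \<tau>"] sr by (simp add: d_def)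
    have "L2norm P (\<lambda>\<omega>. \<zeta> s \<omega> - \<zeta> r \<omega>) = L2norm P (\<lambda>\<omega>. \<Sum>n<N. d n *\<^sub>R V n \<omega>)"
      using sr by (simp add: \<zeta>_ramp d_def scaleR_left_diff_distrib sum_subtractf)
    also have "\<dots> \<le> (\<Sum>n<N. L2norm P (\<lambda>\<omega>. d n *\<^sub>R V n \<omega>))"
      by (intro L2norm_sum L2_scaleR VL2) auto
    also have "\<dots> = (\<Sum>n<N. d n * L2norm P (V n))" using d by (simp add: L2norm_scaleR)
    also have "\<dots> \<le> (\<Sum>n<N. d n * L)" using d VL by (intro sum_mono mult_left_mono) auto
    also have "\<dots> = (s - r) * L"
      using sr ramp_sum[OF \<tau> T] by (simp add: d_def sum_subtractf N_def flip: sum_distrib_right)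
    finally show ?thesis by (simp add: mult.commute)
  qed
  have lip\<zeta>: "L2norm P (\<lambda>\<omega>. \<zeta> s \<omega> - \<zeta> r \<omega>) \<le> L * \<bar>s - r\<bar>"
    if sr: "r \<in> {0..T}" "s \<in> {0..T}" for r s
  proof (cases "r \<le> s")
    case True
    then show ?thesis using lip_le[OF sr] by simp
  next
    case False
    then show ?thesis
      using lip_le[OF sr(2,1)] by (simp add: L2norm_def norm_minus_commute abs_if)
  qed
  show "L2norm P (\<lambda>\<omega>. \<zeta> s \<omega> - \<zeta> t \<omega>) \<le> L * \<bar>s - t\<bar>" if "s \<in> {0..T}"
    using lip\<zeta>[OF t that] .
  \<comment> \<open>Square integrability of the barycenter is read off from the membership of its
    law in \<open>H\<close>, whose elements have finite second moments.\<close>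
  have bL2: "(\<lambda>\<omega>. b n (Y n \<omega>)) \<in> L2 P" if n: "n < N" for n
  proof -
    have m: "(\<lambda>\<omega>. (Y n \<omega>, b n (Y n \<omega>))) \<in> measurable P borel"
      using measurable_compose[OF Ym bm[OF n]] by simp
    have "snd \<in> L2 (distr P borel (\<lambda>\<omega>. (Y n \<omega>, b n (Y n \<omega>))))"
      using bar[OF n] H(2) by (intro P2_L2) auto
    moreover have "snd \<in> measurable (borel :: ('a \<times> 'a) measure) borel"
      by (intro borel_measurable_continuous_onI continuous_intros)
    ultimately show ?thesis using L2_distr_iff[OF m, of snd] by simp
  qed
  define r where "r = L2norm P (\<lambda>\<omega>. Y 0 \<omega> - X 0 \<omega>)"
  \<comment> \<open>Both summands measure the displacement since the last node: the first through
    the change of the squared distance in dissipativity, the second through its pairing with the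
    relative velocity, of norm at most \<open>L + C\<close>.\<close>
  define \<beta> where "\<beta> = 2 * \<bar>lam\<bar> * \<tau>\<^sup>2 * L\<^sup>2 + \<tau> * ((L + C) * L)"
  define E where "E = exp (4 * \<bar>lam\<bar> * T)"
  have "0 \<le> \<beta>" using \<open>0 \<le> L\<close> \<open>0 \<le> C\<close> \<tau> by (simp add: \<beta>_def)
  have "0 \<le> r" by (simp add: r_def)
  have T0: "0 \<in> {0..T}" using T by simp
  have Y0: "Y 0 \<in> L2 P" using N by (rule YL2)
  have \<zeta>0: "\<zeta> 0 \<omega> = Y 0 \<omega>" for \<omega>
  proof -
    have "ramp \<tau> (0 - real n * \<tau>) = 0" for n
      using mult_nonneg_nonneg[of "real n" \<tau>] \<tau> unfolding ramp_def by linarith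
    then show ?thesis unfolding \<zeta>_ramp[OF T0] by simp
  qed
  \<comment> \<open>Here \<epsilon> is the width of the cells. The coupling depends on it, the
    left-hand side does not.\<close>
  have main: "(L2norm P (\<lambda>\<omega>. \<zeta> t \<omega> - X t \<omega>))\<^sup>2
      \<le> 2 * (E * ((\<epsilon> + r)\<^sup>2 + 2 * \<beta> * T)) + 2 * (E * (\<epsilon> + 2 * r)\<^sup>2)" if "0 < \<epsilon>" for \<epsilon>
  proof -
    obtain cell :: "'a \<Rightarrow> nat" where cell: "cell \<in> measurable borel (count_space UNIV)"
      "\<And>x y. cell x = cell y \<Longrightarrow> dist x y < \<epsilon>"
      using small_cells[OF \<open>0 < \<epsilon>\<close>] by blast
    define c where "c \<omega> = cell (Y 0 \<omega>)" for \<omega>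
    have c: "c \<in> measurable P (count_space UNIV)"
      unfolding c_def by (rule measurable_compose[OF Ym cell(1)])
    obtain R :: "('b \<times> 'b) measure" where R: "prob_space R"
      and fstm: "fst \<in> measurable R P" and sndm: "snd \<in> measurable R P"
      and fstl: "distr R P fst = P" and sndl: "distr R P snd = P"
      and same: "AE p in R. c (fst p) = c (snd p)"
      and indep: "\<forall>A\<in>L2 P. \<forall>B\<in>L2 P.
        (\<forall>i e. (\<integral>\<omega>. inner (A \<omega>) (if c \<omega> = i then e else 0 :: 'a) \<partial>P) = 0) \<longrightarrow>
        (\<integral>p. inner (A (fst p)) (B (snd p)) \<partial>R) = 0"
      using conditionally_independent_coupling[OF P c, where 'a = 'a] .
    have fL2: "(\<lambda>p. A (fst p)) \<in> L2 R" "L2norm R (\<lambda>p. A (fst p)) = L2norm P A"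
      and sL2: "(\<lambda>p. A (snd p)) \<in> L2 R" "L2norm R (\<lambda>p. A (snd p)) = L2norm P A"
      if "A \<in> L2 P" for A :: "'b \<Rightarrow> 'a"
      using that L2_distr_iff[OF fstm L2_measurable[OF that]] L2_distr_iff[OF sndm L2_measurable[OF that]]
        L2norm_distr[OF fstm L2_measurable[OF that]] L2norm_distr[OF sndm L2_measurable[OF that]]
      unfolding fstl sndl by simp_all
    have flaw: "distr R borel (\<lambda>p. f (fst p)) = distr P borel f"
      and slaw: "distr R borel (\<lambda>p. f (snd p)) = distr P borel f"
      if "f \<in> measurable P borel" for f :: "'b \<Rightarrow> 'a \<times> 'a"
      using distr_distr[OF that fstm] distr_distr[OF that sndm] unfolding fstl sndl comp_def by simp_all
    \<comment> \<open>The derivative of \<open>X\<close> is taken within \<open>{0..T}\<close>; only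
      its right half is kept, since \<zeta> has corners at the nodes.\<close>
    have right: "((\<lambda>s. f s) \<longlongrightarrow> 0) (at_right t')"
      if "(f \<longlongrightarrow> 0) (at t' within {0..T})" "t' \<in> {0<..<T}" for f :: "real \<Rightarrow> real" and t'
      using tendsto_within_subset[OF that(1), of "{t'..T}"] that(2) at_within_Icc_at_right[of t' T] by auto
    \<comment> \<open>At a common sample point the error is a difference of two comparisons across
      the coupling: \<open>\<zeta> t (fst p) - X t (fst p)\<close> equals
      \<open>D1 t p - D2 t p\<close>.\<close>
    define D1 where "D1 s p = \<zeta> s (fst p) - X s (snd p)" for s p
    define D2 where "D2 s p = X s (fst p) - X s (snd p)" for s p
    have Y0cell: "L2norm R (\<lambda>p. Y 0 (fst p) - Y 0 (snd p)) \<le> \<epsilon>"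
    proof -
      interpret prob_space R by fact
      have "(L2norm R (\<lambda>p. Y 0 (fst p) - Y 0 (snd p)))\<^sup>2 \<le> (\<integral>p. \<epsilon>\<^sup>2 \<partial>R)"
        unfolding L2norm_power2
      proof (rule integral_mono_AE)
        show "integrable R (\<lambda>p. (norm (Y 0 (fst p) - Y 0 (snd p)))\<^sup>2)"
          by (intro L2_integrable_power2 L2_diff fL2 sL2 Y0)
        show "AE p in R. (norm (Y 0 (fst p) - Y 0 (snd p)))\<^sup>2 \<le> \<epsilon>\<^sup>2"
          using same
        proof eventually_elim
          case (elim p)
          then have "dist (Y 0 (fst p)) (Y 0 (snd p)) < \<epsilon>" by (intro cell(2)) (simp add: c_def)
          then show ?case by (intro power_mono) (auto simp: dist_norm)
        qed
      qed simp
      then have "(L2norm R (\<lambda>p. Y 0 (fst p) - Y 0 (snd p)))\<^sup>2 \<le> \<epsilon>\<^sup>2" by (simp add: prob_space)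
      then show ?thesis by (rule power2_le_imp_le) (use \<open>0 < \<epsilon>\<close> in simp)
    qed
    have YX: "(\<lambda>\<omega>. Y 0 \<omega> - X 0 \<omega>) \<in> L2 P" by (intro L2_diff Y0 XL2 T0)
    have D1_0: "L2norm R (D1 0) \<le> \<epsilon> + r"
    proof -
      have "D1 0 = (\<lambda>p. (Y 0 (fst p) - Y 0 (snd p)) + (Y 0 (snd p) - X 0 (snd p)))"
        by (simp add: D1_def \<zeta>0 fun_eq_iff)
      then have "L2norm R (D1 0) \<le> L2norm R (\<lambda>p. Y 0 (fst p) - Y 0 (snd p)) + L2norm R (\<lambda>p. Y 0 (snd p) - X 0 (snd p))"
        using L2norm_triangle[OF L2_diff[OF fL2(1)[OF Y0] sL2(1)[OF Y0]] sL2(1)[OF YX]] by simp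
      then show ?thesis using Y0cell sL2(2)[OF YX] by (simp add: r_def)
    qed
    \<comment> \<open>Both points pass from \<open>X 0\<close> to \<open>Y 0\<close>, at cost
      \<open>r\<close> each, and the two values of \<open>Y 0\<close> lie in the same cell.\<close>
    have D2_0: "L2norm R (D2 0) \<le> \<epsilon> + 2 * r"
    proof -
      have "D2 0 = (\<lambda>p. D1 0 p - (Y 0 (fst p) - X 0 (fst p)))"
        by (simp add: D1_def D2_def \<zeta>0 fun_eq_iff)
      moreover have "D1 0 \<in> L2 R"
        unfolding D1_def by (intro L2_diff fL2 sL2 \<zeta>L2 XL2 T0)
      ultimately have "L2norm R (D2 0) \<le> L2norm R (D1 0) + L2norm R (\<lambda>p. Y 0 (fst p) - X 0 (fst p))"
        using L2norm_diff_triangle[OF _ fL2(1)[OF YX]] by simp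
      then show ?thesis using D1_0 fL2(2)[OF YX] by (simp add: r_def)
    qed
    have D1t: "(L2norm R (D1 t))\<^sup>2 \<le> exp (2 * (2 * \<bar>lam\<bar>) * t) * ((L2norm R (D1 0))\<^sup>2 + 2 * \<beta> * t)"
    proof (rule L2_curve_Gronwall[where C = "L + C" and T = T])
      show D1L2: "D1 s \<in> L2 R" if "s \<in> {0..T}" for s
        unfolding D1_def using that by (intro L2_diff fL2 sL2 \<zeta>L2 XL2)
      show "L2dist R (D1 s) (D1 r) \<le> (L + C) * \<bar>s - r\<bar>" if "s \<in> {0..T}" "r \<in> {0..T}" for s r
      proof -
        have 1: "(\<lambda>\<omega>. \<zeta> s \<omega> - \<zeta> r \<omega>) \<in> L2 P" "(\<lambda>\<omega>. X s \<omega> - X r \<omega>) \<in> L2 P"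
          using that by (intro L2_diff \<zeta>L2 XL2; simp)+
        have "L2dist R (D1 s) (D1 r) = L2norm R (\<lambda>p. (\<zeta> s (fst p) - \<zeta> r (fst p)) - (X s (snd p) - X r (snd p)))"
          unfolding L2dist_eq_L2norm D1_def by (simp add: algebra_simps)
        also have "\<dots> \<le> L2norm P (\<lambda>\<omega>. \<zeta> s \<omega> - \<zeta> r \<omega>) + L2norm P (\<lambda>\<omega>. X s \<omega> - X r \<omega>)"
          using L2norm_diff_triangle[OF fL2(1)[OF 1(1)] sL2(1)[OF 1(2)]] fL2(2)[OF 1(1)] sL2(2)[OF 1(2)] by simp
        also have "\<dots> \<le> L * \<bar>s - r\<bar> + C * \<bar>s - r\<bar>"
          using lip\<zeta>[OF that(2,1)] lipX[OF that] by (simp add: L2dist_eq_L2norm)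
        finally show ?thesis by (simp add: distrib_right)
      qed
      show "AE t in lborel. t \<in> {0<..<T} \<longrightarrow> (\<exists>V\<in>L2 R.
          ((\<lambda>s. L2dist R (\<lambda>p. (1 / (s - t)) *\<^sub>R (D1 s p - D1 t p)) V) \<longlongrightarrow> 0) (at_right t)
          \<and> (\<integral>p. inner (V p) (D1 t p) \<partial>R) \<le> 2 * \<bar>lam\<bar> * (L2norm R (D1 t))\<^sup>2 + \<beta>)"
        using derX
      proof eventually_elim
        case (elim t)
        show ?case
        proof
          assume t0: "t \<in> {0<..<T}"
          then have tT: "t \<in> {0..T}" "0 \<le> t" "t < T" by auto
          obtain W where W: "(X t, W) \<in> lagr_op P H"
            "((\<lambda>s. L2dist P (\<lambda>\<omega>. (1 / (s - t)) *\<^sub>R (X s \<omega> - X t \<omega>)) W) \<longlongrightarrow> 0) (at t within {0..T})"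
            using elim t0 by blast
          have WL2: "W \<in> L2 P" and XW: "distr P borel (\<lambda>\<omega>. (X t \<omega>, W \<omega>)) \<in> H"
            using W(1) by (auto simp: lagr_op_def)
          note Wlim = right[OF W(2) t0]
          have WC: "L2norm P W \<le> C"
            by (rule L2norm_derivative_le[OF XL2 lipX tT(2,3) WL2 Wlim])
          \<comment> \<open>The current step. As \<open>t < (real n + 1) * \<tau>\<close> is strict,
            times shortly after \<open>t\<close> belong to the same step even if \<open>t\<close> is
            a node.\<close>
          define n where "n = nat \<lfloor>t / \<tau>\<rfloor>"
          have n1: "real n * \<tau> \<le> t"
          proof -
            have "real n \<le> t / \<tau>" using tT \<tau> by (simp add: n_def)
            then show ?thesis using \<tau> by (simp add: field_simps)
          qed
          have n2: "t < (real n + 1) * \<tau>"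
          proof -
            have "real n = of_int \<lfloor>t / \<tau>\<rfloor>" using tT \<tau> by (simp add: n_def)
            then have "t / \<tau> < real n + 1" using floor_correct[of "t / \<tau>"] by simp
            then show ?thesis using \<tau> by (simp add: pos_divide_less_eq)
          qed
          have nN: "n < N"
          proof (rule ccontr)
            assume "\<not> n < N"
            then have "real N * \<tau> \<le> real n * \<tau>" using \<tau> by (intro mult_right_mono) auto
            then show False using n1 tT stepN_props(3)[OF \<tau> T] by (simp add: N_def)
          qed
          have \<zeta>n: "\<zeta> s \<omega> = Y n \<omega> + (s - real n * \<tau>) *\<^sub>R V n \<omega>"
            if "t \<le> s" "s \<le> T" "s < (real n + 1) * \<tau>" for s \<omega>
          proof -
            have "\<lfloor>s / \<tau>\<rfloor> = int n"
            proof (rule floor_unique)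
              have "real n * \<tau> \<le> s" using n1 that by simp
              then show "of_int (int n) \<le> s / \<tau>" using \<tau> by (simp add: field_simps)
              show "s / \<tau> < of_int (int n) + 1" using that \<tau> by (simp add: field_simps)
            qed
            then have "min (nat \<lfloor>s / \<tau>\<rfloor>) (stepN \<tau> T - 1) = n" using nN by (simp add: N_def)
            then show ?thesis using that tT unfolding \<zeta>_def Gmap_def by (simp add: Let_def V_def)
          qed
          define V1 where "V1 p = V n (fst p) - W (snd p)" for p
          have V1: "V1 \<in> L2 R" unfolding V1_def by (intro L2_diff fL2 sL2 VL2 WL2 nN)
          \<comment> \<open>To the right of \<open>t\<close>, within the step, the difference
            quotient of \<zeta> is exactly \<open>V n\<close>; the whole error is that of the
            quotient of \<open>X\<close>, evaluated at the second point.\<close>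
          have lim: "((\<lambda>s. L2dist R (\<lambda>p. (1 / (s - t)) *\<^sub>R (D1 s p - D1 t p)) V1) \<longlongrightarrow> 0) (at_right t)"
          proof (rule Lim_transform_eventually[OF Wlim])
            have "\<forall>\<^sub>F s in at_right t. s \<in> {t<..<min T ((real n + 1) * \<tau>)}"
              using tT n2 by (intro eventually_at_right_real) auto
            then show "\<forall>\<^sub>F s in at_right t. L2dist P (\<lambda>\<omega>. (1 / (s - t)) *\<^sub>R (X s \<omega> - X t \<omega>)) W
              = L2dist R (\<lambda>p. (1 / (s - t)) *\<^sub>R (D1 s p - D1 t p)) V1"
            proof eventually_elim
              case (elim s)
              then have s: "t < s" "s \<le> T" "s < (real n + 1) * \<tau>" by auto
              define Q where "Q \<omega> = (1 / (s - t)) *\<^sub>R (X s \<omega> - X t \<omega>) - W \<omega>" for \<omega>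
              have Q: "Q \<in> L2 P"
                unfolding Q_def using s tT by (intro L2_diff L2_scaleR XL2 WL2) auto
              have "(1 / (s - t)) *\<^sub>R (D1 s p - D1 t p) - V1 p = - Q (snd p)" for p
              proof -
                have "D1 s p - D1 t p = (s - t) *\<^sub>R V n (fst p) - (X s (snd p) - X t (snd p))"
                proof -
                  have e: "\<zeta> s (fst p) = Y n (fst p) + (s - real n * \<tau>) *\<^sub>R V n (fst p)"
                    "\<zeta> t (fst p) = Y n (fst p) + (t - real n * \<tau>) *\<^sub>R V n (fst p)"
                    using s n2 tT by (auto intro!: \<zeta>n)
                  show ?thesis unfolding D1_def e by (simp add: algebra_simps)
                qed
                then have "(1 / (s - t)) *\<^sub>R (D1 s p - D1 t p)
                    = V n (fst p) - (1 / (s - t)) *\<^sub>R (X s (snd p) - X t (snd p))"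
                  using s by (simp add: scaleR_right_diff_distrib)
                then show ?thesis by (simp add: V1_def Q_def)
              qed
              then have "L2dist R (\<lambda>p. (1 / (s - t)) *\<^sub>R (D1 s p - D1 t p)) V1 = L2norm R (\<lambda>p. Q (snd p))"
                unfolding L2dist_eq_L2norm L2norm_def by simp
              then show ?case using sL2(2)[OF Q] by (simp add: L2dist_eq_L2norm Q_def[abs_def])
            qed
          qed
          define y where "y p = Y n (fst p)" for p :: "'b \<times> 'b"
          define v where "v p = V n (fst p)" for p :: "'b \<times> 'b"
          define bb where "bb p = b n (Y n (fst p))" for p :: "'b \<times> 'b"
          define x where "x p = X t (snd p)" for p :: "'b \<times> 'b"
          define w where "w p = W (snd p)" for p :: "'b \<times> 'b"
          have Yn: "Y n \<in> L2 P" using YL2 nN by simp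
          have L2s: "y \<in> L2 R" "v \<in> L2 R" "bb \<in> L2 R" "x \<in> L2 R" "w \<in> L2 R"
            unfolding y_def v_def bb_def x_def w_def
            by (intro fL2(1) sL2(1) VL2 bL2 Yn XL2 WL2 nN tT)+
          define A where "A \<omega> = V n \<omega> - b n (Y n \<omega>)" for \<omega>
          have A: "A \<in> L2 P" unfolding A_def by (intro L2_diff VL2 bL2 nN)
          \<comment> \<open>The current position is itself a function of the tested past, so
            centring applies without the coupling.\<close>
          have z1: "(\<integral>p. inner (v p - bb p) (y p) \<partial>R) = 0"
          proof -
            have "(\<lambda>q::'a \<times> 'a. snd q) \<in> borel_measurable borel"
              by (intro borel_measurable_continuous_onI continuous_intros)
            from orth[OF nN this] have z: "(\<integral>\<omega>. inner (A \<omega>) (Y n \<omega>) \<partial>P) = 0"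
              using bL2[OF nN] Yn by (simp add: A_def)
            have "(\<integral>p. inner (A (fst p)) (Y n (fst p)) \<partial>R) = (\<integral>\<omega>. inner (A \<omega>) (Y n \<omega>) \<partial>distr R P fst)"
              by (intro integral_distr[OF fstm, symmetric] borel_measurable_inner Ym L2_measurable[OF A])
            then show ?thesis using z unfolding fstl by (simp add: v_def bb_def y_def A_def)
          qed
          \<comment> \<open>By conditional independence it is enough to test the error with vectors
            constant on the cells of \<open>Y 0\<close>, which are functions of the starting
            point.\<close>
          have z2: "(\<integral>p. inner (v p - bb p) (x p) \<partial>R) = 0"
          proof -
            have "(\<integral>p. inner (A (fst p)) (X t (snd p)) \<partial>R) = 0"
            proof (rule indep[rule_format, OF A XL2[OF tT(1)]])
              fix i and e :: 'a
              define G where "G q = (if cell (fst q) = i then e else 0)" for q :: "'a \<times> 'a"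
              have "fst \<in> measurable (borel :: ('a \<times> 'a) measure) borel"
                by (intro borel_measurable_continuous_onI continuous_intros)
              from measurable_compose[OF this cell(1)]
              have [measurable]: "(\<lambda>q::'a \<times> 'a. cell (fst q)) \<in> measurable borel (count_space UNIV)" .
              have Gm: "G \<in> borel_measurable borel" unfolding G_def by measurable
              have GY: "(\<lambda>\<omega>. G (Y 0 \<omega>, Y n \<omega>)) \<in> borel_measurable P"
                by (rule measurable_compose[OF borel_measurable_Pair[OF Ym Ym] Gm])
              interpret prob_space P by fact
              have "(\<lambda>\<omega>. G (Y 0 \<omega>, Y n \<omega>)) \<in> L2 P"
              proof -
                have "integrable P (\<lambda>\<omega>. (norm (G (Y 0 \<omega>, Y n \<omega>)))\<^sup>2)"
                  using GY by (intro integrable_const_bound[where B = "(norm e)\<^sup>2"]) (auto simp: G_def)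
                then show ?thesis using GY by (simp add: L2_def)
              qed
              from orth[OF nN Gm this bL2[OF nN]]
              show "(\<integral>\<omega>. inner (A \<omega>) (if c \<omega> = i then e else 0) \<partial>P) = 0"
                by (simp add: A_def G_def c_def)
            qed
            then show ?thesis by (simp add: v_def bb_def x_def A_def)
          qed
          have diss: "(\<integral>p. inner (bb p - w p) (y p - x p) \<partial>R) \<le> lam * (L2norm R (\<lambda>p. y p - x p))\<^sup>2"
          proof (rule tdiss_coupling[OF H(1) R])
            show "distr R borel (\<lambda>p. (x p, w p)) \<in> H"
              unfolding x_def w_def using XW slaw[of "\<lambda>\<omega>. (X t \<omega>, W \<omega>)"] L2_measurable[OF XL2[OF tT(1)]] L2_measurable[OF WL2]
              by simp
            show "distr R borel (\<lambda>p. (y p, bb p)) \<in> H"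
              unfolding y_def bb_def using bar[of n] nN flaw[of "\<lambda>\<omega>. (Y n \<omega>, b n (Y n \<omega>))"] L2_measurable[OF Yn] L2_measurable[OF bL2[OF nN]]
              by simp
          qed (use L2s in \<open>auto dest: L2_measurable\<close>)
          \<comment> \<open>The time elapsed since the last node: \<open>D1 t\<close> differs from
            the distance \<open>y - x\<close> at the node by \<delta> times the velocity.\<close>
          define \<delta> where "\<delta> = t - real n * \<tau>"
          have \<delta>: "0 \<le> \<delta>" "\<delta> \<le> \<tau>" using n1 n2 by (auto simp: \<delta>_def distrib_right)
          have D1eq: "D1 t p = (y p - x p) + \<delta> *\<^sub>R v p" for p
            using \<zeta>n[of t "fst p"] n2 tT by (simp add: D1_def y_def x_def v_def \<delta>_def)
          have v_norm: "L2norm R v \<le> L" using fL2(2)[OF VL2[OF nN]] VL[OF nN] by (simp add: v_def[abs_def])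
          have V1_norm: "L2norm R V1 \<le> L + C"
          proof -
            have "L2norm R V1 \<le> L2norm R v + L2norm R w"
              using L2norm_diff_triangle[OF L2s(2,5)] by (simp add: V1_def[abs_def] v_def w_def)
            then show ?thesis using v_norm WC sL2(2)[OF WL2] by (simp add: w_def[abs_def])
          qed
          have yx: "(\<lambda>p. y p - x p) \<in> L2 R" by (intro L2_diff L2s)
          have ints: "integrable R (\<lambda>p. inner (v p - bb p) (y p))" "integrable R (\<lambda>p. inner (v p - bb p) (x p))"
            "integrable R (\<lambda>p. inner (bb p - w p) (y p - x p))" "integrable R (\<lambda>p. inner (V1 p) (v p))"
            by (intro L2_integrable_inner L2_diff L2s V1)+
          \<comment> \<open>Split \<open>V1\<close> at the barycenter and \<open>D1 t\<close> at the
            node: two terms vanish by \<open>z1\<close> and \<open>z2\<close>, one is dissipative,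
            and the last is of the order of the step size.\<close>
          have "(\<integral>p. inner (V1 p) (D1 t p) \<partial>R) = (\<integral>p. inner (v p - bb p) (y p) - inner (v p - bb p) (x p)
              + inner (bb p - w p) (y p - x p) + \<delta> * inner (V1 p) (v p) \<partial>R)"
            by (intro Bochner_Integration.integral_cong refl)
              (simp add: D1eq V1_def v_def[symmetric] w_def[symmetric] inner_add_right inner_diff_left inner_diff_right algebra_simps)
          also have "\<dots> = (\<integral>p. inner (bb p - w p) (y p - x p) \<partial>R) + \<delta> * (\<integral>p. inner (V1 p) (v p) \<partial>R)"
            using ints z1 z2 by simp
          also have "\<dots> \<le> lam * (L2norm R (\<lambda>p. y p - x p))\<^sup>2 + \<tau> * ((L + C) * L)"
          proof (rule add_mono[OF diss])
            have "(\<integral>p. inner (V1 p) (v p) \<partial>R) \<le> L2norm R V1 * L2norm R v"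
              using L2_Cauchy_Schwarz[OF V1 L2s(2)] by simp
            also have "\<dots> \<le> (L + C) * L"
              using V1_norm v_norm \<open>0 \<le> L\<close> \<open>0 \<le> C\<close> by (intro mult_mono) auto
            finally have "\<delta> * (\<integral>p. inner (V1 p) (v p) \<partial>R) \<le> \<delta> * ((L + C) * L)"
              using \<delta> by (intro mult_left_mono) auto
            also have "\<dots> \<le> \<tau> * ((L + C) * L)"
              using \<delta> \<open>0 \<le> L\<close> \<open>0 \<le> C\<close> by (intro mult_right_mono) auto
            finally show "\<delta> * (\<integral>p. inner (V1 p) (v p) \<partial>R) \<le> \<tau> * ((L + C) * L)" .
          qed
          \<comment> \<open>Returning from the distance at the node to \<open>D1 t\<close> needs an
            upper bound for the squared norm, so \<open>lam\<close> is replaced by its absolute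
            value.\<close>
          also have "lam * (L2norm R (\<lambda>p. y p - x p))\<^sup>2 \<le> \<bar>lam\<bar> * (2 * (L2norm R (D1 t))\<^sup>2 + 2 * (\<tau> * L)\<^sup>2)"
          proof -
            have dv: "(\<lambda>p. \<delta> *\<^sub>R v p) \<in> L2 R" by (intro L2_scaleR L2s)
            have "L2norm R (\<lambda>p. \<delta> *\<^sub>R v p) \<le> \<tau> * L"
              using \<delta> v_norm \<open>0 \<le> L\<close> by (simp add: L2norm_scaleR mult_mono)
            moreover have "L2norm R (\<lambda>p. y p - x p) \<le> L2norm R (D1 t) + L2norm R (\<lambda>p. \<delta> *\<^sub>R v p)"
              using L2norm_diff_triangle[OF D1L2[OF tT(1)] dv] by (simp add: D1eq)
            ultimately have "(L2norm R (\<lambda>p. y p - x p))\<^sup>2 \<le> (L2norm R (D1 t) + \<tau> * L)\<^sup>2"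
              by (intro power_mono) auto
            also have "\<dots> \<le> 2 * (L2norm R (D1 t))\<^sup>2 + 2 * (\<tau> * L)\<^sup>2"
              using sum_squares_bound[of "L2norm R (D1 t)" "\<tau> * L"] by (simp add: power2_sum)
            finally have "\<bar>lam\<bar> * (L2norm R (\<lambda>p. y p - x p))\<^sup>2 \<le> \<bar>lam\<bar> * (2 * (L2norm R (D1 t))\<^sup>2 + 2 * (\<tau> * L)\<^sup>2)"
              by (rule mult_left_mono) simp
            moreover have "lam * (L2norm R (\<lambda>p. y p - x p))\<^sup>2 \<le> \<bar>lam\<bar> * (L2norm R (\<lambda>p. y p - x p))\<^sup>2"
              by (intro mult_right_mono) auto
            ultimately show ?thesis by linarith
          qed
          finally have "(\<integral>p. inner (V1 p) (D1 t p) \<partial>R) \<le> 2 * \<bar>lam\<bar> * (L2norm R (D1 t))\<^sup>2 + \<beta>"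
            by (simp add: \<beta>_def power_mult_distrib algebra_simps)
          with V1 lim show "\<exists>V\<in>L2 R.
              ((\<lambda>s. L2dist R (\<lambda>p. (1 / (s - t)) *\<^sub>R (D1 s p - D1 t p)) V) \<longlongrightarrow> 0) (at_right t)
              \<and> (\<integral>p. inner (V p) (D1 t p) \<partial>R) \<le> 2 * \<bar>lam\<bar> * (L2norm R (D1 t))\<^sup>2 + \<beta>"
            by blast
        qed
      qed
    qed (use t \<open>0 \<le> \<beta>\<close> in auto)
    \<comment> \<open>Two copies of the same solution: both pairs of position and velocity have a
      law in \<open>H\<close>, so dissipativity applies directly and leaves no error term.\<close>
    have D2t: "(L2norm R (D2 t))\<^sup>2 \<le> exp (2 * \<bar>lam\<bar> * t) * ((L2norm R (D2 0))\<^sup>2 + 2 * 0 * t)"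
    proof (rule L2_curve_Gronwall[where C = "2 * C" and T = T])
      show D2L2: "D2 s \<in> L2 R" if "s \<in> {0..T}" for s
        unfolding D2_def using that by (intro L2_diff fL2 sL2 XL2)
      show "L2dist R (D2 s) (D2 r) \<le> (2 * C) * \<bar>s - r\<bar>" if "s \<in> {0..T}" "r \<in> {0..T}" for s r
      proof -
        have 1: "(\<lambda>\<omega>. X s \<omega> - X r \<omega>) \<in> L2 P" using that by (intro L2_diff XL2)
        have "L2dist R (D2 s) (D2 r) = L2norm R (\<lambda>p. (X s (fst p) - X r (fst p)) - (X s (snd p) - X r (snd p)))"
          unfolding L2dist_eq_L2norm D2_def by (simp add: algebra_simps)
        also have "\<dots> \<le> L2norm P (\<lambda>\<omega>. X s \<omega> - X r \<omega>) + L2norm P (\<lambda>\<omega>. X s \<omega> - X r \<omega>)"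
          using L2norm_diff_triangle[OF fL2(1)[OF 1] sL2(1)[OF 1]] fL2(2)[OF 1] sL2(2)[OF 1] by simp
        also have "\<dots> \<le> 2 * (C * \<bar>s - r\<bar>)"
          using lipX[OF that] by (simp add: L2dist_eq_L2norm)
        finally show ?thesis by simp
      qed
      show "AE t in lborel. t \<in> {0<..<T} \<longrightarrow> (\<exists>V\<in>L2 R.
          ((\<lambda>s. L2dist R (\<lambda>p. (1 / (s - t)) *\<^sub>R (D2 s p - D2 t p)) V) \<longlongrightarrow> 0) (at_right t)
          \<and> (\<integral>p. inner (V p) (D2 t p) \<partial>R) \<le> \<bar>lam\<bar> * (L2norm R (D2 t))\<^sup>2 + 0)"
        using derX
      proof eventually_elim
        case (elim t)
        show ?case
        proof
          assume t0: "t \<in> {0<..<T}"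
          then have tT: "t \<in> {0..T}" by auto
          obtain W where W: "(X t, W) \<in> lagr_op P H"
            "((\<lambda>s. L2dist P (\<lambda>\<omega>. (1 / (s - t)) *\<^sub>R (X s \<omega> - X t \<omega>)) W) \<longlongrightarrow> 0) (at t within {0..T})"
            using elim t0 by blast
          have WL2: "W \<in> L2 P" and XW: "distr P borel (\<lambda>\<omega>. (X t \<omega>, W \<omega>)) \<in> H"
            using W(1) by (auto simp: lagr_op_def)
          note Wlim = right[OF W(2) t0]
          define V2 where "V2 p = W (fst p) - W (snd p)" for p
          have V2: "V2 \<in> L2 R" unfolding V2_def by (intro L2_diff fL2 sL2 WL2)
          have lim: "((\<lambda>s. L2dist R (\<lambda>p. (1 / (s - t)) *\<^sub>R (D2 s p - D2 t p)) V2) \<longlongrightarrow> 0) (at_right t)"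
          proof (rule tendsto_sandwich[OF _ _ tendsto_const])
            show "((\<lambda>s. 2 * L2dist P (\<lambda>\<omega>. (1 / (s - t)) *\<^sub>R (X s \<omega> - X t \<omega>)) W) \<longlongrightarrow> 0) (at_right t)"
              using tendsto_mult_left[OF Wlim, of 2] by simp
            show "\<forall>\<^sub>F s in at_right t. 0 \<le> L2dist R (\<lambda>p. (1 / (s - t)) *\<^sub>R (D2 s p - D2 t p)) V2"
              by (simp add: L2dist_eq_L2norm)
            have "\<forall>\<^sub>F s in at_right t. s \<in> {t<..<T}"
              using t0 by (intro eventually_at_right_real) auto
            then show "\<forall>\<^sub>F s in at_right t. L2dist R (\<lambda>p. (1 / (s - t)) *\<^sub>R (D2 s p - D2 t p)) V2
              \<le> 2 * L2dist P (\<lambda>\<omega>. (1 / (s - t)) *\<^sub>R (X s \<omega> - X t \<omega>)) W"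
            proof eventually_elim
              case (elim s)
              define Q where "Q \<omega> = (1 / (s - t)) *\<^sub>R (X s \<omega> - X t \<omega>) - W \<omega>" for \<omega>
              have Q: "Q \<in> L2 P"
                unfolding Q_def using elim tT by (intro L2_diff L2_scaleR XL2 WL2) auto
              have "L2dist R (\<lambda>p. (1 / (s - t)) *\<^sub>R (D2 s p - D2 t p)) V2 = L2norm R (\<lambda>p. Q (fst p) - Q (snd p))"
                unfolding L2dist_eq_L2norm
                by (rule arg_cong[where f = "L2norm R"])
                  (simp add: fun_eq_iff Q_def D2_def V2_def algebra_simps)
              also have "\<dots> \<le> 2 * L2norm P Q"
                using L2norm_diff_triangle[OF fL2(1)[OF Q] sL2(1)[OF Q]] fL2(2)[OF Q] sL2(2)[OF Q] by simp
              finally show ?case by (simp add: L2dist_eq_L2norm Q_def[abs_def])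
            qed
          qed
          have XWm: "(\<lambda>\<omega>. (X t \<omega>, W \<omega>)) \<in> measurable P borel"
            using L2_measurable[OF XL2[OF tT]] L2_measurable[OF WL2] by measurable
          have "(\<integral>p. inner (V2 p) (D2 t p) \<partial>R) \<le> lam * (L2norm R (D2 t))\<^sup>2"
            unfolding V2_def D2_def
            by (rule tdiss_coupling[OF H(1) R])
              (use fL2(1)[OF XL2[OF tT]] sL2(1)[OF XL2[OF tT]] fL2(1)[OF WL2] sL2(1)[OF WL2] XW flaw[OF XWm] slaw[OF XWm]
                in \<open>auto dest: L2_measurable\<close>)
          also have "\<dots> \<le> \<bar>lam\<bar> * (L2norm R (D2 t))\<^sup>2 + 0" by (simp add: mult_right_mono)
          finally show "\<exists>V\<in>L2 R.
              ((\<lambda>s. L2dist R (\<lambda>p. (1 / (s - t)) *\<^sub>R (D2 s p - D2 t p)) V) \<longlongrightarrow> 0) (at_right t)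
              \<and> (\<integral>p. inner (V p) (D2 t p) \<partial>R) \<le> \<bar>lam\<bar> * (L2norm R (D2 t))\<^sup>2 + 0"
            using V2 lim by blast
        qed
      qed
    qed (use t in auto)
    have e: "exp (2 * (2 * \<bar>lam\<bar>) * t) \<le> E" "exp (2 * \<bar>lam\<bar> * t) \<le> E"
    proof -
      have "t * \<bar>lam\<bar> \<le> T * \<bar>lam\<bar>" "0 \<le> T * \<bar>lam\<bar>" using t T by (auto intro: mult_right_mono)
      then have "2 * (2 * \<bar>lam\<bar>) * t \<le> 4 * \<bar>lam\<bar> * T" "2 * \<bar>lam\<bar> * t \<le> 4 * \<bar>lam\<bar> * T"
        by (simp_all add: mult_ac)
      then show "exp (2 * (2 * \<bar>lam\<bar>) * t) \<le> E" "exp (2 * \<bar>lam\<bar> * t) \<le> E"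
        unfolding E_def exp_le_cancel_iff .
    qed
    have 1: "(L2norm R (D1 t))\<^sup>2 \<le> E * ((\<epsilon> + r)\<^sup>2 + 2 * \<beta> * T)"
    proof -
      have "(L2norm R (D1 0))\<^sup>2 + 2 * \<beta> * t \<le> (\<epsilon> + r)\<^sup>2 + 2 * \<beta> * T"
        using D1_0 t \<open>0 \<le> \<beta>\<close> by (intro add_mono power_mono mult_left_mono) auto
      then have "exp (2 * (2 * \<bar>lam\<bar>) * t) * ((L2norm R (D1 0))\<^sup>2 + 2 * \<beta> * t) \<le> E * ((\<epsilon> + r)\<^sup>2 + 2 * \<beta> * T)"
        using e t \<open>0 \<le> \<beta>\<close> by (intro mult_mono) (auto simp: E_def)
      with D1t show ?thesis by linarith
    qed
    have 2: "(L2norm R (D2 t))\<^sup>2 \<le> E * (\<epsilon> + 2 * r)\<^sup>2"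
    proof -
      have "(L2norm R (D2 0))\<^sup>2 \<le> (\<epsilon> + 2 * r)\<^sup>2" using D2_0 by (intro power_mono) auto
      then have "exp (2 * \<bar>lam\<bar> * t) * (L2norm R (D2 0))\<^sup>2 \<le> E * (\<epsilon> + 2 * r)\<^sup>2"
        using e by (intro mult_mono) (auto simp: E_def)
      with D2t show ?thesis by simp
    qed
    have D12: "D1 t \<in> L2 R" "D2 t \<in> L2 R"
      unfolding D1_def D2_def using t by (intro L2_diff fL2 sL2 \<zeta>L2 XL2; simp)+
    have "L2norm P (\<lambda>\<omega>. \<zeta> t \<omega> - X t \<omega>) = L2norm R (\<lambda>p. D1 t p - D2 t p)"
      using fL2(2)[OF L2_diff[OF \<zeta>L2[OF t] XL2[OF t]]] by (simp add: D1_def D2_def)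
    also have "\<dots> \<le> L2norm R (D1 t) + L2norm R (D2 t)" by (rule L2norm_diff_triangle[OF D12])
    finally have "(L2norm P (\<lambda>\<omega>. \<zeta> t \<omega> - X t \<omega>))\<^sup>2 \<le> (L2norm R (D1 t) + L2norm R (D2 t))\<^sup>2"
      by (intro power_mono) auto
    also have "\<dots> \<le> 2 * (L2norm R (D1 t))\<^sup>2 + 2 * (L2norm R (D2 t))\<^sup>2"
      using sum_squares_bound[of "L2norm R (D1 t)" "L2norm R (D2 t)"] by (simp add: power2_sum)
    finally show ?thesis using 1 2 by linarith
  qed
  \<comment> \<open>The cell width now tends to zero with the Euler process and its step size
    fixed.\<close>
  have "(L2norm P (\<lambda>\<omega>. \<zeta> t \<omega> - X t \<omega>))\<^sup>2 \<le> 2 * (E * ((0 + r)\<^sup>2 + 2 * \<beta> * T)) + 2 * (E * (0 + 2 * r)\<^sup>2)"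
  proof (rule tendsto_lowerbound[OF _ _ trivial_limit_at_right_real])
    show "((\<lambda>\<epsilon>. 2 * (E * ((\<epsilon> + r)\<^sup>2 + 2 * \<beta> * T)) + 2 * (E * (\<epsilon> + 2 * r)\<^sup>2))
      \<longlongrightarrow> 2 * (E * ((0 + r)\<^sup>2 + 2 * \<beta> * T)) + 2 * (E * (0 + 2 * r)\<^sup>2)) (at_right 0)"
      by (intro tendsto_intros)
    show "\<forall>\<^sub>F \<epsilon> in at_right 0. (L2norm P (\<lambda>\<omega>. \<zeta> t \<omega> - X t \<omega>))\<^sup>2
      \<le> 2 * (E * ((\<epsilon> + r)\<^sup>2 + 2 * \<beta> * T)) + 2 * (E * (\<epsilon> + 2 * r)\<^sup>2)"
      using main by (auto simp: eventually_at_filter)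
  qed
  also have "\<dots> = E * (10 * r\<^sup>2 + 4 * \<beta> * T)"
    by (simp add: power_mult_distrib distrib_left)
  finally show "(L2norm P (\<lambda>\<omega>. \<zeta> t \<omega> - X t \<omega>))\<^sup>2 \<le> exp (4 * \<bar>lam\<bar> * T) * (10 * (L2norm P (\<lambda>\<omega>. Y 0 \<omega> - X 0 \<omega>))\<^sup>2
      + 4 * (2 * \<bar>lam\<bar> * \<tau>\<^sup>2 * L\<^sup>2 + \<tau> * ((L + C) * L)) * T)"
    unfolding E_def r_def \<beta>_def .
qed

end

section \<open>Wasserstein convergence and almost sure convergence\<close>

text \<open>On any coupling the triangle inequality bounds the difference of the two norms by the
  root of the cost. The maximum with 0 allows this difference to be squared before the infimum is
  taken.\<close>

lemma L2norm_le_W2: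
  fixes X Y :: "'b \<Rightarrow> 'a::{real_inner,second_countable_topology}"
  assumes P: "prob_space P" and X: "X \<in> L2 P" and Y: "Y \<in> L2 P"
  shows "L2norm P X \<le> L2norm P Y + W2 (distr P borel X) (distr P borel Y)" and "0 \<le> W2 (distr P borel X) (distr P borel Y)"
proof -
  define S where "S = {(\<integral>p. (norm (fst p - snd p))\<^sup>2 \<partial>\<gamma>) | \<gamma>. \<gamma> \<in> Gamma (distr P borel X) (distr P borel Y)}"
  note [measurable] = L2_measurable[OF X] L2_measurable[OF Y]
  have fst_meas: "(fst :: 'a \<times> 'a \<Rightarrow> 'a) \<in> measurable borel borel"
    and snd_meas: "(snd :: 'a \<times> 'a \<Rightarrow> 'a) \<in> measurable borel borel"
    by (intro borel_measurable_continuous_onI continuous_intros)+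
  have J: "(\<lambda>\<omega>. (X \<omega>, Y \<omega>)) \<in> measurable P borel" by measurable
  have "distr P borel (\<lambda>\<omega>. (X \<omega>, Y \<omega>)) \<in> Gamma (distr P borel X) (distr P borel Y)"
    unfolding Gamma_def using fst_meas snd_meas
    by (auto simp: prob_space.prob_space_distr[OF P J] distr_distr[OF _ J] comp_def)
  then have "S \<noteq> {}" unfolding S_def by blast
  have low: "(max 0 (L2norm P X - L2norm P Y))\<^sup>2 \<le> Inf S"
  proof (rule cInf_greatest[OF \<open>S \<noteq> {}\<close>])
    fix c assume "c \<in> S"
    then obtain \<gamma> where \<gamma>: "sets \<gamma> = sets borel" "distr \<gamma> borel fst = distr P borel X" "distr \<gamma> borel snd = distr P borel Y"
      and c: "c = (L2norm \<gamma> (\<lambda>p. fst p - snd p))\<^sup>2"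
      by (auto simp: S_def Gamma_def L2norm_power2)
    have m: "fst \<in> measurable \<gamma> borel" "snd \<in> measurable \<gamma> borel"
      using fst_meas snd_meas by (auto simp: measurable_cong_sets[OF \<gamma>(1) refl])
    have id: "(\<lambda>x::'a. x) \<in> borel_measurable borel" by simp
    have f: "fst \<in> L2 \<gamma>" "L2norm \<gamma> fst = L2norm P X"
      using L2_distr_iff[OF m(1) id] L2norm_distr[OF m(1) id] L2_distr_iff[OF L2_measurable[OF X] id]
        L2norm_distr[OF L2_measurable[OF X] id] X unfolding \<gamma>(2) by simp_all
    have s: "snd \<in> L2 \<gamma>" "L2norm \<gamma> snd = L2norm P Y"
      using L2_distr_iff[OF m(2) id] L2norm_distr[OF m(2) id] L2_distr_iff[OF L2_measurable[OF Y] id]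
        L2norm_distr[OF L2_measurable[OF Y] id] Y unfolding \<gamma>(3) by simp_all
    have "L2norm \<gamma> fst \<le> L2norm \<gamma> (\<lambda>p. fst p - snd p) + L2norm \<gamma> snd"
      using L2norm_triangle[OF L2_diff[OF f(1) s(1)] s(1)] by simp
    then show "(max 0 (L2norm P X - L2norm P Y))\<^sup>2 \<le> c"
      unfolding c f(2) s(2) by (intro power_mono) auto
  qed
  then have "sqrt ((max 0 (L2norm P X - L2norm P Y))\<^sup>2) \<le> W2 (distr P borel X) (distr P borel Y)"
    unfolding W2_def S_def[symmetric] by (rule real_sqrt_le_mono)
  then show "L2norm P X \<le> L2norm P Y + W2 (distr P borel X) (distr P borel Y)" "0 \<le> W2 (distr P borel X) (distr P borel Y)"
    by simp_all
qed

text \<open>By the parallelogram identity it suffices to bound \<open>\<parallel>X\<^sub>h + X\<parallel>\<close> from below, which is Fatou's lemma.\<close>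

lemma AE_W2_tendsto_imp_L2_tendsto:
  fixes X :: "nat \<Rightarrow> 'b \<Rightarrow> 'a::{real_inner,second_countable_topology}"
  assumes P: "prob_space P" and X: "\<And>h. X h \<in> L2 P" and Y: "Y \<in> L2 P"
    and AE: "AE \<omega> in P. (\<lambda>h. X h \<omega>) \<longlonglongrightarrow> Y \<omega>"
    and W: "(\<lambda>h. W2 (distr P borel (X h)) (distr P borel Y)) \<longlonglongrightarrow> 0"
  shows "(\<lambda>h. L2norm P (\<lambda>\<omega>. X h \<omega> - Y \<omega>)) \<longlonglongrightarrow> 0"
proof -
  define w where "w h = W2 (distr P borel (X h)) (distr P borel Y)" for h
  define B where "B = L2norm P Y"
  define a where "a h = (L2norm P (\<lambda>\<omega>. X h \<omega> + Y \<omega>))\<^sup>2" for h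
  define u where "u h = (L2norm P (\<lambda>\<omega>. X h \<omega> - Y \<omega>))\<^sup>2" for h
  note [measurable] = L2_measurable[OF X] L2_measurable[OF Y]
  have w0: "0 \<le> w h" for h unfolding w_def by (rule L2norm_le_W2(2)[OF P X Y])
  \<comment> \<open>The parallelogram identity, with the norm of \<open>X h\<close> replaced by its
    bound through the Wasserstein distance.\<close>
  have upper: "u h \<le> 4 * B * w h + 2 * (w h)\<^sup>2 + (4 * B\<^sup>2 - a h)" for h
  proof -
    have "u h = 2 * (L2norm P (X h))\<^sup>2 + 2 * B\<^sup>2 - a h"
      using L2norm_add_power2[OF X[of h] Y] L2norm_add_power2[OF X[of h] L2_scaleR[OF Y, of "-1"]]
        L2norm_scaleR[of P "-1" Y]
      by (simp add: u_def a_def B_def)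
    moreover have "(L2norm P (X h))\<^sup>2 \<le> (B + w h)\<^sup>2"
      using L2norm_le_W2(1)[OF P X[of h] Y] by (intro power_mono) (auto simp: B_def w_def)
    ultimately show ?thesis by (simp add: power2_sum algebra_simps)
  qed
  have nn: "(\<integral>\<^sup>+\<omega>. ennreal ((norm (f \<omega>))\<^sup>2) \<partial>P) = ennreal ((L2norm P f)\<^sup>2)" if "f \<in> L2 P" for f :: "'b \<Rightarrow> 'a"
    unfolding L2norm_power2 by (rule nn_integral_eq_integral[OF L2_integrable_power2[OF that]]) simp
  have fatou: "ennreal (4 * B\<^sup>2) \<le> liminf (\<lambda>h. ennreal (a h))"
  proof -
    have "ennreal (4 * B\<^sup>2) = (\<integral>\<^sup>+\<omega>. ennreal ((norm (2 *\<^sub>R Y \<omega>))\<^sup>2) \<partial>P)"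
      unfolding nn[OF L2_scaleR[OF Y]] by (simp add: L2norm_scaleR B_def power_mult_distrib)
    also have "\<dots> = (\<integral>\<^sup>+\<omega>. liminf (\<lambda>h. ennreal ((norm (X h \<omega> + Y \<omega>))\<^sup>2)) \<partial>P)"
    proof (rule nn_integral_cong_AE)
      show "AE \<omega> in P. ennreal ((norm (2 *\<^sub>R Y \<omega>))\<^sup>2) = liminf (\<lambda>h. ennreal ((norm (X h \<omega> + Y \<omega>))\<^sup>2))"
        using AE
      proof eventually_elim
        case (elim \<omega>)
        have "(\<lambda>h. ennreal ((norm (X h \<omega> + Y \<omega>))\<^sup>2)) \<longlonglongrightarrow> ennreal ((norm (Y \<omega> + Y \<omega>))\<^sup>2)"
          by (intro tendsto_ennrealI tendsto_power tendsto_norm tendsto_add elim tendsto_const)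
        from lim_imp_Liminf[OF _ this] show ?case by (simp add: scaleR_2)
      qed
    qed
    also have "\<dots> \<le> liminf (\<lambda>h. \<integral>\<^sup>+\<omega>. ennreal ((norm (X h \<omega> + Y \<omega>))\<^sup>2) \<partial>P)"
      by (rule nn_integral_liminf) measurable
    also have "\<dots> = liminf (\<lambda>h. ennreal (a h))"
      unfolding nn[OF L2_add[OF X Y]] a_def ..
    finally show ?thesis .
  qed
  have "u \<longlonglongrightarrow> 0"
  proof (rule order_tendstoI)
    fix e :: real assume "0 < e"
    have "\<forall>\<^sub>F h in sequentially. 4 * B\<^sup>2 - e / 2 < a h"
    \<comment> \<open>\<open>ennreal\<close> sends negative numbers to 0, so the comparison by
      Fatou's lemma is made only for a nonnegative threshold; a negative one is trivially
      exceeded.\<close>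
    proof (cases "4 * B\<^sup>2 - e / 2 < 0")
      case True
      have "4 * B\<^sup>2 - e / 2 < a h" for h
        using True by (rule less_le_trans) (simp add: a_def)
      then show ?thesis by simp
    next
      case False
      then have "ennreal (4 * B\<^sup>2 - e / 2) < ennreal (4 * B\<^sup>2)" using \<open>0 < e\<close> by (intro ennreal_lessI) auto
      also note fatou
      finally have "\<forall>\<^sub>F h in sequentially. ennreal (4 * B\<^sup>2 - e / 2) < ennreal (a h)"
        by (rule less_LiminfD)
      then show ?thesis using False by (auto simp: ennreal_less_iff)
    qed
    moreover have "(\<lambda>h. 4 * B * w h + 2 * (w h)\<^sup>2) \<longlonglongrightarrow> 4 * B * 0 + 2 * 0\<^sup>2"
      using W unfolding w_def[symmetric] by (intro tendsto_intros)
    then have "\<forall>\<^sub>F h in sequentially. 4 * B * w h + 2 * (w h)\<^sup>2 < e / 2"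
      by (rule order_tendstoD) (use \<open>0 < e\<close> in simp)
    ultimately show "\<forall>\<^sub>F h in sequentially. u h < e"
    proof eventually_elim
      case (elim h)
      then show ?case using upper[of h] by linarith
    qed
  next
    fix e :: real assume "e < 0"
    then show "\<forall>\<^sub>F h in sequentially. e < u h"
      by (intro always_eventually allI) (simp add: u_def less_le_trans[OF _ zero_le_power2])
  qed
  from tendsto_real_sqrt[OF this] show ?thesis by (simp add: u_def)
qed

section \<open>Convergence of the Euler scheme\<close>

theorem theorem5p10:
  fixes F :: "('a::{real_inner,complete_space,second_countable_topology} \<times> 'a) measure set"
    and lam T L :: real
    and \<mu> :: "'a measure" and \<mu>h :: "nat \<Rightarrow> 'a measure"
    and \<tau> :: "nat \<Rightarrow> real"
    and Mh :: "nat \<Rightarrow> real \<Rightarrow> 'a measure"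
    and Fh :: "nat \<Rightarrow> real \<Rightarrow> ('a \<times> 'a) measure"
    and \<eta>h :: "nat \<Rightarrow> (real \<Rightarrow> 'a) measure"
    and Fhat :: "('a \<times> 'a) measure set"
    and P :: "'b::polish_space measure"
    and Xb :: "'b \<Rightarrow> 'a" and Xbh :: "nat \<Rightarrow> 'b \<Rightarrow> 'a"
    and Z :: "nat \<Rightarrow> 'b \<Rightarrow> real \<Rightarrow> 'a"
    and Xs :: "'b \<Rightarrow> real \<Rightarrow> 'a"
  assumes F: "is_MPVF F"
    and barF_diss: "tdiss lam (barF F)"
    and mu: "\<mu> \<in> dom_F F" and muh: "\<And>h. \<mu>h h \<in> dom_F F"
    and muh_conv: "(\<lambda>h. W2 (\<mu>h h) \<mu>) \<longlonglongrightarrow> 0"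
    and tau_pos: "\<And>h. \<tau> h > 0" and tau_conv: "\<tau> \<longlonglongrightarrow> 0"
    and T: "T > 0" and L: "L > 0"
    and sol: "\<And>h. (Mh h, Fh h, \<eta>h h) \<in> Tsol F (\<mu>h h) (\<tau> h) T L"
    and Fhat: "barF F \<subseteq> Fhat" "max_tdiss lam Fhat"
    and solvable: "approx_solvable F \<mu> T"
    and P: "prob_space P" "sets P = sets borel" "atomless P"
    and Xb: "Xb \<in> L2 P" "distr P borel Xb = \<mu>"
    and Xbh: "\<And>h. Xbh h \<in> L2 P" "\<And>h. distr P borel (Xbh h) = \<mu>h h"
    and Z: "\<And>h. Z h \<in> L2C P T" "\<And>h. distr P (pathM T) (Z h) = \<eta>h h"
    and Xbh_conv: "AE \<omega> in P. (\<lambda>h. Xbh h \<omega>) \<longlonglongrightarrow> Xb \<omega>"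
    and Z0: "\<And>h. AE \<omega> in P. Z h \<omega> 0 = Xbh h \<omega>"
    and Xs: "lagr_solution P Fhat T Xb Xs"
  shows "(\<lambda>h. L2C_dist2 P T (Z h) Xs) \<longlonglongrightarrow> 0"
proof -
  have Fhat': "tdiss lam Fhat" "Fhat \<subseteq> P2"
    using Fhat(2) by (auto simp: max_tdiss_def is_MPVF_def)
  obtain X where X: "lagr_curve P Fhat T Xb X" and XsX: "\<And>t. t \<in> {0..T} \<Longrightarrow> AE \<omega> in P. Xs \<omega> t = X t \<omega>"
    and Xs_meas: "Xs \<in> measurable P (pathM T)" and Xs_cont: "\<And>\<omega>. continuous_on {0..T} (Xs \<omega>)"
    using Xs unfolding lagr_solution_def by blast
  obtain C where lipX: "\<And>s t. s \<in> {0..T} \<Longrightarrow> t \<in> {0..T} \<Longrightarrow> L2dist P (X s) (X t) \<le> C * \<bar>s - t\<bar>"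
    and XL2: "\<And>t. t \<in> {0..T} \<Longrightarrow> X t \<in> L2 P" and X0: "AE \<omega> in P. X 0 \<omega> = Xb \<omega>"
    and derX: "AE t in lborel. t \<in> {0<..<T} \<longrightarrow> (\<exists>W. (X t, W) \<in> lagr_op P Fhat \<and>
      ((\<lambda>s. L2dist P (\<lambda>\<omega>. (1 / (s - t)) *\<^sub>R (X s \<omega> - X t \<omega>)) W) \<longlongrightarrow> 0) (at t within {0..T}))"
    using X unfolding lagr_curve_def by blast
  have T0: "0 \<in> {0..T}" using T by simp
  have "0 \<le> C * \<bar>0 - T\<bar>"
    using order_trans[OF L2norm_nonneg lipX[of 0 T, unfolded L2dist_eq_L2norm]] T by simp
  then have "0 \<le> C" using T by (simp add: zero_le_mult_iff)
  \<comment> \<open>The initial distance in mean square; \<kappa> is the resulting bound on the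
    squared error, the same for all times in \<open>{0..T}\<close>.\<close>
  define r where "r h = L2norm P (\<lambda>\<omega>. Xbh h \<omega> - Xb \<omega>)" for h
  define \<kappa> where "\<kappa> h = exp (4 * \<bar>lam\<bar> * T) * (10 * (r h)\<^sup>2
      + 4 * (2 * \<bar>lam\<bar> * (\<tau> h)\<^sup>2 * L\<^sup>2 + \<tau> h * ((L + C) * L)) * T)" for h
  \<comment> \<open>Almost sure convergence excludes oscillation and Wasserstein convergence
    excludes a loss of second moment at infinity; together they give convergence in mean
    square.\<close>
  have "r \<longlonglongrightarrow> 0"
    unfolding r_def using muh_conv
    by (intro AE_W2_tendsto_imp_L2_tendsto P(1) Xb(1) Xbh(1) Xbh_conv) (simp add: Xb(2) Xbh(2))
  then have "\<kappa> \<longlonglongrightarrow> exp (4 * \<bar>lam\<bar> * T) * (10 * 0\<^sup>2 + 4 * (2 * \<bar>lam\<bar> * 0\<^sup>2 * L\<^sup>2 + 0 * ((L + C) * L)) * T)"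
    unfolding \<kappa>_def using tau_conv by (intro tendsto_intros)
  then have \<kappa>: "\<kappa> \<longlonglongrightarrow> 0" by simp
  have Xs_t: "(\<lambda>\<omega>. Xs \<omega> t) \<in> borel_measurable P" if "t \<in> {0..T}" for t
    using measurable_compose[OF Xs_meas measurable_component_singleton[OF that]] .
  \<comment> \<open>The level \<open>m\<close> is free: the first term counts the
    \<open>2 ^ m + 1\<close> grid points, the second pays for the oscillation between them.\<close>
  have bound: "L2C_dist2 P T (Z h) Xs \<le> ennreal (2 * ((2 ^ m + 1) * \<kappa> h) + 2 * T\<^sup>2 * (L + C)\<^sup>2 / 2 ^ m)" for h m
  proof -
    have \<tau>: "0 < \<tau> h" by (rule tau_pos)
    have Zm: "Z h \<in> measurable P (pathM T)" and Zc: "\<And>\<omega>. continuous_on {0..T} (Z h \<omega>)"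
      using Z(1)[of h] by (auto simp: L2C_def)
    have Z_t: "(\<lambda>\<omega>. Z h \<omega> t) \<in> borel_measurable P" if "t \<in> {0..T}" for t
      using measurable_compose[OF Zm measurable_component_singleton[OF that]] .
    obtain M \<Phi> K where stable: "Lstable F (\<mu>h h) (\<tau> h) T L M \<Phi>" and eta: "\<eta>h h = eta (\<tau> h) T \<Phi> K"
      and K: "\<And>n. n < stepN (\<tau> h) T \<Longrightarrow> disint (distr (Tn (\<tau> h) (\<Phi> n)) borel fst) (Tn (\<tau> h) (\<Phi> n)) (K n)"
      using sol[of h] unfolding Tsol_def by blast
    have law: "distr P (pathM T) (Z h) = eta (\<tau> h) T \<Phi> K" using Z(2) eta by simp
    obtain Y b where lift: "Euler_lift P Fhat (\<tau> h) T L Y b"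
      and interp: "\<And>t. t \<in> {0..T} \<Longrightarrow> AE \<omega> in P. Z h \<omega> t = Gmap (\<tau> h) T (\<lambda>n. Y n \<omega>) t"
      and Y0: "\<And>\<omega>. Y 0 \<omega> = Z h \<omega> 0"
      using Euler_lift_exists[OF \<tau> T F Fhat(1) stable K Zm law] by blast
    define \<zeta> where "\<zeta> t \<omega> = Gmap (\<tau> h) T (\<lambda>n. Y n \<omega>) t" for t \<omega>
    have Z\<zeta>: "AE \<omega> in P. Z h \<omega> t = \<zeta> t \<omega>" if "t \<in> {0..T}" for t
      using interp[OF that] unfolding \<zeta>_def .
    note est = Euler_lift.Lagrangian_estimate[where X = X and C = C, OF lift P(1) Fhat' _ _ derX]
    have \<zeta>L2: "\<zeta> t \<in> L2 P" if "t \<in> {0..T}" for t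
      unfolding \<zeta>_def by (rule est(1)) (use XL2 lipX that in auto)
    have \<zeta>_lip: "L2norm P (\<lambda>\<omega>. \<zeta> s \<omega> - \<zeta> t \<omega>) \<le> L * \<bar>s - t\<bar>" if "s \<in> {0..T}" "t \<in> {0..T}" for s t
      unfolding \<zeta>_def by (rule est(2)) (use XL2 lipX that in auto)
    have r: "L2norm P (\<lambda>\<omega>. Y 0 \<omega> - X 0 \<omega>) = r h"
      unfolding r_def
    proof (rule L2norm_cong_AE)
      show "AE \<omega> in P. Y 0 \<omega> - X 0 \<omega> = Xbh h \<omega> - Xb \<omega>"
        using X0 Z0[of h] by eventually_elim (simp add: Y0)
    qed (use Euler_lift.Ym[OF lift] L2_measurable[OF XL2[OF T0]] L2_measurable[OF Xb(1)] L2_measurable[OF Xbh(1)] in auto)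
    \<comment> \<open>The supremum needs the continuous versions \<open>Z h\<close> and
      \<open>Xs\<close>. The estimates are proved for \<zeta> and \<open>X\<close>, which agree with
      them almost surely at each fixed time, and this suffices for all norms below.\<close>
    define D where "D \<omega> t = Z h \<omega> t - Xs \<omega> t" for \<omega> t
    have D_meas: "(\<lambda>\<omega>. D \<omega> t) \<in> borel_measurable P" if "t \<in> {0..T}" for t
      unfolding D_def using Z_t[OF that] Xs_t[OF that] by measurable
    have D_AE: "AE \<omega> in P. \<zeta> t \<omega> - X t \<omega> = D \<omega> t" if "t \<in> {0..T}" for t
      using Z\<zeta>[OF that] XsX[OF that] by eventually_elim (simp add: D_def)
    have \<zeta>X: "(\<lambda>\<omega>. \<zeta> t \<omega> - X t \<omega>) \<in> L2 P" if "t \<in> {0..T}" for t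
      using that by (intro L2_diff \<zeta>L2 XL2)
    have DL2: "(\<lambda>\<omega>. D \<omega> t) \<in> L2 P" if "t \<in> {0..T}" for t
      by (rule L2_cong_AE[OF \<zeta>X[OF that] D_meas[OF that] D_AE[OF that]])
    have D\<kappa>: "(L2norm P (\<lambda>\<omega>. D \<omega> t))\<^sup>2 \<le> \<kappa> h" if "t \<in> {0..T}" for t
    proof -
      have "L2norm P (\<lambda>\<omega>. D \<omega> t) = L2norm P (\<lambda>\<omega>. \<zeta> t \<omega> - X t \<omega>)"
        using L2norm_cong_AE[OF L2_measurable[OF \<zeta>X[OF that]] D_meas[OF that] D_AE[OF that]] by simp
      moreover have "(L2norm P (\<lambda>\<omega>. \<zeta> t \<omega> - X t \<omega>))\<^sup>2 \<le> \<kappa> h"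
        unfolding \<kappa>_def r[symmetric] \<zeta>_def by (rule est(3)) (use XL2 lipX that in auto)
      ultimately show ?thesis by simp
    qed
    have D_lip: "L2norm P (\<lambda>\<omega>. D \<omega> s - D \<omega> t) \<le> (L + C) * \<bar>s - t\<bar>" if "s \<in> {0..T}" "t \<in> {0..T}" for s t
    proof -
      have l: "(\<lambda>\<omega>. \<zeta> s \<omega> - \<zeta> t \<omega>) \<in> L2 P" "(\<lambda>\<omega>. X s \<omega> - X t \<omega>) \<in> L2 P"
        using that by (intro L2_diff \<zeta>L2 XL2; simp)+
      have "L2norm P (\<lambda>\<omega>. D \<omega> s - D \<omega> t) = L2norm P (\<lambda>\<omega>. (\<zeta> s \<omega> - \<zeta> t \<omega>) - (X s \<omega> - X t \<omega>))"
      proof (rule L2norm_cong_AE)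
        show "AE \<omega> in P. D \<omega> s - D \<omega> t = (\<zeta> s \<omega> - \<zeta> t \<omega>) - (X s \<omega> - X t \<omega>)"
          using D_AE[OF that(1)] D_AE[OF that(2)] by eventually_elim (simp add: algebra_simps)
      qed (use D_meas that L2_measurable[OF l(1)] L2_measurable[OF l(2)] in auto)
      also have "\<dots> \<le> L2norm P (\<lambda>\<omega>. \<zeta> s \<omega> - \<zeta> t \<omega>) + L2norm P (\<lambda>\<omega>. X s \<omega> - X t \<omega>)"
        by (rule L2norm_diff_triangle[OF l])
      also have "\<dots> \<le> L * \<bar>s - t\<bar> + C * \<bar>s - t\<bar>"
        using \<zeta>_lip[OF that] lipX[OF that] by (simp add: L2dist_eq_L2norm)
      finally show ?thesis by (simp add: distrib_right)
    qed
    have "L2C_dist2 P T (Z h) Xs = (\<integral>\<^sup>+\<omega>. ennreal ((SUP t\<in>{0..T}. norm (D \<omega> t))\<^sup>2) \<partial>P)"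
      by (simp add: L2C_dist2_def D_def)
    also have "\<dots> \<le> ennreal (2 * (\<Sum>k\<le>2 ^ m. (L2norm P (\<lambda>\<omega>. D \<omega> (dyadic T m k)))\<^sup>2) + 2 * T\<^sup>2 * (L + C)\<^sup>2 / 2 ^ m)"
      using L \<open>0 \<le> C\<close> DL2 D_lip
      by (intro nn_integral_SUP_path_le[OF T]) (auto simp: D_def intro!: continuous_on_diff Zc Xs_cont)
    also have "\<dots> \<le> ennreal (2 * ((2 ^ m + 1) * \<kappa> h) + 2 * T\<^sup>2 * (L + C)\<^sup>2 / 2 ^ m)"
    proof -
      have "(\<Sum>k\<le>2 ^ m. (L2norm P (\<lambda>\<omega>. D \<omega> (dyadic T m k)))\<^sup>2) \<le> (\<Sum>k\<le>(2::nat) ^ m. \<kappa> h)"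
        using D\<kappa> dyadic_mem[OF T] by (intro sum_mono) auto
      then show ?thesis by (intro ennreal_leI) (simp add: add.commute)
    qed
    finally show ?thesis .
  qed
  show ?thesis
  proof (rule order_tendstoI)
    fix x :: ennreal assume "0 < x"
    then obtain y where y: "0 < y" "y < x" using dense by blast
    then obtain e where e: "y = ennreal e" "0 < e" by (cases y) auto
    \<comment> \<open>The order matters: \<open>m\<close> is chosen first, from \<open>T\<close>,
      \<open>L\<close>, \<open>C\<close> and \<open>e\<close> alone, and then \<open>h\<close> is
      taken so large that the factor \<open>2 ^ m + 1\<close> is harmless.\<close>
    have "(\<lambda>m. 2 * T\<^sup>2 * (L + C)\<^sup>2 * (1 / 2) ^ m) \<longlonglongrightarrow> 2 * T\<^sup>2 * (L + C)\<^sup>2 * 0"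
      by (intro tendsto_mult_left LIMSEQ_power_zero) simp
    then have "\<forall>\<^sub>F m in sequentially. 2 * T\<^sup>2 * (L + C)\<^sup>2 * (1 / 2) ^ m < e / 2"
      by (rule order_tendstoD) (use e in simp)
    then obtain m where m: "2 * T\<^sup>2 * (L + C)\<^sup>2 / 2 ^ m < e / 2"
      by (auto simp: eventually_sequentially power_divide)
    have "(\<lambda>h. 2 * ((2 ^ m + 1) * \<kappa> h)) \<longlonglongrightarrow> 2 * ((2 ^ m + 1) * 0)"
      by (intro tendsto_mult_left \<kappa>)
    then have "\<forall>\<^sub>F h in sequentially. 2 * ((2 ^ m + 1) * \<kappa> h) < e / 2"
      by (rule order_tendstoD) (use e in simp)
    then show "\<forall>\<^sub>F h in sequentially. L2C_dist2 P T (Z h) Xs < x"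
    proof eventually_elim
      case (elim h)
      have "L2C_dist2 P T (Z h) Xs \<le> ennreal (2 * ((2 ^ m + 1) * \<kappa> h) + 2 * T\<^sup>2 * (L + C)\<^sup>2 / 2 ^ m)"
        by (rule bound)
      also have "\<dots> \<le> y" unfolding e using elim m by (intro ennreal_leI) simp
      finally show ?case using y(2) by simp
    qed
  qed simp
qed

end
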